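(* Let $d\ge1$, $\alpha<1$, let $\mathbf F:S^{d-1}\to\mathbb R^d$ be continuously differentiable, and let $\mathbf G$ be a regularization function as in the context. Let $\mathbf x^\nu(t)$, $\nu>0$, be the solution of the $\nu$-regularized problem $\dot{\mathbf x}=\mathbf f^\nu(\mathbf x)$ with initial condition $\mathbf x^\nu(t_0)=\mathbf x_0=r_0\mathbf y_*$, where $r_0>0$ and $\mathbf y_*\in S^{d-1}$ satisfies $\mathbf F_s(\mathbf y_* )=\mathbf 0$ and $F_r(\mathbf y_* )<0$; let $t_b=t_0+\frac{r_0^{1-\alpha}}{(\alpha-1)F_r(\mathbf y_* )}$ be the blowup time. Assume that the regularization is expelling and that $\mathbf y_*^{esc}$ is in the basin of attraction $\mathcal B(\mathcal A')$ of an exponentially stable limit cycle $\mathcal A'=\{\tilde{\mathbf Y}_p(S):S\in[0,T)\}$ of $d\tilde{\mathbf Y}/dS=\mathbf F_s(\tilde{\mathbf Y})$ on $S^{d-1}$, with period $T$ and average $\langle F_r\rangle=\frac1T\int_0^TF_r(\tilde{\mathbf Y}_p(S))\,dS>0$. Then there is a constant $c\in\mathbb R$, depending on the regularization, such that for every fixed $\chi\in\mathbb R$ and the sequence $$\nu_n=e^{-T\langle F_r\rangle n+\chi},$$ the limit $\mathbf x(t)=\lim_{n\to\infty}\mathbf x^{\nu_n}(t)$ exists and, for all $t>t_b$, $$\mathbf x(t)=(t-t_b)^{\frac1{1-\alpha}}\,\mathbf X_p\left(\ln\left[(t-t_b)^{\frac1{1-\alpha}}\right]+\zeta\right)\quad\text{with}\quad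 \zeta=c-\chi,$$ where $\mathbf X_p$ is the $T\langle F_r\rangle$-periodic function determined by $\tilde{\mathbf Y}_p$ as described in the context.
   Context: The singular system is $\dot{\mathbf x}=\mathbf f(\mathbf x)=r^\alpha\mathbf F(\mathbf y)$, $r=|\mathbf x|$, $\mathbf y=\mathbf x/r$. Decompose $\mathbf F(\mathbf y)=F_r(\mathbf y)\,\mathbf y+\mathbf F_s(\mathbf y)$ with $F_r(\mathbf y)=\mathbf F(\mathbf y)\cdot\mathbf y$. Regularization: $\mathbf G$ is an $\mathbb R^d$-valued function on the closed unit ball such that for every $\nu>0$ the field $$\mathbf f^\nu(\mathbf x)=\begin{cases}r^\alpha\mathbf F(\mathbf x/r),& r>\nu,\\ \nu^\alpha\mathbf G(\mathbf x/\nu),& r\le\nu,\end{cases}$$ is continuously differentiable on $\mathbb R^d$. Then $\mathbf x^\nu(t)$ exists and is unique globally in time. Rescaled problem: let $\mathbf X(\tau)$ be the unique global solution of $$\frac{d\mathbf X}{d\tau}=\begin{cases}R^\alpha\mathbf F(\mathbf X/R),&R>1,\\ \mathbf G(\mathbf X),&R\le1,\end{cases}\qquad \mathbf X(\tau_{ent})=\mathbf y_*,\quad R=|\mathbf X|,$$ with $\tau_{ent}=-\frac{1}{F_r(\mathbf y_* )(\alpha-1)}$. The regularization is expelling if there is a finite $\tau_{esc}>\tau_{ent}$ with $R(\tau_{esc})=1$ and $R(\tau)>1$ for all $\tau>\tau_{esc}$; then $\mathbf y_*^{esc}:=\mathbf X(\tau_{esc})$. Limit cycle: $\tilde{\mathbf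 Y}_p(S)$ is a periodic solution, $\tilde{\mathbf Y}_p(S+T)=\tilde{\mathbf Y}_p(S)$, of $d\tilde{\mathbf Y}/dS=\mathbf F_s(\tilde{\mathbf Y})$ on $S^{d-1}$, and $\mathcal A'$ is its orbit. Exponentially stable means that all characteristic (Floquet) exponents of the linearized problem near $\tilde{\mathbf Y}_p$ (on the sphere) have negative real parts, except for the single vanishing exponent responsible for time translations. The basin $\mathcal B(\mathcal A')$ is the set of all points of $S^{d-1}$ whose trajectories approach $\mathcal A'$ asymptotically as $S\to\infty$. The function $\mathbf X_p$: set $I(S_1,S_2)=\int_{S_1}^{S_2}F_r(\tilde{\mathbf Y}_p(S))\,dS$ (with $I(S_1,S_2)=-I(S_2,S_1)$ for $S_1>S_2$), $$\varphi(s_1,s_2)=\frac1{1-\alpha}\ln\left[\int_{-\infty}^0e^{-(1-\alpha)I(s_1+s',s_2)}\,ds'\right],\quad \psi(s)=\varphi(s,0),\quad \mathbf x_p(s)=e^{-\varphi(s,s)}\tilde{\mathbf Y}_p(s).$$ When $\langle F_r\rangle>0$, the map $\psi:\mathbb R\to\mathbb R$ is invertible, and $\mathbf X_p:=\mathbf x_p\circ\psi^{-1}$. *)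

theory Defs
  imports "HOL-Analysis.Analysis"
begin

(* Continuous differentiability on an arbitrary subset (such as a sphere): the function is the
   restriction of a C1 function defined on an open neighbourhood. On UNIV this is the usual notion. *)
definition C1_on :: "'a::euclidean_space set \<Rightarrow> ('a \<Rightarrow> 'b::euclidean_space) \<Rightarrow> bool" where
  "C1_on A f \<longleftrightarrow> (\<exists>U g (g' :: 'a \<Rightarrow> 'a \<Rightarrow>\<^sub>L 'b). open U \<and> A \<subseteq> U \<and> (\<forall>x\<in>A. f x = g x) \<and>
     (\<forall>x\<in>U. (g has_derivative blinfun_apply (g' x)) (at x)) \<and> continuous_on U g')"

definition ivp_solution ::
  "('a::euclidean_space \<Rightarrow> 'a) \<Rightarrow> real \<Rightarrow> 'a \<Rightarrow> (real \<Rightarrow> 'a) \<Rightarrow> bool" where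
  "ivp_solution f t0 x0 x \<longleftrightarrow>
     x t0 = x0 \<and> (\<forall>t\<ge>t0. (x has_vector_derivative f (x t)) (at t within {t0..}))"

(* Throughout, F matters only on the unit sphere and G only on the closed unit ball. *)

definition F_rad :: "('a::euclidean_space \<Rightarrow> 'a) \<Rightarrow> 'a \<Rightarrow> real" where
  "F_rad F y = F y \<bullet> y"

definition F_sph :: "('a::euclidean_space \<Rightarrow> 'a) \<Rightarrow> 'a \<Rightarrow> 'a" where
  "F_sph F y = F y - F_rad F y *\<^sub>R y"

definition reg_field ::
  "real \<Rightarrow> ('a::euclidean_space \<Rightarrow> 'a) \<Rightarrow> ('a \<Rightarrow> 'a) \<Rightarrow> real \<Rightarrow> 'a \<Rightarrow> 'a" where
  "reg_field \<alpha> F G \<nu> x =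
     (if norm x > \<nu> then norm x powr \<alpha> *\<^sub>R F (x /\<^sub>R norm x) else \<nu> powr \<alpha> *\<^sub>R G (x /\<^sub>R \<nu>))"

definition is_regularization ::
  "real \<Rightarrow> ('a::euclidean_space \<Rightarrow> 'a) \<Rightarrow> ('a \<Rightarrow> 'a) \<Rightarrow> bool" where
  "is_regularization \<alpha> F G \<longleftrightarrow> (\<forall>\<nu>>0. C1_on UNIV (reg_field \<alpha> F G \<nu>))"

definition tau_ent :: "real \<Rightarrow> ('a::euclidean_space \<Rightarrow> 'a) \<Rightarrow> 'a \<Rightarrow> real" where
  "tau_ent \<alpha> F y = - 1 / (F_rad F y * (\<alpha> - 1))"

(* The rescaled field is the regularized field with \<nu> = 1. *)
definition rescaled_solution ::
  "real \<Rightarrow> ('a::euclidean_space \<Rightarrow> 'a) \<Rightarrow> ('a \<Rightarrow> 'a) \<Rightarrow> 'a \<Rightarrow> (real \<Rightarrow> 'a) \<Rightarrow> bool" where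
  "rescaled_solution \<alpha> F G y X \<longleftrightarrow> ivp_solution (reg_field \<alpha> F G 1) (tau_ent \<alpha> F y) y X"

(* A regularization is expelling iff its rescaled solution has an escape time, which is then unique. *)
definition escape_time ::
  "real \<Rightarrow> ('a::euclidean_space \<Rightarrow> 'a) \<Rightarrow> 'a \<Rightarrow> (real \<Rightarrow> 'a) \<Rightarrow> real \<Rightarrow> bool" where
  "escape_time \<alpha> F y X \<tau>e \<longleftrightarrow>
     \<tau>e > tau_ent \<alpha> F y \<and> norm (X \<tau>e) = 1 \<and> (\<forall>\<tau>>\<tau>e. norm (X \<tau>) > 1)"

(* T is a positive period, not required to be minimal; equilibria are excluded. *)
definition periodic_solution ::
  "('a::euclidean_space \<Rightarrow> 'a) \<Rightarrow> (real \<Rightarrow> 'a) \<Rightarrow> real \<Rightarrow> bool" where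
  "periodic_solution F Y T \<longleftrightarrow>
     T > 0 \<and> (\<forall>S. Y S \<in> sphere 0 1) \<and>
     (\<forall>S. (Y has_vector_derivative F_sph F (Y S)) (at S)) \<and>
     (\<forall>S. Y (S + T) = Y S) \<and> (\<exists>S. Y S \<noteq> Y 0)"

definition orbit :: "(real \<Rightarrow> 'a) \<Rightarrow> real \<Rightarrow> 'a set" where
  "orbit Y T = Y ` {0..<T}"

(* On vectors tangent to the sphere, the derivative of the extension of F_sph that is constant
   along rays is the derivative of F_sph along the sphere. *)
definition linearized_solution ::
  "('a::euclidean_space \<Rightarrow> 'a) \<Rightarrow> (real \<Rightarrow> 'a) \<Rightarrow> (real \<Rightarrow> 'a) \<Rightarrow> bool" where
  "linearized_solution F Y \<eta> \<longleftrightarrow>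
     (\<forall>S. \<eta> S \<bullet> Y S = 0 \<and>
       (\<eta> has_vector_derivative
          frechet_derivative (\<lambda>x. F_sph F (x /\<^sub>R norm x)) (at (Y S)) (\<eta> S)) (at S))"

definition tangent_space :: "'a::euclidean_space \<Rightarrow> 'a set" where
  "tangent_space y = {w. w \<bullet> y = 0}"

(* Meaningful for w in tangent_space (Y 0). *)
definition monodromy ::
  "('a::euclidean_space \<Rightarrow> 'a) \<Rightarrow> (real \<Rightarrow> 'a) \<Rightarrow> real \<Rightarrow> 'a \<Rightarrow> 'a" where
  "monodromy F Y T w = (THE \<eta>. linearized_solution F Y \<eta> \<and> \<eta> 0 = w) T"

(* exp (\<mu> * T) is an eigenvalue of the complexified monodromy map, with eigenvector u + i v. *)
definition floquet_exponent ::
  "('a::euclidean_space \<Rightarrow> 'a) \<Rightarrow> (real \<Rightarrow> 'a) \<Rightarrow> real \<Rightarrow> complex \<Rightarrow> bool" where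
  "floquet_exponent F Y T \<mu> \<longleftrightarrow>
     (let \<rho> = exp (\<mu> * of_real T); M = monodromy F Y T; V = tangent_space (Y 0) in
       \<exists>u\<in>V. \<exists>v\<in>V. (u \<noteq> 0 \<or> v \<noteq> 0) \<and>
         M u = Re \<rho> *\<^sub>R u - Im \<rho> *\<^sub>R v \<and> M v = Im \<rho> *\<^sub>R u + Re \<rho> *\<^sub>R v)"

(* Algebraic multiplicity of the Floquet multiplier 1: dimension of its generalized eigenspace. *)
definition zero_exponent_multiplicity ::
  "('a::euclidean_space \<Rightarrow> 'a) \<Rightarrow> (real \<Rightarrow> 'a) \<Rightarrow> real \<Rightarrow> nat" where
  "zero_exponent_multiplicity F Y T =
     dim {w \<in> tangent_space (Y 0). ((\<lambda>z. monodromy F Y T z - z) ^^ DIM('a)) w = 0}"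

(* Floquet exponents are determined only modulo 2 pi i / T, so an exponent vanishes iff its
   multiplier is 1. *)
definition exponentially_stable ::
  "('a::euclidean_space \<Rightarrow> 'a) \<Rightarrow> (real \<Rightarrow> 'a) \<Rightarrow> real \<Rightarrow> bool" where
  "exponentially_stable F Y T \<longleftrightarrow>
     (\<forall>\<mu>. floquet_exponent F Y T \<mu> \<longrightarrow> exp (\<mu> * of_real T) = 1 \<or> Re \<mu> < 0) \<and>
     zero_exponent_multiplicity F Y T = 1"

definition basin :: "('a::euclidean_space \<Rightarrow> 'a) \<Rightarrow> 'a set \<Rightarrow> 'a set" where
  "basin F A = {y \<in> sphere 0 1. \<exists>Y. ivp_solution (F_sph F) 0 y Y \<and>
     (\<forall>S\<ge>0. Y S \<in> sphere 0 1) \<and> ((\<lambda>S. infdist (Y S) A) \<longlongrightarrow> 0) at_top}"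

definition avg_F_rad :: "('a::euclidean_space \<Rightarrow> 'a) \<Rightarrow> (real \<Rightarrow> 'a) \<Rightarrow> real \<Rightarrow> real" where
  "avg_F_rad F Y T = 1 / T * integral {0..T} (\<lambda>S. F_rad F (Y S))"

definition I_int :: "('a::euclidean_space \<Rightarrow> 'a) \<Rightarrow> (real \<Rightarrow> 'a) \<Rightarrow> real \<Rightarrow> real \<Rightarrow> real" where
  "I_int F Y S1 S2 =
     (if S1 \<le> S2 then integral {S1..S2} (\<lambda>S. F_rad F (Y S))
      else - integral {S2..S1} (\<lambda>S. F_rad F (Y S)))"

definition phi_fun ::
  "real \<Rightarrow> ('a::euclidean_space \<Rightarrow> 'a) \<Rightarrow> (real \<Rightarrow> 'a) \<Rightarrow> real \<Rightarrow> real \<Rightarrow> real" where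
  "phi_fun \<alpha> F Y s1 s2 =
     1 / (1 - \<alpha>) * ln (integral {..0} (\<lambda>s'. exp (- (1 - \<alpha>) * I_int F Y (s1 + s') s2)))"

definition psi_fun :: "real \<Rightarrow> ('a::euclidean_space \<Rightarrow> 'a) \<Rightarrow> (real \<Rightarrow> 'a) \<Rightarrow> real \<Rightarrow> real" where
  "psi_fun \<alpha> F Y s = phi_fun \<alpha> F Y s 0"

definition x_p :: "real \<Rightarrow> ('a::euclidean_space \<Rightarrow> 'a) \<Rightarrow> (real \<Rightarrow> 'a) \<Rightarrow> real \<Rightarrow> 'a" where
  "x_p \<alpha> F Y s = exp (- phi_fun \<alpha> F Y s s) *\<^sub>R Y s"

(* Meaningful when the average of F_rad over the cycle is positive: then psi_fun is a bijection
   of the real line. *)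
definition X_p :: "real \<Rightarrow> ('a::euclidean_space \<Rightarrow> 'a) \<Rightarrow> (real \<Rightarrow> 'a) \<Rightarrow> real \<Rightarrow> 'a" where
  "X_p \<alpha> F Y = x_p \<alpha> F Y \<circ> inv (psi_fun \<alpha> F Y)"

end

theory Submission
  imports Defs "HOL-Computational_Algebra.Fundamental_Theorem_Algebra"
begin

text \<open>
  The fields are homogeneous, so \<open>x\<^sup>\<nu>(t) = \<nu> X((t - t\<^sub>b) / \<nu>\<^bsup>1-\<alpha>\<^esup>)\<close> once the solution has entered the
  ball of radius \<open>\<nu>\<close>, and the theorem is a statement on \<open>X(\<tau>)\<close> as \<open>\<tau> \<rightarrow> \<infinity>\<close>. After escape,
  \<open>X(\<tau>(S)) = \<rho>(S) Y(S)\<close> with \<open>Y\<close> a trajectory on the sphere, \<open>\<rho> = exp \<integral> F\<^sub>r(Y) dS\<close> and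
  \<open>d\<tau>/dS = \<rho>\<^bsup>1-\<alpha>\<^esup>\<close>. Exponential stability gives an asymptotic phase,
  \<open>Y(S) = Y\<^sub>p(S + \<theta>) + O(e\<^bsup>-\<kappa>S\<^esup>)\<close>, so \<open>\<rho>\<close> agrees up to a convergent factor with its value along the
  cycle, and l'Hopital's rule compares \<open>\<tau>(S)\<close> with \<open>W(s) = \<integral>\<^bsub>-\<infinity>\<^esub>\<^bsup>s\<^esup> exp((1-\<alpha>) I(0,u)) du\<close> at
  \<open>s = S + \<theta>\<close>. Since \<open>\<psi> = ln W / (1-\<alpha>)\<close>, this yields
  \<open>X(\<tau>) / \<tau>\<^bsup>1/(1-\<alpha>)\<^esup> - X\<^sub>p(ln \<tau> / (1-\<alpha>) + c) \<rightarrow> 0\<close>; along \<open>\<nu>\<^sub>n\<close> the argument of \<open>X\<^sub>p\<close> only moves by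
  whole periods.

  The asymptotic phase comes from a section through \<open>Y\<^sub>p(0)\<close> whose normal \<open>a\<close> is a left eigenvector of
  the monodromy \<open>M\<close> for the multiplier 1. Some power of \<open>M\<close> halves the vectors orthogonal to \<open>a\<close>, so
  successive hits of the section contract geometrically and the return times converge geometrically
  to a multiple of the period.
\<close>

text \<open>The nonlinear solutions are all given, by the hypotheses and by the definition of the
  basin, so for them only uniqueness is at stake; the one equation that has to be solved is the
  linearization along the cycle.

  Mere convergence to the cycle would not do. The constant \<open>c\<close> is minus the limit of
  the difference between the logarithmic radius of the trajectory and that of the phase-shifted
  cycle. This difference is an integral of \<open>F_r\<close> differences over unbounded time, and
  the exponential rate is what makes it converge. The phase shift enters \<open>c\<close> only
  through this limit, because radius and elapsed time are compared with the cycle at the same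
  shifted parameter.

  A left eigenvector is chosen as normal so that the linearized return maps the section into itself.
  The correction of the hitting time is then of higher order, and the contraction of the linear map
  passes to the nonlinear return.

  \<open>F\<close> is known on the sphere only; its derivatives are read off the regularized field
  with \<open>\<nu> = 1 / 2\<close>, which on a neighbourhood of the sphere is the homogeneous
  extension of \<open>F\<close>.\<close>

section \<open>Ordinary differential equations and periodic functions\<close>

text \<open>The squared norm stays differentiable where \<open>u\<close> vanishes, and weighted by
  \<open>exp (- 2 * L * t)\<close> it cannot increase. Derivatives are asked for in the interior
  only, which suits solutions that have a one-sided derivative at the start.\<close>

lemma gronwall_homogeneous:
  fixes u :: "real \<Rightarrow> 'b::real_inner"
  assumes "a \<le> b" and cont: "continuous_on {a..b} u"
    and der: "\<And>t. a < t \<Longrightarrow> t < b \<Longrightarrow> (u has_vector_derivative u' t) (at t)"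
    and bnd: "\<And>t. a < t \<Longrightarrow> t < b \<Longrightarrow> norm (u' t) \<le> L * norm (u t)"
  shows "norm (u b) \<le> norm (u a) * exp (L * (b - a))"
proof -
  define v where "v t = (u t \<bullet> u t) * exp (- 2 * L * t)" for t
  have "v b \<le> v a"
  proof (rule DERIV_nonpos_imp_decreasing_open[OF \<open>a \<le> b\<close>])
    fix t assume t: "a < t" "t < b"
    have "(v has_real_derivative (2 * (u t \<bullet> u' t) - 2 * L * (u t \<bullet> u t)) * exp (- 2 * L * t)) (at t)"
      unfolding v_def
      using der[OF t] unfolding has_vector_derivative_def has_field_derivative_def
      by (auto intro!: derivative_eq_intros simp: algebra_simps inner_commute)
    moreover have "u t \<bullet> u' t \<le> L * (u t \<bullet> u t)"
    proof -
      have "u t \<bullet> u' t \<le> norm (u t) * norm (u' t)" by (rule norm_cauchy_schwarz)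
      also have "\<dots> \<le> norm (u t) * (L * norm (u t))"
        by (intro mult_left_mono bnd t) auto
      finally show ?thesis by (simp add: dot_square_norm power2_eq_square mult_ac)
    qed
    ultimately show "\<exists>y. (v has_real_derivative y) (at t) \<and> y \<le> 0"
      by (intro exI[of _ "(2 * (u t \<bullet> u' t) - 2 * L * (u t \<bullet> u t)) * exp (- 2 * L * t)"])
         (auto intro: mult_nonpos_nonneg)
  next
    show "continuous_on {a..b} v"
      unfolding v_def by (intro continuous_intros cont)
  qed
  then have "(norm (u b))\<^sup>2 * exp (- 2 * L * b) * exp (2 * L * b)
      \<le> (norm (u a))\<^sup>2 * exp (- 2 * L * a) * exp (2 * L * b)"
    by (simp add: v_def dot_square_norm)
  also have "(norm (u b))\<^sup>2 * exp (- 2 * L * b) * exp (2 * L * b) = (norm (u b))\<^sup>2"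
    by (simp add: mult.assoc flip: exp_add)
  also have "(norm (u a))\<^sup>2 * exp (- 2 * L * a) * exp (2 * L * b) = (norm (u a) * exp (L * (b - a)))\<^sup>2"
    by (simp add: power_mult_distrib mult.assoc power2_eq_square algebra_simps flip: exp_add)
  finally show ?thesis by (rule power2_le_imp_le) auto
qed

text \<open>Appending the constant coordinate \<open>K / L\<close> to \<open>u\<close> absorbs the
  inhomogeneity: \<open>K = L * (K / L)\<close> is at most \<open>L\<close> times the norm of the
  pair, whence the rate \<open>2 * L\<close>.\<close>

lemma gronwall_zero_start:
  fixes u :: "real \<Rightarrow> 'b::real_inner"
  assumes "a \<le> b" and cont: "continuous_on {a..b} u"
    and der: "\<And>t. a < t \<Longrightarrow> t < b \<Longrightarrow> (u has_vector_derivative u' t) (at t)"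
    and bnd: "\<And>t. a < t \<Longrightarrow> t < b \<Longrightarrow> norm (u' t) \<le> L * norm (u t) + K"
    and "u a = 0" "L > 0" "K \<ge> 0"
  shows "norm (u b) \<le> K / L * exp (2 * L * (b - a))"
proof -
  define U where "U t = (u t, K / L)" for t
  have n: "norm (U b) \<le> norm (U a) * exp (2 * L * (b - a))"
  proof (rule gronwall_homogeneous[OF \<open>a \<le> b\<close>])
    show "continuous_on {a..b} U" unfolding U_def by (intro continuous_intros cont)
  next
    fix t assume t: "a < t" "t < b"
    show "(U has_vector_derivative (u' t, 0)) (at t)"
      unfolding U_def using der[OF t] by (auto intro!: derivative_eq_intros)
    have "norm (u' t, 0::real) \<le> L * (norm (u t) + K / L)"
      using bnd[OF t] \<open>L > 0\<close> by (simp add: norm_Pair distrib_left)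
    also have "\<dots> \<le> L * (norm (U t) + norm (U t))"
      using \<open>L > 0\<close> \<open>K \<ge> 0\<close> norm_fst_le[of "u t" "K/L"] norm_snd_le[of "K/L" "u t"]
      unfolding U_def by (intro mult_left_mono add_mono) auto
    finally show "norm (u' t, 0::real) \<le> 2 * L * norm (U t)" by simp
  qed
  have "norm (u b) \<le> norm (U b)" unfolding U_def by (rule norm_fst_le)
  also note n
  also have "norm (U a) = K / L" using assms by (simp add: U_def norm_Pair)
  finally show ?thesis .
qed

definition lipschitz_on_compacts :: "'a::metric_space set \<Rightarrow> ('a \<Rightarrow> 'b::metric_space) \<Rightarrow> bool" where
  "lipschitz_on_compacts U f \<longleftrightarrow> (\<forall>K\<subseteq>U. compact K \<longrightarrow> (\<exists>L. L-lipschitz_on K f))"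

lemma C1_lipschitz_on_compacts:
  fixes f :: "'a::euclidean_space \<Rightarrow> 'a"
  assumes der: "\<And>x. x \<in> U \<Longrightarrow> (f has_derivative blinfun_apply (g' x)) (at x)"
    and cont: "continuous_on U g'" and "open U"
  shows "lipschitz_on_compacts U f"
  unfolding lipschitz_on_compacts_def
proof safe
  fix K :: "'a set" assume K: "compact K" "K \<subseteq> U"
  have "local_lipschitz UNIV U (\<lambda>t::real. f)"
    by (rule c1_implies_local_lipschitz[where f'="\<lambda>(t, x). g' x"])
       (auto intro!: der \<open>open U\<close> continuous_on_compose2[OF cont] continuous_intros simp: case_prod_beta)
  then have "local_lipschitz {0::real} K (\<lambda>t::real. f)"
    by (rule local_lipschitz_subset) (use K in auto)
  then obtain L where "\<And>t. t \<in> {0::real} \<Longrightarrow> L-lipschitz_on K f"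
    using local_lipschitz_compact_implies_lipschitz[where X = K and T = "{0::real}" and f = "\<lambda>t. f"] K by auto
  then show "\<exists>L. L-lipschitz_on K f" by auto
qed

lemma C1_UNIV_lipschitz_on_compacts:
  fixes f :: "'a::euclidean_space \<Rightarrow> 'a"
  assumes "C1_on UNIV f"
  shows "lipschitz_on_compacts UNIV f"
proof -
  obtain U g and g' :: "'a \<Rightarrow> 'a \<Rightarrow>\<^sub>L 'a" where "UNIV \<subseteq> U" "\<forall>x\<in>UNIV. f x = g x"
    "\<forall>x\<in>U. (g has_derivative blinfun_apply (g' x)) (at x)" "continuous_on U g'"
    using assms unfolding C1_on_def by blast
  moreover from this have "f = g" "U = UNIV" by auto
  ultimately show ?thesis by (intro C1_lipschitz_on_compacts[of UNIV f g']) auto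
qed

text \<open>The scalar factor \<open>g\<close> admits time changes: it is 1 for the regularized
  problem and \<open>d\<tau>/dS\<close> for the comparison after escape. The Lipschitz constant is
  taken on the union of the two compact arcs.\<close>

lemma ode_uniqueness:
  fixes x z :: "real \<Rightarrow> 'b::real_inner"
  assumes lip: "lipschitz_on_compacts U f"
    and "a \<le> b" and cx: "continuous_on {a..b} x" and cz: "continuous_on {a..b} z"
    and cg: "continuous_on {a..b} g"
    and dx: "\<And>t. a < t \<Longrightarrow> t < b \<Longrightarrow> (x has_vector_derivative g t *\<^sub>R f (x t)) (at t)"
    and dz: "\<And>t. a < t \<Longrightarrow> t < b \<Longrightarrow> (z has_vector_derivative g t *\<^sub>R f (z t)) (at t)"
    and U: "x ` {a..b} \<subseteq> U" "z ` {a..b} \<subseteq> U"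
    and "x a = z a"
  shows "x b = z b"
proof -
  have "compact (x ` {a..b} \<union> z ` {a..b})"
    by (intro compact_Un compact_continuous_image cx cz compact_Icc)
  then obtain L where L: "L-lipschitz_on (x ` {a..b} \<union> z ` {a..b}) f"
    using lip U unfolding lipschitz_on_compacts_def by (metis Un_subset_iff)
  have "bounded (g ` {a..b})"
    by (intro compact_imp_bounded compact_continuous_image cg compact_Icc)
  then obtain C where C: "\<And>t. t \<in> {a..b} \<Longrightarrow> \<bar>g t\<bar> \<le> C"
    unfolding bounded_iff real_norm_def by (metis imageI)
  have "norm (x b - z b) \<le> norm (x a - z a) * exp (C * L * (b - a))"
  proof (rule gronwall_homogeneous[where u = "\<lambda>t. x t - z t" and u' = "\<lambda>t. g t *\<^sub>R f (x t) - g t *\<^sub>R f (z t)", OF \<open>a \<le> b\<close>])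
    show "continuous_on {a..b} (\<lambda>t. x t - z t)" by (intro continuous_intros cx cz)
  next
    fix t assume t: "a < t" "t < b"
    show "((\<lambda>t. x t - z t) has_vector_derivative g t *\<^sub>R f (x t) - g t *\<^sub>R f (z t)) (at t)"
      by (intro derivative_intros dx dz t)
    have "norm (g t *\<^sub>R f (x t) - g t *\<^sub>R f (z t)) = \<bar>g t\<bar> * dist (f (x t)) (f (z t))"
      by (simp add: dist_norm flip: scaleR_diff_right)
    also have "\<dots> \<le> C * (L * dist (x t) (z t))"
      using t C[of t] by (intro mult_mono lipschitz_onD[OF L]) auto
    finally show "norm (g t *\<^sub>R f (x t) - g t *\<^sub>R f (z t)) \<le> C * L * norm (x t - z t)"
      by (simp add: dist_norm mult_ac)
  qed
  then show ?thesis using \<open>x a = z a\<close> by simp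
qed

section \<open>Periodic functions of a real variable\<close>

lemma periodic_shift_nat:
  assumes "\<And>x::real. f (x + p) = f x"
  shows "f (x + real n * p) = f x"
proof (induction n)
  case (Suc n)
  have "f (x + real (Suc n) * p) = f ((x + real n * p) + p)" by (simp add: algebra_simps)
  then show ?case using Suc assms by simp
qed simp

lemma periodic_shift_int:
  assumes "\<And>x::real. f (x + p) = f x"
  shows "f (x + of_int n * p) = f x"
proof (cases n)
  case (nonneg m)
  then show ?thesis using periodic_shift_nat[of f p x m, OF assms] by simp
next
  case (neg m)
  have "f (x + of_int n * p) = f ((x + of_int n * p) + real (Suc m) * p)"
    using periodic_shift_nat[of f p, OF assms] by metis
  also have "(x + of_int n * p) + real (Suc m) * p = x"
    unfolding neg by (simp add: algebra_simps)
  finally show ?thesis .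
qed

lemma real_reduce_period:
  fixes x p :: real
  assumes "p > 0"
  obtains n :: int where "0 \<le> x + of_int n * p" "x + of_int n * p < p"
proof
  have "of_int \<lfloor>x / p\<rfloor> * p \<le> x / p * p" "x / p * p < (of_int \<lfloor>x / p\<rfloor> + 1) * p"
    using assms by (intro mult_right_mono mult_strict_right_mono; linarith)+
  then show "0 \<le> x + of_int (- \<lfloor>x / p\<rfloor>) * p" "x + of_int (- \<lfloor>x / p\<rfloor>) * p < p"
    using assms by (simp_all add: algebra_simps)
qed

lemma periodic_continuous_bounded:
  fixes f :: "real \<Rightarrow> 'b::real_normed_vector"
  assumes "continuous_on UNIV f" "p > 0" and per: "\<And>x. f (x + p) = f x"
  obtains C where "C > 0" "\<And>x. norm (f x) \<le> C"
proof -
  have "bounded (f ` {0..p})"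
    using assms by (intro compact_imp_bounded compact_continuous_image) (auto intro: continuous_on_subset)
  then obtain C where C: "C > 0" "\<And>x. x \<in> {0..p} \<Longrightarrow> norm (f x) \<le> C"
    unfolding bounded_pos by auto
  have "norm (f x) \<le> C" for x
  proof -
    obtain n where "0 \<le> x + of_int n * p" "x + of_int n * p < p"
      using real_reduce_period[OF \<open>p > 0\<close>] .
    then show ?thesis
      using C(2)[of "x + of_int n * p"] periodic_shift_int[of f p x n, OF per] by auto
  qed
  with C that show thesis by blast
qed

lemma periodic_continuous_uniformly_continuous:
  fixes f :: "real \<Rightarrow> 'b::metric_space"
  assumes cont: "continuous_on UNIV f" and "p > 0" and per: "\<And>x. f (x + p) = f x"
  shows "uniformly_continuous_on UNIV f"
  unfolding uniformly_continuous_on_def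
proof (intro allI impI)
  fix e :: real assume "e > 0"
  \<comment> \<open>The margin of 1 on either side keeps \<open>y\<close> inside the interval once
    \<open>x\<close> has been moved into one period.\<close>
  have "uniformly_continuous_on {-1..p+1} f"
    by (intro compact_uniformly_continuous continuous_on_subset[OF cont]) auto
  then obtain d where d: "d > 0"
    "\<And>x y. x \<in> {-1..p+1} \<Longrightarrow> y \<in> {-1..p+1} \<Longrightarrow> dist y x < d \<Longrightarrow> dist (f y) (f x) < e"
    unfolding uniformly_continuous_on_def using \<open>e > 0\<close> by metis
  show "\<exists>d>0. \<forall>x\<in>UNIV. \<forall>x'\<in>UNIV. dist x' x < d \<longrightarrow> dist (f x') (f x) < e"
  proof (intro exI[of _ "min d 1"] conjI ballI impI)
    fix x y :: real assume xy: "dist y x < min d 1"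
    obtain n where n: "0 \<le> x + of_int n * p" "x + of_int n * p < p"
      using real_reduce_period[OF \<open>p > 0\<close>] .
    have "dist (f (y + of_int n * p)) (f (x + of_int n * p)) < e"
      using n xy by (intro d(2)) (auto simp: dist_real_def)
    then show "dist (f y) (f x) < e"
      by (simp add: periodic_shift_int[of f p, OF per])
  qed (use d in auto)
qed

section \<open>Linear equations on the whole line\<close>

text \<open>The case split copies that of \<open>I_int\<close>, so that the two agree by
  unfolding.\<close>

definition oriented_integral :: "(real \<Rightarrow> 'b::banach) \<Rightarrow> real \<Rightarrow> real \<Rightarrow> 'b" where
  "oriented_integral g a b = (if a \<le> b then integral {a..b} g else - integral {b..a} g)"

lemma oriented_integral_from_left:
  fixes g :: "real \<Rightarrow> 'b::banach"
  assumes cont: "continuous_on UNIV g" and "c \<le> a" "c \<le> b"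
  shows "oriented_integral g a b = integral {c..b} g - integral {c..a} g"
proof (cases "a \<le> b")
  case True
  have "integral {c..a} g + integral {a..b} g = integral {c..b} g"
    using assms True by (intro Henstock_Kurzweil_Integration.integral_combine integrable_continuous_real continuous_on_subset[OF cont]) auto
  then show ?thesis using True by (simp add: oriented_integral_def algebra_simps)
next
  case False
  have "integral {c..b} g + integral {b..a} g = integral {c..a} g"
    using assms False by (intro Henstock_Kurzweil_Integration.integral_combine integrable_continuous_real continuous_on_subset[OF cont]) auto
  then show ?thesis using False by (simp add: oriented_integral_def algebra_simps)
qed

lemma oriented_integral_has_vector_derivative:
  fixes g :: "real \<Rightarrow> 'b::banach"
  assumes cont: "continuous_on UNIV g"
  shows "(oriented_integral g a has_vector_derivative g s) (at s)"
proof -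
  define c where "c = min a s - 1"
  have "((\<lambda>s. integral {c..s} g) has_vector_derivative g s) (at s within {c..s+1})"
    by (rule integral_has_vector_derivative) (auto intro: continuous_on_subset[OF cont] simp: c_def)
  then have "((\<lambda>s. integral {c..s} g) has_vector_derivative g s) (at s)"
    by (subst (asm) at_within_interior) (auto simp: c_def)
  then have "((\<lambda>s. integral {c..s} g - integral {c..a} g) has_vector_derivative g s) (at s)"
    by (auto intro!: derivative_eq_intros)
  then show ?thesis
  proof (rule has_vector_derivative_transform_within_open[where S="{c<..}"])
    fix t assume "t \<in> {c<..}"
    then show "integral {c..t} g - integral {c..a} g = oriented_integral g a t"
      by (subst oriented_integral_from_left[OF cont, of c]) (auto simp: c_def)
  qed (auto simp: c_def)
qed

lemma oriented_integral_refl [simp]: "oriented_integral g a a = 0"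
  by (simp add: oriented_integral_def)

text \<open>Integrating a function of growth \<open>exp (k * \<bar>s\<bar>)\<close> gains the factor
  \<open>1 / k\<close>; this is what makes Picard's operator a contraction. Negative times follow by
  reflection.\<close>

lemma oriented_integral_bound:
  fixes g :: "real \<Rightarrow> 'b::banach"
  assumes cont: "continuous_on UNIV g" and "k > 0" "M \<ge> 0"
    and bnd: "\<And>s. norm (g s) \<le> M * k * exp (k * \<bar>s\<bar>)"
  shows "norm (oriented_integral g 0 s) \<le> M * exp (k * \<bar>s\<bar>)"
proof -
  have *: "norm (G s) \<le> M * exp (k * s)"
    if "s > 0" "G 0 = 0" "\<And>s. (G has_vector_derivative g' s) (at s)"
      "\<And>s. norm (g' s) \<le> M * k * exp (k * \<bar>s\<bar>)" for G g' :: "real \<Rightarrow> 'b" and s :: real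
  proof -
    have "norm (G s - G 0) \<le> M * exp (k * s) - M * exp (k * 0)"
    proof (rule differentiable_bound_general[where f' = g' and \<phi>' = "\<lambda>s. M * k * exp (k * s)"])
      show "continuous_on {0..s} G"
        using that(3) by (auto intro!: continuous_at_imp_continuous_on has_vector_derivative_continuous)
      fix x assume "0 < x" "x < s"
      then show "norm (g' x) \<le> M * k * exp (k * x)" using that(4)[of x] by simp
      show "((\<lambda>s. M * exp (k * s)) has_vector_derivative M * k * exp (k * x)) (at x)"
        by (auto intro!: derivative_eq_intros simp flip: has_real_derivative_iff_has_vector_derivative)
    qed (use that in \<open>auto intro!: continuous_intros\<close>)
    then show ?thesis using that \<open>M \<ge> 0\<close> by simp
  qed
  note d = oriented_integral_has_vector_derivative[OF cont, of 0]
  consider "s = 0" | "s > 0" | "s < 0" by linarith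
  then show ?thesis
  proof cases
    case 1 then show ?thesis using \<open>M \<ge> 0\<close> by simp
  next
    case 2 then show ?thesis using *[OF 2 _ d bnd] by simp
  next
    case 3
    have "norm (oriented_integral g 0 (- (- s))) \<le> M * exp (k * (- s))"
    proof (rule *[where G = "\<lambda>s. oriented_integral g 0 (- s)" and g' = "\<lambda>s. - g (- s)"])
      show "((\<lambda>s. oriented_integral g 0 (- s)) has_vector_derivative - g (- s)) (at s)" for s
        using vector_diff_chain_at[OF has_vector_derivative_minus[OF has_vector_derivative_id] d, of s]
        by (simp add: o_def)
      show "norm (- g (- s)) \<le> M * k * exp (k * \<bar>s\<bar>)" for s using bnd[of "- s"] by simp
    qed (use 3 in auto)
    then show ?thesis using 3 by simp
  qed
qed

text \<open>Picard iteration in a sup norm with weight \<open>exp (- k * \<bar>s\<bar>)\<close>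
  contracts on the whole line at once, so no local solutions have to be glued. The space is an
  arbitrary Banach space because the equation is later solved for operators.\<close>

lemma linear_ode_exists:
  fixes f :: "real \<Rightarrow> 'b::banach \<Rightarrow> 'b"
  assumes lin: "\<And>s. linear (f s)" and bnd: "\<And>s z. norm (f s z) \<le> L * norm z"
    and cont: "\<And>z. continuous_on UNIV z \<Longrightarrow> continuous_on UNIV (\<lambda>s. f s (z s))"
  shows "\<exists>z. z 0 = w \<and> (\<forall>s. (z has_vector_derivative f s (z s)) (at s))"
proof -
  \<comment> \<open>\<open>\<bar>L\<bar> \<le> k / 2\<close> gives the contraction factor 1/2; the
    summand 1 keeps \<open>k\<close> positive when \<open>L = 0\<close>.\<close>
  define k where "k = 2 * (\<bar>L\<bar> + 1)"
  have k: "k > 0" "\<bar>L\<bar> \<le> k / 2" unfolding k_def by auto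
  \<comment> \<open>The fixed point is sought among bounded functions \<open>z\<close>;
    \<open>v z\<close> removes the weight and is the candidate solution.\<close>
  define v where "v z s = exp (k * \<bar>s\<bar>) *\<^sub>R apply_bcontfun z s" for z :: "real \<Rightarrow>\<^sub>C 'b" and s
  have cf: "continuous_on UNIV (\<lambda>s. f s (v z s))" for z
    unfolding v_def by (intro cont continuous_intros) auto
  have small: "norm (oriented_integral (\<lambda>s. f s (v z s)) 0 s) \<le> norm z / 2 * exp (k * \<bar>s\<bar>)" for z s
  proof (rule oriented_integral_bound[OF cf \<open>k > 0\<close>])
    fix s
    have "norm (f s (v z s)) \<le> L * norm (v z s)" by (rule bnd)
    also have "\<dots> \<le> (k / 2) * norm (v z s)" using k by (intro mult_right_mono) auto
    also have "\<dots> \<le> (k / 2) * (exp (k * \<bar>s\<bar>) * norm z)"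
      using k unfolding v_def by (intro mult_left_mono) (auto intro: norm_bounded)
    finally show "norm (f s (v z s)) \<le> norm z / 2 * k * exp (k * \<bar>s\<bar>)" by (simp add: mult_ac)
  qed auto
  define Op where "Op z s = exp (- k * \<bar>s\<bar>) *\<^sub>R (w + oriented_integral (\<lambda>s. f s (v z s)) 0 s)" for z s
  have Op_cont: "continuous_on UNIV (Op z)" for z
  proof -
    have "continuous_on UNIV (oriented_integral (\<lambda>s. f s (v z s)) 0)"
      using oriented_integral_has_vector_derivative[OF cf]
      by (auto intro!: continuous_at_imp_continuous_on has_vector_derivative_continuous)
    then show ?thesis unfolding Op_def[abs_def] by (intro continuous_intros) auto
  qed
  have Op_bcont: "Op z \<in> bcontfun" for z
  proof (rule bcontfun_normI[OF Op_cont])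
    fix s
    have "norm (w + oriented_integral (\<lambda>s. f s (v z s)) 0 s) \<le> norm w * exp (k * \<bar>s\<bar>) + norm z / 2 * exp (k * \<bar>s\<bar>)"
      using \<open>k > 0\<close> by (intro norm_triangle_le add_mono small) (auto intro!: mult_right_mono[of 1, simplified mult_1_left] simp: mult_le_cancel_left1)
    then have "exp (- k * \<bar>s\<bar>) * norm (w + oriented_integral (\<lambda>s. f s (v z s)) 0 s)
        \<le> exp (- k * \<bar>s\<bar>) * (norm w * exp (k * \<bar>s\<bar>) + norm z / 2 * exp (k * \<bar>s\<bar>))"
      by (intro mult_left_mono) auto
    also have "\<dots> = norm w + norm z / 2" by (simp add: distrib_left exp_minus field_simps)
    finally show "norm (Op z s) \<le> norm w + norm z / 2" by (simp add: Op_def)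
  qed
  have diff: "dist (Bcontfun (Op z1)) (Bcontfun (Op z2)) \<le> 1 / 2 * dist z1 z2" for z1 z2
  proof (rule dist_bound)
    fix s
    have "oriented_integral (\<lambda>s. f s (v z1 s)) 0 s - oriented_integral (\<lambda>s. f s (v z2 s)) 0 s
      = oriented_integral (\<lambda>s. f s (v z1 s) - f s (v z2 s)) 0 s"
    proof -
      have int: "(\<lambda>s. f s (v z s)) integrable_on {a..b}" for z a b
        by (intro integrable_continuous_real continuous_on_subset[OF cf]) auto
      show ?thesis
        unfolding oriented_integral_def by (simp add: Henstock_Kurzweil_Integration.integral_diff[OF int int])
    qed
    also have "(\<lambda>s. f s (v z1 s) - f s (v z2 s)) = (\<lambda>s. f s (v (z1 - z2) s))"
      by (simp add: v_def linear_diff[OF lin, symmetric] scaleR_diff_right fun_eq_iff)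
    finally have eq: "Op z1 s - Op z2 s = exp (- k * \<bar>s\<bar>) *\<^sub>R oriented_integral (\<lambda>s. f s (v (z1 - z2) s)) 0 s"
      unfolding Op_def by (simp flip: scaleR_diff_right)
    have "norm (Op z1 s - Op z2 s) \<le> exp (- k * \<bar>s\<bar>) * (norm (z1 - z2) / 2 * exp (k * \<bar>s\<bar>))"
      unfolding eq using small by simp
    also have "\<dots> = norm (z1 - z2) / 2" by (simp add: exp_minus field_simps)
    finally show "dist (apply_bcontfun (Bcontfun (Op z1)) s) (apply_bcontfun (Bcontfun (Op z2)) s) \<le> 1 / 2 * dist z1 z2"
      by (simp add: Bcontfun_inverse Op_bcont dist_norm)
  qed
  have "\<exists>!z. Bcontfun (Op z) = z"
    by (rule banach_fix_type[where c = "1/2"]) (use diff in auto)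
  then obtain z where z: "Bcontfun (Op z) = z" by blast
  have vz: "v z s = w + oriented_integral (\<lambda>s. f s (v z s)) 0 s" for s
  proof -
    have "apply_bcontfun z s = Op z s" by (metis z Bcontfun_inverse Op_bcont)
    then have "v z s = exp (k * \<bar>s\<bar>) *\<^sub>R Op z s" by (simp add: v_def)
    then show ?thesis by (simp add: Op_def flip: exp_add)
  qed
  have "(v z has_vector_derivative f s (v z s)) (at s)" for s
  proof -
    have "((\<lambda>s. w + oriented_integral (\<lambda>s. f s (v z s)) 0 s) has_vector_derivative f s (v z s)) (at s)"
      using oriented_integral_has_vector_derivative[OF cf[of z], of 0 s] by (auto intro!: derivative_eq_intros)
    then show ?thesis by (simp flip: vz)
  qed
  moreover have "v z 0 = w" using vz[of 0] by simp
  ultimately show ?thesis by blast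
qed

text \<open>Solving in the space of operators makes \<open>\<Phi> s w\<close> linear in
  \<open>w\<close> without further argument.\<close>

lemma linear_ode_fundamental_matrix:
  fixes A :: "real \<Rightarrow> 'a::euclidean_space \<Rightarrow>\<^sub>L 'a"
  assumes cont: "continuous_on UNIV A" and bnd: "\<And>s. norm (A s) \<le> L"
  obtains \<Phi> :: "real \<Rightarrow> 'a \<Rightarrow>\<^sub>L 'a"
  where "\<Phi> 0 = id_blinfun" "\<And>s. (\<Phi> has_vector_derivative A s o\<^sub>L \<Phi> s) (at s)"
proof -
  have "\<exists>\<Phi>. \<Phi> 0 = id_blinfun \<and> (\<forall>s. (\<Phi> has_vector_derivative A s o\<^sub>L \<Phi> s) (at s))"
  proof (rule linear_ode_exists[where L = L])
    show "linear ((o\<^sub>L) (A s))" for s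
      using bounded_bilinear.bounded_linear_right[OF bounded_bilinear_blinfun_compose]
      by (auto dest: bounded_linear.linear)
    show "norm (A s o\<^sub>L z) \<le> L * norm z" for s and z :: "'a \<Rightarrow>\<^sub>L 'a"
      using order_trans[OF norm_blinfun_compose mult_right_mono[OF bnd]] by simp
    show "continuous_on UNIV (\<lambda>s. A s o\<^sub>L z s)" if "continuous_on UNIV z" for z :: "real \<Rightarrow> 'a \<Rightarrow>\<^sub>L 'a"
      by (intro continuous_intros cont that)
  qed
  then show thesis using that by blast
qed

section \<open>Powers of a linear map with a simple eigenvalue 1\<close>

lemma contracting_recursion_tendsto_0:
  fixes a e :: "nat \<Rightarrow> real"
  assumes "0 \<le> q" "q < 1" "\<And>k. 0 \<le> a k" and rec: "\<And>k. a (Suc k) \<le> q * a k + e k"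
    and e: "e \<longlonglongrightarrow> 0"
  shows "a \<longlonglongrightarrow> 0"
proof (rule tendstoI)
  fix r :: real assume "r > 0"
  then have "(1 - q) * (r / 2) > 0" using \<open>q < 1\<close> by simp
  \<comment> \<open>With this bound, \<open>r / 2\<close> is the fixed point of
    \<open>a \<mapsto> q * a + (1 - q) * (r / 2)\<close>, so the excess over \<open>r / 2\<close>
    shrinks by the factor \<open>q\<close> in each step.\<close>
  from order_tendstoD(2)[OF e this] obtain k0 where k0: "\<And>k. k \<ge> k0 \<Longrightarrow> e k < (1 - q) * (r / 2)"
    unfolding eventually_sequentially by blast
  have step: "a (k0 + m) - r / 2 \<le> q ^ m * a k0" for m
  proof (induction m)
    case 0 then show ?case using \<open>r > 0\<close> by simp
  next
    case (Suc m)
    have "a (k0 + Suc m) - r / 2 \<le> q * (a (k0 + m) - r / 2)"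
      using rec[of "k0 + m"] k0[of "k0 + m"] by (simp add: algebra_simps)
    also have "\<dots> \<le> q * (q ^ m * a k0)" by (intro mult_left_mono Suc \<open>0 \<le> q\<close>)
    finally show ?case by simp
  qed
  have "(\<lambda>m. q ^ m * a k0) \<longlonglongrightarrow> 0 * a k0"
    using assms by (intro tendsto_mult LIMSEQ_realpow_zero tendsto_const) auto
  then have "\<forall>\<^sub>F m in sequentially. q ^ m * a k0 < r / 2"
    using \<open>r > 0\<close> by (intro order_tendstoD) auto
  then obtain m0 where m0: "\<And>m. m \<ge> m0 \<Longrightarrow> q ^ m * a k0 < r / 2"
    unfolding eventually_sequentially by blast
  have "a k < r" if "k \<ge> k0 + m0" for k
    using step[of "k - k0"] m0[of "k - k0"] that by force
  then show "\<forall>\<^sub>F k in sequentially. dist (a k) 0 < r"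
    using assms(3) unfolding eventually_sequentially by (auto simp: dist_real_def)
qed

text \<open>The complexification of a real space is modelled on pairs, \<open>(u, v)\<close> standing for \<open>u + i v\<close>.\<close>

definition cscale :: "complex \<Rightarrow> 'a::real_vector \<times> 'a \<Rightarrow> 'a \<times> 'a" where
  "cscale c x = (Re c *\<^sub>R fst x - Im c *\<^sub>R snd x, Im c *\<^sub>R fst x + Re c *\<^sub>R snd x)"


lemma cscale_diff_left: "cscale (c - d) x = cscale c x - cscale d x"
  by (simp add: cscale_def algebra_simps)

lemma cscale_diff_right: "cscale c (x - y) = cscale c x - cscale c y"
  by (simp add: cscale_def algebra_simps)

lemma cscale_add_right: "cscale c (x + y) = cscale c x + cscale c y"
  by (simp add: cscale_def algebra_simps)

lemma cscale_cscale: "cscale c (cscale d x) = cscale (c * d) x"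
  by (simp add: cscale_def algebra_simps)

lemma cscale_0_left [simp]: "cscale 0 x = 0"
  by (simp add: cscale_def zero_prod_def)

lemma cscale_0_right [simp]: "cscale c 0 = 0"
  by (simp add: cscale_def zero_prod_def)

lemma cscale_1 [simp]: "cscale 1 x = x"
  by (simp add: cscale_def)

lemma cscale_sum_right: "cscale c (\<Sum>i\<in>I. f i) = (\<Sum>i\<in>I. cscale c (f i))"
  by (induction I rule: infinite_finite_induct) (auto simp: cscale_add_right)

lemma cscale_eq_0D: "cscale c x = 0 \<Longrightarrow> c \<noteq> 0 \<Longrightarrow> x = 0"
  using cscale_cscale[of "inverse c" c x] by simp

lemma norm_cscale: "norm (cscale c x) = cmod c * norm (x :: 'a::real_inner \<times> 'a)"
proof -
  have "(norm (cscale c x))\<^sup>2 = (cmod c * norm x)\<^sup>2"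
    by (simp add: cscale_def power_mult_distrib cmod_power2 power2_norm_eq_inner inner_prod_def
      inner_add inner_diff inner_commute) (simp add: power2_eq_square algebra_simps)
  then show ?thesis by (simp add: power2_eq_iff_nonneg)
qed

text \<open>This is \<open>p(L)\<close> on the complexification. Annihilating polynomials take the
  place of the Jordan normal form in controlling the powers of \<open>L\<close>.\<close>

definition poly_action :: "('a::real_vector \<Rightarrow> 'a) \<Rightarrow> complex poly \<Rightarrow> 'a \<times> 'a \<Rightarrow> 'a \<times> 'a" where
  "poly_action L p x = (\<Sum>i\<le>degree p. cscale (coeff p i) ((map_prod L L ^^ i) x))"

lemma poly_action_alt:
  assumes "degree p \<le> n"
  shows "poly_action L p x = (\<Sum>i\<le>n. cscale (coeff p i) ((map_prod L L ^^ i) x))"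
  unfolding poly_action_def using assms
  by (intro sum.mono_neutral_left) (auto simp: coeff_eq_0)

context
  fixes L :: "'a::euclidean_space \<Rightarrow> 'a"
  assumes lin: "linear L"
begin

lemma map_prod_linear_cscale: "map_prod L L (cscale c x) = cscale c (map_prod L L x)"
  by (cases x) (simp add: cscale_def linear_diff[OF lin] linear_add[OF lin] linear_scale[OF lin])

lemma map_prod_linear_diff: "map_prod L L (x - y) = map_prod L L x - map_prod L L y"
  by (cases x; cases y) (simp add: linear_diff[OF lin])

lemma map_prod_linear_add: "map_prod L L (x + y) = map_prod L L x + map_prod L L y"
  by (cases x; cases y) (simp add: linear_add[OF lin])

lemma map_prod_linear_0: "map_prod L L 0 = 0"
  by (simp add: linear_0[OF lin] zero_prod_def)

lemma map_prod_linear_sum: "map_prod L L (\<Sum>i\<in>I. f i) = (\<Sum>i\<in>I. map_prod L L (f i))"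
  by (induction I rule: infinite_finite_induct) (auto simp: map_prod_linear_add map_prod_linear_0)

lemma funpow_map_prod_linear_diff: "(map_prod L L ^^ n) (x - y) = (map_prod L L ^^ n) x - (map_prod L L ^^ n) y"
  by (induction n) (auto simp: map_prod_linear_diff)

lemma funpow_map_prod_linear_cscale: "(map_prod L L ^^ n) (cscale c x) = cscale c ((map_prod L L ^^ n) x)"
  by (induction n) (auto simp: map_prod_linear_cscale)

lemma poly_action_linear_factor:
  "poly_action L ([:- \<mu>, 1:] * q) x = poly_action L q (map_prod L L x - cscale \<mu> x)"
proof -
  let ?p = "[:- \<mu>, 1:] * q" and ?M = "map_prod L L" and ?n = "degree q"
  have c: "coeff ?p i = (case i of 0 \<Rightarrow> 0 | Suc j \<Rightarrow> coeff q j) - \<mu> * coeff q i" for i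
    by (simp add: coeff_pCons split: nat.split)
  have "degree ?p \<le> Suc ?n"
    by (rule order_trans[OF degree_mult_le]) simp
  then have "poly_action L ?p x = (\<Sum>i\<le>Suc ?n. cscale (coeff ?p i) ((?M ^^ i) x))"
    by (rule poly_action_alt)
  also have "\<dots> = (\<Sum>i\<le>Suc ?n. cscale (case i of 0 \<Rightarrow> 0 | Suc j \<Rightarrow> coeff q j) ((?M ^^ i) x))
      - (\<Sum>i\<le>Suc ?n. cscale (\<mu> * coeff q i) ((?M ^^ i) x))"
    unfolding c by (simp only: cscale_diff_left sum_subtractf)
  also have "(\<Sum>i\<le>Suc ?n. cscale (case i of 0 \<Rightarrow> 0 | Suc j \<Rightarrow> coeff q j) ((?M ^^ i) x))
      = (\<Sum>i\<le>?n. cscale (coeff q i) ((?M ^^ Suc i) x))"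
    by (subst sum.atMost_Suc_shift) (simp add: cscale_0_left del: funpow.simps)
  also have "(\<Sum>i\<le>Suc ?n. cscale (\<mu> * coeff q i) ((?M ^^ i) x)) = (\<Sum>i\<le>?n. cscale (\<mu> * coeff q i) ((?M ^^ i) x))"
    by (simp add: coeff_eq_0)
  finally show ?thesis
    unfolding poly_action_def sum_subtractf[symmetric]
    by (simp add: funpow_map_prod_linear_diff funpow_map_prod_linear_cscale cscale_diff_right cscale_cscale
      mult.commute funpow_swap1[of "map_prod L L"])
qed

lemma poly_action_commute:
  "poly_action L q (map_prod L L x - cscale \<mu> x) = map_prod L L (poly_action L q x) - cscale \<mu> (poly_action L q x)"
  unfolding poly_action_def
  by (simp add: map_prod_linear_sum cscale_sum_right sum_subtractf[symmetric] cscale_diff_right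
    funpow_map_prod_linear_diff funpow_map_prod_linear_cscale cscale_cscale map_prod_linear_cscale
    mult.commute funpow_swap1[of "map_prod L L"])

text \<open>Induction on the degree, splitting off a root \<open>\<mu>\<close> of \<open>p\<close>.
  If \<open>cmod \<mu> < 1\<close>, the cofactor \<open>q\<close> annihilates
  \<open>y = (L - \<mu>) x\<close>, so the powers of \<open>L\<close> send \<open>y\<close> to 0,
  and the powers applied to \<open>x\<close> obey a recursion with factor \<open>\<mu>\<close> and a
  vanishing perturbation. Otherwise \<open>q(L) x\<close> would be an eigenvector for a forbidden
  eigenvalue; hence it is 0 and \<open>q\<close> already annihilates \<open>x\<close>.\<close>

lemma funpow_tendsto_0_if_poly_action_0:
  assumes W: "subspace W" "L ` W \<subseteq> W"
    and eig: "\<And>\<mu> x. x \<in> W \<times> W \<Longrightarrow> x \<noteq> 0 \<Longrightarrow> map_prod L L x = cscale \<mu> x \<Longrightarrow> cmod \<mu> < 1"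
    and "degree p = n" "p \<noteq> 0" "x \<in> W \<times> W" "poly_action L p x = 0"
  shows "(\<lambda>k. (map_prod L L ^^ k) x) \<longlonglongrightarrow> 0"
  using assms(4-)
proof (induction n arbitrary: p x)
  case 0
  then obtain c where "p = [:c:]" "c \<noteq> 0" by (metis degree_eq_zeroE pCons_0_0)
  with 0 have "x = 0" by (auto simp: poly_action_def dest: cscale_eq_0D)
  moreover have "(map_prod L L ^^ k) 0 = 0" for k by (induction k) (auto simp: map_prod_linear_0)
  ultimately show ?case by simp
next
  case (Suc n)
  let ?M = "map_prod L L"
  have WW: "subspace (W \<times> W)" using W by (intro subspace_Times)
  have MW: "?M y \<in> W \<times> W" if "y \<in> W \<times> W" for y using that W by (auto simp: image_subset_iff)
  have cW: "cscale c y \<in> W \<times> W" if "y \<in> W \<times> W" for y c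
    using that W by (auto simp: cscale_def subspace_diff subspace_add subspace_scale)
  have "\<not> constant (poly p)"
    using Suc.prems constant_degree[of p] by auto
  then obtain \<mu> where "poly p \<mu> = 0" using fundamental_theorem_of_algebra by blast
  then obtain q where q: "p = [:- \<mu>, 1:] * q" by (metis dvdE poly_eq_0_iff_dvd)
  with Suc.prems have "q \<noteq> 0" by auto
  have "degree p = degree [:- \<mu>, 1:] + degree q"
    unfolding q using \<open>q \<noteq> 0\<close> by (intro degree_mult_eq) auto
  with Suc.prems(1) have dq: "degree q = n" by simp
  show ?case
  proof (cases "cmod \<mu> < 1")
    case True
    define y where "y = ?M x - cscale \<mu> x"
    have "y \<in> W \<times> W" unfolding y_def using Suc.prems MW cW WW by (intro subspace_diff) auto
    moreover have "poly_action L q y = 0"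
      using Suc.prems unfolding y_def q by (simp only: poly_action_linear_factor)
    ultimately have lim: "(\<lambda>k. (?M ^^ k) y) \<longlonglongrightarrow> 0"
      using Suc.IH dq \<open>q \<noteq> 0\<close> by blast
    have "(\<lambda>k. norm ((?M ^^ k) x)) \<longlonglongrightarrow> 0"
    proof (rule contracting_recursion_tendsto_0[where q = "cmod \<mu>" and e = "\<lambda>k. norm ((?M ^^ k) y)"])
      fix k
      have "(?M ^^ Suc k) x = cscale \<mu> ((?M ^^ k) x) + (?M ^^ k) y"
        by (simp add: y_def funpow_map_prod_linear_diff funpow_map_prod_linear_cscale funpow_swap1[of "map_prod L L"])
      then show "norm ((?M ^^ Suc k) x) \<le> cmod \<mu> * norm ((?M ^^ k) x) + norm ((?M ^^ k) y)"
        by (metis norm_cscale norm_triangle_ineq)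
    qed (use True lim in \<open>auto simp: tendsto_norm_zero\<close>)
    then show ?thesis by (rule tendsto_norm_zero_cancel)
  next
    case False
    define z where "z = poly_action L q x"
    have pw: "(?M ^^ i) x \<in> W \<times> W" for i using Suc.prems by (induction i) (auto intro: MW)
    have "z \<in> W \<times> W" unfolding z_def poly_action_def
      by (intro subspace_sum[OF WW] cW pw)
    moreover have "?M z = cscale \<mu> z"
      using Suc.prems unfolding z_def q
      by (simp only: poly_action_linear_factor poly_action_commute) simp
    ultimately have "z = 0" using eig False by blast
    then show ?thesis using Suc.IH dq \<open>q \<noteq> 0\<close> Suc.prems unfolding z_def by blast
  qed
qed

text \<open>The \<open>DIM('a) + 1\<close> iterates of \<open>w\<close> satisfy a linear relation,
  whose coefficients form the polynomial. Annihilating the single vector \<open>w\<close> is enough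
  for the convergence of its orbit.\<close>

lemma exists_annihilating_poly: "\<exists>p. p \<noteq> 0 \<and> poly_action L p (w, 0) = 0"
proof -
  let ?d = "DIM('a)" and ?f = "\<lambda>i. (L ^^ i) w"
  have "\<exists>c. (\<exists>i\<le>?d. c i \<noteq> 0) \<and> (\<Sum>i\<le>?d. c i *\<^sub>R ?f i) = 0"
  \<comment> \<open>Linear dependence is a property of sets and does not see coinciding iterates;
    two equal iterates give a relation with coefficients 1 and -1 directly.\<close>
  proof (cases "inj_on ?f {..?d}")
    case True
    have "dependent (?f ` {..?d})"
      by (rule dependent_biggerset) (simp add: card_image[OF True])
    then obtain u v where uv: "(\<Sum>x\<in>?f ` {..?d}. u x *\<^sub>R x) = 0" "v \<in> ?f ` {..?d}" "u v \<noteq> 0"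
      by (subst (asm) dependent_finite) auto
    then show ?thesis
      by (intro exI[of _ "\<lambda>i. u (?f i)"]) (auto simp: sum.reindex[OF True])
  next
    case False
    then obtain i j where ij: "i \<le> ?d" "j \<le> ?d" "i \<noteq> j" "?f i = ?f j" unfolding inj_on_def by auto
    define c :: "nat \<Rightarrow> real" where "c m = (if m = i then 1 else 0) - (if m = j then 1 else 0)" for m
    have "(\<Sum>m\<le>?d. c m *\<^sub>R ?f m) = (\<Sum>m\<le>?d. if m = i then ?f m else 0) - (\<Sum>m\<le>?d. if m = j then ?f m else 0)"
      unfolding sum_subtractf[symmetric] by (intro sum.cong) (auto simp: c_def)
    also have "\<dots> = 0" using ij by (simp add: sum.delta)
    finally show ?thesis using ij by (intro exI[of _ c]) (auto simp: c_def)
  qed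
  then obtain c i where c: "i \<le> ?d" "c i \<noteq> 0" "(\<Sum>i\<le>?d. c i *\<^sub>R ?f i) = 0" by blast
  define p where "p = (\<Sum>i\<le>?d. monom (complex_of_real (c i)) i)"
  have cp: "coeff p m = (if m \<le> ?d then complex_of_real (c m) else 0)" for m
    unfolding p_def by (simp add: coeff_sum)
  have "degree p \<le> ?d" using cp by (intro degree_le) auto
  then have "poly_action L p (w, 0) = (\<Sum>m\<le>?d. cscale (coeff p m) ((map_prod L L ^^ m) (w, 0)))"
    by (rule poly_action_alt)
  also have "\<dots> = (\<Sum>m\<le>?d. (c m *\<^sub>R ?f m, 0))"
  proof (intro sum.cong refl)
    fix m assume "m \<in> {..?d}"
    have "(map_prod L L ^^ m) (w, 0) = (?f m, 0)"
      by (induction m) (auto simp: linear_0[OF lin])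
    then show "cscale (coeff p m) ((map_prod L L ^^ m) (w, 0)) = (c m *\<^sub>R ?f m, 0)"
      using \<open>m \<in> _\<close> by (simp add: cp cscale_def)
  qed
  also have "\<dots> = ((\<Sum>m\<le>?d. c m *\<^sub>R ?f m), 0)"
    by (simp add: prod_eq_iff fst_sum snd_sum)
  finally have "poly_action L p (w, 0) = 0" using c by (simp add: zero_prod_def)
  moreover have "p \<noteq> 0" using cp[of i] c by auto
  ultimately show ?thesis by blast
qed

lemma funpow_tendsto_0:
  assumes W: "subspace W" "L ` W \<subseteq> W"
    and eig: "\<And>\<mu> u v. u \<in> W \<Longrightarrow> v \<in> W \<Longrightarrow> u \<noteq> 0 \<or> v \<noteq> 0 \<Longrightarrow>
      L u = Re \<mu> *\<^sub>R u - Im \<mu> *\<^sub>R v \<Longrightarrow> L v = Im \<mu> *\<^sub>R u + Re \<mu> *\<^sub>R v \<Longrightarrow> cmod \<mu> < 1"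
    and "w \<in> W"
  shows "(\<lambda>k. (L ^^ k) w) \<longlonglongrightarrow> 0"
proof -
  obtain p where p: "p \<noteq> 0" "poly_action L p (w, 0) = 0" using exists_annihilating_poly by blast
  have "(\<lambda>k. (map_prod L L ^^ k) (w, 0)) \<longlonglongrightarrow> 0"
  proof (rule funpow_tendsto_0_if_poly_action_0[OF W])
    fix \<mu> x assume "x \<in> W \<times> W" "x \<noteq> 0" "map_prod L L x = cscale \<mu> x"
    then show "cmod \<mu> < 1"
      by (cases x) (auto simp: cscale_def zero_prod_def intro: eig)
  qed (use p W \<open>w \<in> W\<close> in \<open>auto simp: subspace_0\<close>)
  then have "(\<lambda>k. fst ((map_prod L L ^^ k) (w, 0))) \<longlonglongrightarrow> fst (0 :: 'a \<times> 'a)" by (rule tendsto_fst)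
  moreover have "fst ((map_prod L L ^^ k) (w, 0)) = (L ^^ k) w" for k by (induction k) auto
  ultimately show ?thesis by simp
qed

lemma linear_funpow: "linear (L ^^ k)"
proof (induction k)
  case 0
  show ?case using linear_id by (simp add: id_def)
next
  case (Suc k)
  show ?case using linear_compose[OF Suc lin] by (simp add: o_def)
qed

text \<open>Pointwise convergence on a finite orthonormal basis becomes uniform on the unit ball of
  \<open>W\<close>, since the coordinates of \<open>w\<close> are bounded by
  \<open>norm w\<close>.\<close>

lemma funpow_half_contraction:
  assumes W: "subspace W" and lim: "\<And>w. w \<in> W \<Longrightarrow> (\<lambda>k. (L ^^ k) w) \<longlonglongrightarrow> 0"
  shows "\<exists>k>0. \<forall>w\<in>W. norm ((L ^^ k) w) \<le> 1 / 2 * norm w"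
proof -
  obtain B where B: "B \<subseteq> W" "pairwise orthogonal B" "\<And>x. x \<in> B \<Longrightarrow> norm x = 1" "independent B" "span B = W"
    by (rule orthonormal_basis_subspace[OF W]) blast
  have finB: "finite B" using B(4) by (rule independent_imp_finite)
  have "(\<lambda>k. \<Sum>b\<in>B. norm ((L ^^ k) b)) \<longlonglongrightarrow> (\<Sum>b\<in>B. norm (0::'a))"
    using B(1) lim by (intro tendsto_sum tendsto_norm) blast
  then have "\<forall>\<^sub>F k in sequentially. (\<Sum>b\<in>B. norm ((L ^^ k) b)) < 1 / 2"
    by (rule order_tendstoD(2)) simp
  with eventually_gt_at_top[of 0] have "\<forall>\<^sub>F k in sequentially. 0 < k \<and> (\<Sum>b\<in>B. norm ((L ^^ k) b)) < 1 / 2"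
    by eventually_elim auto
  then obtain k where k: "k > 0" "(\<Sum>b\<in>B. norm ((L ^^ k) b)) < 1 / 2"
    using eventually_happens'[OF sequentially_bot] by blast
  have "norm ((L ^^ k) w) \<le> 1 / 2 * norm w" if "w \<in> W" for w
  proof -
    have "w = (\<Sum>b\<in>B. (w \<bullet> b) *\<^sub>R b)"
      by (rule orthonormal_basis_expand[symmetric]) (use B finB that in simp_all)
    then have "(L ^^ k) w = (L ^^ k) (\<Sum>b\<in>B. (w \<bullet> b) *\<^sub>R b)" by (rule arg_cong)
    also have "\<dots> = (\<Sum>b\<in>B. (w \<bullet> b) *\<^sub>R (L ^^ k) b)"
      by (simp add: linear_sum[OF linear_funpow] linear_scale[OF linear_funpow])
    also have "norm \<dots> \<le> (\<Sum>b\<in>B. norm w * norm ((L ^^ k) b))"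
    proof (intro sum_norm_le)
      fix b assume "b \<in> B"
      then have "\<bar>w \<bullet> b\<bar> \<le> norm w" using Cauchy_Schwarz_ineq2[of w b] B(3) by simp
      then show "norm ((w \<bullet> b) *\<^sub>R (L ^^ k) b) \<le> norm w * norm ((L ^^ k) b)"
        by (simp add: mult_right_mono)
    qed
    also have "\<dots> = norm w * (\<Sum>b\<in>B. norm ((L ^^ k) b))" by (simp add: sum_distrib_left)
    also have "\<dots> \<le> norm w * (1 / 2)" using k by (intro mult_left_mono) auto
    finally show ?thesis by simp
  qed
  with k show ?thesis by blast
qed

text \<open>The vector \<open>a\<close> is a left eigenvector: it annihilates the image of \<open>L - 1\<close>, and that image
  misses \<open>v\<close> because the eigenvalue 1 has no Jordan block of size two.\<close>

lemma spectral_splitting: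
  assumes V: "subspace V" "L ` V \<subseteq> V" and v: "v \<in> V" "v \<noteq> 0" "L v = v" and d: "DIM('a) \<ge> 2"
    and eig: "\<And>\<mu> u v. u \<in> V \<Longrightarrow> v \<in> V \<Longrightarrow> u \<noteq> 0 \<or> v \<noteq> 0 \<Longrightarrow> \<mu> \<noteq> 0 \<Longrightarrow>
      L u = Re \<mu> *\<^sub>R u - Im \<mu> *\<^sub>R v \<Longrightarrow> L v = Im \<mu> *\<^sub>R u + Re \<mu> *\<^sub>R v \<Longrightarrow> \<mu> = 1 \<or> cmod \<mu> < 1"
    and mult: "dim {w \<in> V. ((\<lambda>z. L z - z) ^^ DIM('a)) w = 0} = 1"
  obtains a k where "a \<in> V" "a \<bullet> v = 1" "\<And>w. w \<in> V \<Longrightarrow> a \<bullet> L w = a \<bullet> w"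
    "k > 0" "\<And>w. w \<in> V \<Longrightarrow> a \<bullet> w = 0 \<Longrightarrow> norm ((L ^^ k) w) \<le> 1 / 2 * norm w"
proof -
  define N where "N = (\<lambda>z. L z - z)"
  have linN: "linear N"
    unfolding N_def by (intro linear_compose_sub lin linear_id[unfolded id_def])
  have NV: "N w \<in> V" if "w \<in> V" for w
    unfolding N_def using that V by (auto intro!: subspace_diff)
  have N0: "(N ^^ m) 0 = 0" for m by (induction m) (auto simp: linear_0[OF linN])
  \<comment> \<open>The generalized eigenspace of 1 has dimension 1 and contains \<open>v\<close>;
    since the dimension is at least 2, it also contains the kernel of the square of
    \<open>N\<close>.\<close>
  have ker: "u \<in> span {v}" if "u \<in> V" "N (N u) = 0" for u
  proof -
    let ?K = "{w \<in> V. (N ^^ DIM('a)) w = 0}"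
    have inK: "w \<in> ?K" if "w \<in> V" "N (N w) = 0" for w
    proof -
      have "(N ^^ DIM('a)) w = (N ^^ (DIM('a) - 2)) ((N ^^ 2) w)"
        using d by (metis comp_apply funpow_add le_add_diff_inverse2)
      then show ?thesis using that N0 by (simp add: numeral_2_eq_2)
    qed
    have "v \<in> ?K" using v by (intro inK) (auto simp: N_def linear_0[OF lin])
    moreover have "dim ?K \<le> dim {v}" using mult v by (simp add: N_def dim_insert)
    ultimately have "span {v} = span ?K" by (intro dim_eq_span) auto
    then show ?thesis using inK[OF that] by (auto intro: span_base)
  qed
  have "v \<notin> N ` V"
  proof
    assume "v \<in> N ` V"
    then obtain u where u: "u \<in> V" "v = N u" by auto
    have "N v = 0" using v by (simp add: N_def)
    then have "u \<in> span {v}" using ker u by simp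
    then obtain c where "u = c *\<^sub>R v" by (auto simp: span_singleton)
    then have "N u = c *\<^sub>R N v" by (simp add: linear_scale[OF linN])
    then show False using \<open>N v = 0\<close> u v by simp
  qed
  have sNV: "subspace (N ` V)" by (rule linear_subspace_image[OF linN V(1)])
  obtain y z where yz: "y \<in> span (N ` V)" "\<And>w. w \<in> span (N ` V) \<Longrightarrow> orthogonal z w" "v = y + z"
    by (rule orthogonal_subspace_decomp_exists[of "N ` V" v]) blast
  have y: "y \<in> N ` V" using yz(1) sNV by (simp add: span_eq_iff[THEN iffD2])
  have z0: "z \<noteq> 0" using y yz(3) \<open>v \<notin> N ` V\<close> by auto
  \<comment> \<open>\<open>z\<close> is the component of \<open>v\<close> orthogonal to the image of
    \<open>N\<close>, so \<open>z \<bullet> v = z \<bullet> z\<close> and this scaling gives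
    \<open>a \<bullet> v = 1\<close>.\<close>
  define a where "a = z /\<^sub>R (z \<bullet> z)"
  have "z = v - y" using yz(3) by simp
  then have aV: "a \<in> V"
    unfolding a_def using y v V NV by (auto intro!: subspace_scale subspace_diff)
  have "z \<bullet> y = 0" using yz(1,2) by (simp add: orthogonal_def)
  then have av: "a \<bullet> v = 1" unfolding a_def using z0 yz(3) by (simp add: inner_add_right)
  have aN: "a \<bullet> N w = 0" if "w \<in> V" for w
  proof -
    have "N w \<in> span (N ` V)" using that by (intro span_base) auto
    then show ?thesis using yz(2)[of "N w"] by (simp add: a_def orthogonal_def)
  qed
  have aL: "a \<bullet> L w = a \<bullet> w" if "w \<in> V" for w
    using aN[OF that] by (simp add: N_def inner_diff_right)
  define W where "W = V \<inter> {w. a \<bullet> w = 0}"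
  have W: "subspace W" unfolding W_def by (intro subspace_inter V subspace_hyperplane)
  have LW: "L ` W \<subseteq> W" using V aL by (auto simp: W_def)
  have no1: "u = 0" if "u \<in> W" "L u = u" for u
  proof -
    have "u \<in> span {v}" using that by (intro ker) (auto simp: W_def N_def linear_0[OF lin])
    then obtain c where "u = c *\<^sub>R v" by (auto simp: span_singleton)
    with that av show ?thesis by (auto simp: W_def)
  qed
  have "(\<lambda>k. (L ^^ k) w) \<longlonglongrightarrow> 0" if "w \<in> W" for w
  proof (rule funpow_tendsto_0[OF W LW _ that])
    fix \<mu> u v assume *: "u \<in> W" "v \<in> W" "u \<noteq> 0 \<or> v \<noteq> 0"
      "L u = Re \<mu> *\<^sub>R u - Im \<mu> *\<^sub>R v" "L v = Im \<mu> *\<^sub>R u + Re \<mu> *\<^sub>R v"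
    show "cmod \<mu> < 1"
    \<comment> \<open>The value 0 is treated apart because \<open>eig\<close> speaks of nonzero
      multipliers only: a Floquet multiplier is an exponential.\<close>
    proof (cases "\<mu> = 0")
      case False
      have "\<mu> = 1 \<or> cmod \<mu> < 1" using * False by (intro eig[of u v]) (auto simp: W_def)
      moreover have "\<mu> \<noteq> 1" using * no1[of u] no1[of v] by auto
      ultimately show ?thesis by auto
    qed auto
  qed
  from funpow_half_contraction[OF W this] obtain k where
    "k > 0" "\<And>w. w \<in> W \<Longrightarrow> norm ((L ^^ k) w) \<le> 1 / 2 * norm w" by blast
  with aV av aL show thesis by (intro that[of a k]) (auto simp: W_def)
qed

end

section \<open>The field on the sphere\<close>

lemma reg_field_outside:
  "norm x > \<nu> \<Longrightarrow> reg_field \<alpha> F G \<nu> x = norm x powr \<alpha> *\<^sub>R F (x /\<^sub>R norm x)"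
  by (simp add: reg_field_def)

lemma reg_field_half_sphere:
  "norm x = 1 \<Longrightarrow> reg_field \<alpha> F G (1 / 2) x = F x"
  by (simp add: reg_field_def)

text \<open>For \<open>norm x > 1 / 2\<close> the regularized field \<open>f\<close> with
  \<open>\<nu> = 1 / 2\<close> is \<open>norm x powr \<alpha>\<close> times \<open>F\<close> at the
  projected point. Removing its radial part \<open>m x *\<^sub>R x\<close> and multiplying by
  \<open>p x\<close> gives the extension of \<open>F_sph\<close> that is constant along rays, so its
  smoothness comes from that of \<open>f\<close>. The derivative is written out to make its
  continuity visible.\<close>

lemma F_sph_extension_C1:
  fixes F G :: "'a::euclidean_space \<Rightarrow> 'a"
  assumes "is_regularization \<alpha> F G"
  obtains D :: "'a \<Rightarrow> 'a \<Rightarrow>\<^sub>L 'a"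
  where "\<And>x. norm x > 1 / 2 \<Longrightarrow> ((\<lambda>x. F_sph F (x /\<^sub>R norm x)) has_derivative blinfun_apply (D x)) (at x)"
    "continuous_on {x. norm x > 1 / 2} D"
proof -
  define U :: "'a set" where "U = {x. norm x > 1 / 2}"
  have openU: "open U" unfolding U_def by (intro open_Collect_less continuous_intros)
  define f where "f = reg_field \<alpha> F G (1 / 2)"
  obtain f' :: "'a \<Rightarrow> 'a \<Rightarrow>\<^sub>L 'a" where f': "\<And>x. (f has_derivative blinfun_apply (f' x)) (at x)"
    and cf': "continuous_on UNIV f'"
  proof -
    have "C1_on UNIV f" using assms unfolding f_def is_regularization_def by auto
    then obtain g g' U where g: "open U" "UNIV \<subseteq> U" "\<forall>x\<in>UNIV. f x = g x"
      "\<forall>x\<in>U. (g has_derivative blinfun_apply (g' x)) (at x)" "continuous_on U g'"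
      unfolding C1_on_def by auto
    then have "f = g" "U = UNIV" by auto
    with g that show thesis by auto
  qed
  define m where "m x = (f x \<bullet> x) / (x \<bullet> x)" for x
  define m' where "m' x v = ((f' x v \<bullet> x + f x \<bullet> v) * (x \<bullet> x) - (f x \<bullet> x) * (2 * (x \<bullet> v))) / ((x \<bullet> x) * (x \<bullet> x))" for x v
  define p where "p x = norm x powr (- \<alpha>)" for x :: 'a
  define p' where "p' x v = - \<alpha> * norm x powr (- \<alpha> - 1) * (sgn x \<bullet> v)" for x v :: 'a
  define D where "D x v = p' x v *\<^sub>R (f x - m x *\<^sub>R x) + p x *\<^sub>R (f' x v - m' x v *\<^sub>R x - m x *\<^sub>R v)" for x v
  have nz: "x \<noteq> 0" if "x \<in> U" for x using that by (auto simp: U_def)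
  have H: "F_sph F (x /\<^sub>R norm x) = p x *\<^sub>R (f x - m x *\<^sub>R x)" if "x \<in> U" for x
  proof -
    have n: "norm x > 0" using nz[OF that] by simp
    define u where "u = F (x /\<^sub>R norm x)"
    have fx: "f x = norm x powr \<alpha> *\<^sub>R u"
      using that by (simp add: f_def U_def reg_field_outside u_def)
    have "p x *\<^sub>R f x = u" unfolding fx p_def using n by (simp flip: powr_add)
    moreover have "p x * m x = (u \<bullet> x) / (norm x)\<^sup>2"
      unfolding fx m_def p_def using n by (simp add: power2_norm_eq_inner flip: powr_add mult.assoc)
    ultimately show ?thesis
      unfolding F_sph_def F_rad_def u_def[symmetric]
      by (simp add: scaleR_diff_right) (simp add: power2_eq_square field_simps)
  qed
  have dm: "(m has_derivative m' x) (at x)" if "x \<in> U" for x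
    unfolding m_def[abs_def] m'_def[abs_def] using nz[OF that] f'[of x]
    by (auto intro!: derivative_eq_intros simp: inner_commute power2_eq_square algebra_simps)
  have dp: "(p has_derivative p' x) (at x)" if "x \<in> U" for x
    unfolding p_def[abs_def] p'_def[abs_def] using nz[OF that]
    by (auto intro!: derivative_eq_intros GDERIV_norm[unfolded gderiv_def] simp: powr_diff powr_minus field_simps inner_commute)
  have dH: "((\<lambda>x. F_sph F (x /\<^sub>R norm x)) has_derivative D x) (at x)" if "x \<in> U" for x
  proof (rule has_derivative_transform_within_open[OF _ openU that])
    show "((\<lambda>x. p x *\<^sub>R (f x - m x *\<^sub>R x)) has_derivative D x) (at x)"
      unfolding D_def[abs_def] using dm[OF that] dp[OF that] f'[of x]
      by (auto intro!: derivative_eq_intros simp: algebra_simps)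
  qed (simp add: H)
  define DB where "DB x = Blinfun (D x)" for x
  have app: "blinfun_apply (DB x) = D x" if "x \<in> U" for x
    unfolding DB_def by (rule bounded_linear_Blinfun_apply) (use dH[OF that] in \<open>auto dest: has_derivative_bounded_linear\<close>)
  have cf: "continuous_on U f"
    using f' by (auto intro!: continuous_at_imp_continuous_on has_derivative_continuous)
  have cf'U: "continuous_on U (\<lambda>x. f' x v)" for v
    by (intro continuous_intros continuous_on_subset[OF cf']) auto
  have "continuous_on U DB"
  proof (rule continuous_on_blinfun_componentwise)
    fix v :: 'a
    have cm: "continuous_on U m" unfolding m_def[abs_def] by (intro continuous_intros cf) (auto dest: nz)
    have cm': "continuous_on U (\<lambda>x. m' x v)" unfolding m'_def by (intro continuous_intros cf cf'U) (auto dest: nz)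
    have cp: "continuous_on U p" unfolding p_def[abs_def] by (intro continuous_intros) (auto dest: nz)
    have cp': "continuous_on U (\<lambda>x. p' x v)" unfolding p'_def by (intro continuous_intros) (auto dest: nz)
    have "continuous_on U (\<lambda>x. D x v)" unfolding D_def by (intro continuous_intros cf cf'U cm cm' cp cp')
    then show "continuous_on U (\<lambda>x. DB x v)"
      by (rule continuous_on_eq) (simp add: app)
  qed
  show thesis
  proof (rule that[of DB])
    show "continuous_on {x. norm x > 1 / 2} DB" using \<open>continuous_on U DB\<close> by (simp add: U_def)
    fix x :: 'a assume "norm x > 1 / 2"
    then have "x \<in> U" by (simp add: U_def)
    then show "((\<lambda>x. F_sph F (x /\<^sub>R norm x)) has_derivative blinfun_apply (DB x)) (at x)"
      using dH[of x] app[of x] by simp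
  qed
qed

lemma F_sph_extension_tangential: "x \<noteq> 0 \<Longrightarrow> F_sph F (x /\<^sub>R norm x) \<bullet> x = 0"
  by (simp add: F_sph_def F_rad_def inner_diff_left power2_norm_eq_inner[symmetric] power2_eq_square field_simps)

text \<open>This converts exponential approach to the cycle into an exponentially small difference
  of radial growth rates.\<close>

lemma F_rad_lipschitz_on_sphere:
  fixes F G :: "'a::euclidean_space \<Rightarrow> 'a"
  assumes "is_regularization \<alpha> F G"
  obtains L where "L-lipschitz_on (sphere 0 1) (F_rad F)"
proof -
  have "C1_on UNIV (reg_field \<alpha> F G (1/2))" using assms by (simp add: is_regularization_def)
  then obtain L where L: "L-lipschitz_on (sphere 0 1) (reg_field \<alpha> F G (1/2))"
    using C1_UNIV_lipschitz_on_compacts[unfolded lipschitz_on_compacts_def, rule_format, of _ "sphere 0 1"] by auto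
  have L': "norm (F x - F y) \<le> L * norm (x - y)" if "norm x = 1" "norm y = 1" for x y
    using lipschitz_onD[OF L, of x y] that by (simp add: dist_norm reg_field_half_sphere)
  have "continuous_on (sphere 0 1) (reg_field \<alpha> F G (1/2))" using L by (rule lipschitz_on_continuous_on)
  then have "bounded (reg_field \<alpha> F G (1/2) ` sphere 0 1)"
    by (intro compact_imp_bounded compact_continuous_image) auto
  then obtain C where C: "\<And>y. norm y = 1 \<Longrightarrow> norm (F y) \<le> C"
    unfolding bounded_iff by (metis imageI mem_sphere_0 reg_field_half_sphere)
  have "0 \<le> L" using L by (rule lipschitz_on_nonneg)
  have "(L + \<bar>C\<bar>)-lipschitz_on (sphere 0 1) (F_rad F)"
  proof (rule lipschitz_onI)
    fix x y :: 'a assume xy: "x \<in> sphere 0 1" "y \<in> sphere 0 1"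
    have "F_rad F x - F_rad F y = (F x - F y) \<bullet> x + F y \<bullet> (x - y)"
      by (simp add: F_rad_def inner_diff_left inner_diff_right)
    also have "\<bar>\<dots>\<bar> \<le> norm (F x - F y) * norm x + norm (F y) * norm (x - y)"
      by (rule order_trans[OF abs_triangle_ineq]) (intro add_mono Cauchy_Schwarz_ineq2)
    also have "\<dots> \<le> (L * norm (x - y)) * 1 + \<bar>C\<bar> * norm (x - y)"
      using xy L'[of x y] C[of y] \<open>0 \<le> L\<close> by (intro add_mono mult_mono) auto
    finally show "dist (F_rad F x) (F_rad F y) \<le> (L + \<bar>C\<bar>) * dist x y"
      by (simp add: dist_norm algebra_simps)
  qed (use \<open>0 \<le> L\<close> in auto)
  then show thesis by (rule that)
qed

section \<open>Linearization along a cycle\<close>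

text \<open>\<open>h\<close> stands for the extension of \<open>F_sph\<close> that is constant along
  rays. Tangency is required on a neighbourhood of the sphere so that it can be differentiated in
  every direction.\<close>

locale sphere_cycle =
  fixes h :: "'a::euclidean_space \<Rightarrow> 'a" and D :: "'a \<Rightarrow> 'a \<Rightarrow>\<^sub>L 'a"
    and Yp :: "real \<Rightarrow> 'a" and T :: real
  assumes h_deriv: "\<And>x. norm x > 1 / 2 \<Longrightarrow> (h has_derivative blinfun_apply (D x)) (at x)"
    and D_cont: "continuous_on {x. norm x > 1 / 2} D"
    and h_tang: "\<And>x. norm x > 1 / 2 \<Longrightarrow> h x \<bullet> x = 0"
    and T_pos: "T > 0"
    and Yp_norm: "\<And>s. norm (Yp s) = 1"
    and Yp_deriv: "\<And>s. (Yp has_vector_derivative h (Yp s)) (at s)"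
    and Yp_per: "\<And>s. Yp (s + T) = Yp s"
    and Yp_nonconst: "\<exists>s. Yp s \<noteq> Yp 0"
begin

lemma Yp_cont: "continuous_on S Yp"
  using Yp_deriv by (auto intro!: continuous_at_imp_continuous_on has_vector_derivative_continuous)

lemma open_dom: "open {x::'a. norm x > 1 / 2}"
  by (intro open_Collect_less continuous_intros)

lemma h_lipschitz: "\<exists>L>0. \<forall>x y. norm x = 1 \<longrightarrow> norm y = 1 \<longrightarrow> norm (h x - h y) \<le> L * norm (x - y)"
proof -
  have "lipschitz_on_compacts {x. norm x > 1 / 2} h"
    by (rule C1_lipschitz_on_compacts[OF _ D_cont open_dom]) (use h_deriv in auto)
  moreover have "sphere 0 1 \<subseteq> {x::'a. norm x > 1 / 2}" by auto
  ultimately obtain L where L: "L-lipschitz_on (sphere 0 1) h"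
    unfolding lipschitz_on_compacts_def by (meson compact_sphere)
  have "norm (h x - h y) \<le> (L + 1) * norm (x - y)" if "norm x = 1" "norm y = 1" for x y
    using lipschitz_onD[OF L, of x y] that by (simp add: dist_norm distrib_right add_increasing2)
  moreover have "L + 1 > 0" using lipschitz_on_nonneg[OF L] by simp
  ultimately show ?thesis by blast
qed

definition Lh where "Lh = (SOME L. L > 0 \<and> (\<forall>x y. norm x = 1 \<longrightarrow> norm y = 1 \<longrightarrow> norm (h x - h y) \<le> L * norm (x - y)))"

lemma Lh: "Lh > 0" "norm x = 1 \<Longrightarrow> norm y = 1 \<Longrightarrow> norm (h x - h y) \<le> Lh * norm (x - y)"
  using someI_ex[OF h_lipschitz] unfolding Lh_def by blast+

lemma h_bound: "norm y = 1 \<Longrightarrow> norm (h y) \<le> norm (h (Yp 0)) + 2 * Lh"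
proof -
  assume y: "norm y = 1"
  have "norm (h y) \<le> norm (h (Yp 0)) + norm (h y - h (Yp 0))" by (metis norm_triangle_sub)
  also have "norm (h y - h (Yp 0)) \<le> Lh * norm (y - Yp 0)" by (rule Lh(2)) (simp_all add: y Yp_norm)
  also have "norm (y - Yp 0) \<le> 2" using norm_triangle_ineq4[of y "Yp 0"] by (simp add: y Yp_norm)
  finally show ?thesis using Lh(1) by (simp add: mult.commute)
qed

definition Kh where "Kh = norm (h (Yp 0)) + 2 * Lh"

lemma Kh: "Kh > 0" "norm y = 1 \<Longrightarrow> norm (h y) \<le> Kh"
  using h_bound Lh(1) by (auto simp: Kh_def add_nonneg_pos)

definition A where "A s = D (Yp s)"

lemma A_cont: "continuous_on UNIV A"
  unfolding A_def by (rule continuous_on_compose2[OF D_cont Yp_cont]) (auto simp: Yp_norm)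

lemma A_per: "A (s + T) = A s"
  by (simp add: A_def Yp_per)

lemma A_bound: "\<exists>C>0. \<forall>s. norm (A s) \<le> C"
  using periodic_continuous_bounded[OF A_cont T_pos A_per] by metis

definition \<Phi> :: "real \<Rightarrow> 'a \<Rightarrow>\<^sub>L 'a" where
  "\<Phi> = (SOME \<Phi>. \<Phi> 0 = id_blinfun \<and> (\<forall>s. (\<Phi> has_vector_derivative A s o\<^sub>L \<Phi> s) (at s)))"

lemma \<Phi>: "\<Phi> 0 = id_blinfun" "(\<Phi> has_vector_derivative A s o\<^sub>L \<Phi> s) (at s)"
proof -
  obtain C where "\<And>s. norm (A s) \<le> C" using A_bound by blast
  from linear_ode_fundamental_matrix[OF A_cont this]
  have "\<exists>\<Phi>. \<Phi> 0 = id_blinfun \<and> (\<forall>s. (\<Phi> has_vector_derivative A s o\<^sub>L \<Phi> s) (at s))" by metis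
  from someI_ex[OF this] show "\<Phi> 0 = id_blinfun" "(\<Phi> has_vector_derivative A s o\<^sub>L \<Phi> s) (at s)"
    unfolding \<Phi>_def by auto
qed

lemma \<Phi>_deriv: "((\<lambda>s. \<Phi> s w) has_vector_derivative A s (\<Phi> s w)) (at s)"
  using bounded_linear.has_vector_derivative[OF blinfun.bounded_linear_left \<Phi>(2)[of s], of w] by simp

lemma linear_ode_zero:
  assumes u: "\<And>s. (u has_vector_derivative A s (u s)) (at s)" and "u 0 = 0"
  shows "u s = 0"
proof -
  obtain C where C: "\<And>s. norm (A s) \<le> C" using A_bound by blast
  have bnd: "norm (A s z) \<le> C * norm z" for s z
    by (rule order_trans[OF norm_blinfun mult_right_mono[OF C]]) simp
  have cu: "continuous_on S u" for S
    using u by (auto intro!: continuous_at_imp_continuous_on has_vector_derivative_continuous)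
  show ?thesis
  proof (cases "s \<ge> 0")
    case True
    have "norm (u s) \<le> norm (u 0) * exp (C * (s - 0))"
      by (rule gronwall_homogeneous[OF True cu u bnd])
    then show ?thesis using \<open>u 0 = 0\<close> by simp
  next
    case False
    have "norm (u (- (- s))) \<le> norm (u (- 0)) * exp (C * (- s - 0))"
    proof (rule gronwall_homogeneous[where u = "\<lambda>t. u (- t)" and u' = "\<lambda>t. - A (- t) (u (- t))"])
      show "((\<lambda>t. u (- t)) has_vector_derivative - A (- t) (u (- t))) (at t)" for t
        using vector_diff_chain_at[OF has_vector_derivative_minus[OF has_vector_derivative_id] u, of t]
        by (simp add: o_def)
      show "continuous_on {0..- s} (\<lambda>t. u (- t))"
        by (rule continuous_on_compose2[OF cu[of UNIV]]) (auto intro!: continuous_intros)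
      show "norm (- A (- t) (u (- t))) \<le> C * norm (u (- t))" for t using bnd by simp
    qed (use False in auto)
    then show ?thesis using \<open>u 0 = 0\<close> by simp
  qed
qed

lemma linear_ode_unique:
  assumes "\<And>s. (u has_vector_derivative A s (u s)) (at s)"
  shows "u s = \<Phi> s (u 0)"
proof -
  have "u s - \<Phi> s (u 0) = 0"
  proof (rule linear_ode_zero[where u = "\<lambda>s. u s - \<Phi> s (u 0)"])
    fix s
    show "((\<lambda>s. u s - \<Phi> s (u 0)) has_vector_derivative A s (u s - \<Phi> s (u 0))) (at s)"
      using has_vector_derivative_diff[OF assms[of s] \<Phi>_deriv[of "u 0" s]] by (simp add: blinfun.diff_right)
  qed (simp add: \<Phi>)
  then show ?thesis by simp
qed

text \<open>The linear equation is not autonomous; the flow property used here rests on the shift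
  being a whole number of periods, under which \<open>A\<close> is invariant.\<close>

lemma \<Phi>_shift: "\<Phi> (s + real n * T) w = \<Phi> s (\<Phi> (real n * T) w)"
proof -
  have per: "A (s + real n * T) = A s" for s by (rule periodic_shift_nat) (rule A_per)
  have "(\<lambda>s. \<Phi> (s + real n * T) w) s = \<Phi> s ((\<lambda>s. \<Phi> (s + real n * T) w) 0)"
  proof (rule linear_ode_unique[where u = "\<lambda>s. \<Phi> (s + real n * T) w"])
    fix s
    have "((\<lambda>s. s + real n * T) has_vector_derivative 1) (at s)"
      by (auto intro!: derivative_eq_intros)
    from vector_diff_chain_at[OF this \<Phi>_deriv]
    show "((\<lambda>s. \<Phi> (s + real n * T) w) has_vector_derivative A s (\<Phi> (s + real n * T) w)) (at s)"
      by (simp add: o_def per)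
  qed
  then show ?thesis by simp
qed

lemma \<Phi>_funpow: "(blinfun_apply (\<Phi> T) ^^ n) w = \<Phi> (real n * T) w"
proof (induction n)
  case 0
  show ?case by (simp add: \<Phi>)
next
  case (Suc n)
  have "\<Phi> (real (Suc n) * T) w = \<Phi> (T + real n * T) w" by (simp add: algebra_simps)
  also have "\<dots> = \<Phi> T (\<Phi> (real n * T) w)" by (rule \<Phi>_shift)
  finally show ?case by (simp add: Suc)
qed

lemma D_tang: "norm x > 1 / 2 \<Longrightarrow> D x v \<bullet> x + h x \<bullet> v = 0"
proof -
  assume x: "norm x > 1 / 2"
  have "((\<lambda>x. h x \<bullet> x) has_derivative (\<lambda>v. D x v \<bullet> x + h x \<bullet> v)) (at x)"
    using h_deriv[OF x] by (auto intro!: derivative_eq_intros)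
  moreover have "((\<lambda>x. h x \<bullet> x) has_derivative (\<lambda>v. 0)) (at x)"
    by (rule has_derivative_transform_within_open[OF has_derivative_const[of 0] open_dom])
       (use x in \<open>auto simp: h_tang\<close>)
  ultimately have "(\<lambda>v. D x v \<bullet> x + h x \<bullet> v) = (\<lambda>v. 0)" by (rule has_derivative_unique)
  then show ?thesis by metis
qed

text \<open>By \<open>D_tang\<close>, which is the tangency of \<open>h\<close> differentiated, the
  two terms in the derivative of \<open>u s \<bullet> Yp s\<close> cancel. The linearized flow
  therefore preserves tangent vectors.\<close>

lemma linear_ode_tangent:
  assumes u: "\<And>s. (u has_vector_derivative A s (u s)) (at s)" and "u 0 \<bullet> Yp 0 = 0"
  shows "u s \<bullet> Yp s = 0"
proof -
  have "((\<lambda>s. u s \<bullet> Yp s) has_real_derivative 0) (at s)" for s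
  proof -
    have "((\<lambda>s. u s \<bullet> Yp s) has_vector_derivative (u s \<bullet> h (Yp s) + A s (u s) \<bullet> Yp s)) (at s)"
      using bounded_bilinear.has_vector_derivative[OF bounded_bilinear_inner u[of s] Yp_deriv[of s]] .
    moreover have "u s \<bullet> h (Yp s) + A s (u s) \<bullet> Yp s = 0"
      using D_tang[of "Yp s" "u s"] by (simp add: A_def Yp_norm inner_commute add.commute)
    ultimately show ?thesis by (simp add: has_real_derivative_iff_has_vector_derivative)
  qed
  then have "(\<lambda>s. u s \<bullet> Yp s) s = (\<lambda>s. u s \<bullet> Yp s) 0" by (intro DERIV_isconst_all) auto
  then show ?thesis using assms by simp
qed

text \<open>Differentiating the equation of the cycle in time: the velocity solves the linearized
  equation and provides the multiplier 1 of time translation.\<close>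

lemma h_Yp_deriv: "((\<lambda>s. h (Yp s)) has_vector_derivative A s (h (Yp s))) (at s)"
  using vector_derivative_diff_chain_within[OF Yp_deriv[of s] has_derivative_at_withinI[OF h_deriv[of "Yp s"]]]
  by (simp add: A_def o_def Yp_norm)

lemma \<Phi>_tangent: "w \<bullet> Yp 0 = 0 \<Longrightarrow> \<Phi> s w \<bullet> Yp s = 0"
  by (rule linear_ode_tangent[OF \<Phi>_deriv]) (simp add: \<Phi>)

lemma Yp_T: "Yp T = Yp 0"
  using Yp_per[of 0] by simp

lemma \<Phi>_velocity: "\<Phi> T (h (Yp 0)) = h (Yp 0)"
  using linear_ode_unique[of "\<lambda>s. h (Yp s)" T, OF h_Yp_deriv] by (simp add: Yp_T)

section \<open>Nonlinear solutions near the cycle\<close>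

text \<open>Unit norm is built in because the Lipschitz constant \<open>Lh\<close> is one for points
  of the sphere.\<close>

definition solution where
  "solution b Z \<longleftrightarrow> continuous_on {0..b} Z \<and> (\<forall>t\<in>{0<..<b}. (Z has_vector_derivative h (Z t)) (at t))
     \<and> (\<forall>t\<in>{0..b}. norm (Z t) = 1)"

lemma solution_mono: "solution b Z \<Longrightarrow> b' \<le> b \<Longrightarrow> solution b' Z"
  unfolding solution_def by (auto intro: continuous_on_subset)

lemma solution_Yp: "solution b (\<lambda>s. Yp (s + c))"
proof -
  have "((\<lambda>s. Yp (s + c)) has_vector_derivative h (Yp (s + c))) (at s)" for s
  proof -
    have "((\<lambda>s. s + c) has_vector_derivative 1) (at s)"
      by (auto intro!: derivative_eq_intros)
    from vector_diff_chain_at[OF this Yp_deriv] show ?thesis by (simp add: o_def)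
  qed
  then show ?thesis unfolding solution_def
    by (auto simp: Yp_norm intro!: continuous_at_imp_continuous_on has_vector_derivative_continuous)
qed

lemma solution_dist:
  assumes X: "solution b X" and Z: "solution b Z" and "b \<ge> 0"
  shows "norm (X b - Z b) \<le> norm (X 0 - Z 0) * exp (Lh * b)"
proof -
  have "norm (X b - Z b) \<le> norm (X 0 - Z 0) * exp (Lh * (b - 0))"
  proof (rule gronwall_homogeneous[where u' = "\<lambda>t. h (X t) - h (Z t)" and u = "\<lambda>t. X t - Z t"])
    show "continuous_on {0..b} (\<lambda>t. X t - Z t)"
      using X Z unfolding solution_def by (intro continuous_intros) auto
    fix t assume "0 < t" "t < b"
    then show "((\<lambda>t. X t - Z t) has_vector_derivative h (X t) - h (Z t)) (at t)"
      "norm (h (X t) - h (Z t)) \<le> Lh * norm (X t - Z t)"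
      using X Z Lh(2)[of "X t" "Z t"] unfolding solution_def by (auto intro!: has_vector_derivative_diff)
  qed fact
  then show ?thesis by simp
qed

text \<open>If the velocity vanished, the constant curve would be a second solution from
  \<open>Yp 0\<close>. Uniqueness is available forward in time, and periodicity moves any parameter
  there.\<close>

lemma velocity_nonzero: "h (Yp 0) \<noteq> 0"
proof
  assume z: "h (Yp 0) = 0"
  have "Yp s = Yp 0" if "s \<ge> 0" for s
  proof -
    have "solution s (\<lambda>s. Yp 0)" unfolding solution_def by (auto simp: z Yp_norm)
    then show ?thesis
      using solution_dist[OF solution_Yp[of s 0] _ that, of "\<lambda>_. Yp 0"] by simp
  qed
  moreover obtain s where s: "Yp s \<noteq> Yp 0" using Yp_nonconst by blast
  moreover obtain n where "0 \<le> s + of_int n * T" using real_reduce_period[OF T_pos] .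
  moreover have "Yp (s + of_int n * T) = Yp s" by (rule periodic_shift_int) (rule Yp_per)
  ultimately show False by metis
qed

text \<open>One \<open>\<delta>\<close> must serve for all base points, since the expansion is used
  along the whole cycle.\<close>

lemma h_uniform_taylor:
  assumes "\<epsilon> > 0"
  shows "\<exists>\<delta>>0. \<forall>x y. norm x = 1 \<longrightarrow> norm y = 1 \<longrightarrow> norm (x - y) < \<delta> \<longrightarrow>
    norm (h x - h y - D y (x - y)) \<le> \<epsilon> * norm (x - y)"
proof -
  \<comment> \<open>Chords between unit vectors leave the sphere. Points within 1/4 of a unit vector
    stay in this compact shell, where \<open>D\<close> is uniformly continuous.\<close>
  let ?K = "cball (0::'a) 2 - ball 0 (3 / 4)"
  have "compact ?K" by (intro compact_diff) auto
  moreover have "?K \<subseteq> {x. norm x > 1 / 2}" by auto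
  ultimately have "uniformly_continuous_on ?K D"
    using D_cont by (meson compact_uniformly_continuous continuous_on_subset)
  then obtain d where d: "d > 0" "\<And>x y. x \<in> ?K \<Longrightarrow> y \<in> ?K \<Longrightarrow> dist y x < d \<Longrightarrow> dist (D y) (D x) < \<epsilon>"
    unfolding uniformly_continuous_on_def using assms by metis
  show ?thesis
  proof (intro exI[of _ "min d (1 / 4)"] conjI allI impI)
    fix x y :: 'a assume xy: "norm x = 1" "norm y = 1" "norm (x - y) < min d (1 / 4)"
    have *: "z \<in> ?K" "dist z y < d" if "z \<in> ball y (min d (1 / 4))" for z
    proof -
      have "norm (z - y) < min d (1 / 4)" using that by (simp add: dist_norm norm_minus_commute)
      moreover have "\<bar>norm z - norm y\<bar> \<le> norm (z - y)" by (rule norm_triangle_ineq3)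
      ultimately have "\<bar>norm z - 1\<bar> < 1 / 4" "norm (z - y) < d" using xy(2) by linarith+
      then have "norm z \<le> 2" "3 / 4 \<le> norm z" "norm (z - y) < d" by linarith+
      then show "z \<in> ?K" "dist z y < d" by (auto simp: dist_norm)
    qed
    have "norm (h x - h y - blinfun_apply (D y) (x - y)) \<le> norm (x - y) * \<epsilon>"
    proof (rule differentiable_bound_linearization[where S = "ball y (min d (1 / 4))" and f' = "\<lambda>z. blinfun_apply (D z)"])
      fix t :: real assume "t \<in> {0..1}"
      then have "norm (t *\<^sub>R (x - y)) \<le> norm (x - y)" by (simp add: mult_left_le_one_le)
      then have "dist y (y + t *\<^sub>R (x - y)) < min d (1 / 4)" using xy unfolding dist_norm by simp
      then show "y + t *\<^sub>R (x - y) \<in> ball y (min d (1 / 4))" by simp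
    next
      fix z assume z: "z \<in> ball y (min d (1 / 4))"
      have "3 / 4 \<le> norm z" using *(1)[OF z] by simp
      then have "1 / 2 < norm z" by linarith
      then show "(h has_derivative D z) (at z within ball y (min d (1 / 4)))"
        by (rule has_derivative_at_withinI[OF h_deriv])
      have "onorm (blinfun_apply (D z) - blinfun_apply (D y)) = norm (D z - D y)"
        unfolding norm_blinfun.rep_eq by (rule arg_cong[where f = onorm]) (simp add: fun_eq_iff blinfun.diff_left)
      also have "\<dots> \<le> \<epsilon>" using d(2)[OF _ *[OF z]] xy by (simp add: dist_norm less_imp_le)
      finally show "onorm (blinfun_apply (D z) - blinfun_apply (D y)) \<le> \<epsilon>" .
    qed (use xy d in auto)
    then show "norm (h x - h y - D y (x - y)) \<le> \<epsilon> * norm (x - y)" by (simp add: mult.commute)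
  qed (use d in auto)
qed

text \<open>Differentiability of the flow at the cycle, phrased for whichever solutions start
  nearby, so that no flow map is needed. The error \<open>r\<close> solves the linearized equation
  with the Taylor remainder as forcing and starts at 0.\<close>

lemma flow_differentiable:
  assumes "b > 0" "\<epsilon> > 0"
  shows "\<exists>\<delta>>0. \<forall>Z. solution b Z \<longrightarrow> norm (Z 0 - Yp 0) < \<delta> \<longrightarrow>
    norm (Z b - Yp b - \<Phi> b (Z 0 - Yp 0)) \<le> \<epsilon> * norm (Z 0 - Yp 0)"
proof -
  obtain C where C: "C > 0" "\<And>s. norm (A s) \<le> C" using A_bound by blast
  define E where "E = exp (Lh * b)"
  \<comment> \<open>Chosen so that the Gronwall factor \<open>exp (2 * C * b) / C\<close> and the
    spreading factor \<open>E\<close> of nearby solutions leave exactly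
    \<open>\<epsilon>\<close>.\<close>
  define \<epsilon>' where "\<epsilon>' = \<epsilon> * C / (E * exp (2 * C * b))"
  have "\<epsilon>' > 0" using assms C by (simp add: \<epsilon>'_def E_def)
  then obtain d where d: "d > 0" "\<And>x y. norm x = 1 \<Longrightarrow> norm y = 1 \<Longrightarrow> norm (x - y) < d \<Longrightarrow>
    norm (h x - h y - D y (x - y)) \<le> \<epsilon>' * norm (x - y)" using h_uniform_taylor by meson
  show ?thesis
  proof (intro exI[of _ "d / E"] conjI allI impI)
    show "d / E > 0" using d by (simp add: E_def)
  next
    fix Z assume Z: "solution b Z" "norm (Z 0 - Yp 0) < d / E"
    define u0 where "u0 = Z 0 - Yp 0"
    define r where "r t = Z t - Yp t - \<Phi> t u0" for t
    define g where "g t = h (Z t) - h (Yp t) - A t (Z t - Yp t)" for t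
    have dist: "norm (Z t - Yp t) \<le> norm u0 * E" if "0 \<le> t" "t \<le> b" for t
    proof -
      have "norm (Z t - Yp t) \<le> norm (Z 0 - Yp 0) * exp (Lh * t)"
        using solution_dist[OF solution_mono[OF Z(1)] solution_Yp[of t 0]] that by simp
      also have "\<dots> \<le> norm u0 * E" unfolding u0_def E_def using that Lh(1) by (intro mult_left_mono) auto
      finally show ?thesis .
    qed
    have nr: "norm (r b) \<le> \<epsilon>' * (norm u0 * E) / C * exp (2 * C * (b - 0))"
    proof (rule gronwall_zero_start[where u' = "\<lambda>t. A t (r t) + g t"])
      have "continuous_on {0..b} (\<lambda>s. \<Phi> s u0)"
        using \<Phi>_deriv by (auto intro!: continuous_at_imp_continuous_on has_vector_derivative_continuous)
      then show "continuous_on {0..b} r"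
        using Z(1) unfolding r_def[abs_def] solution_def by (intro continuous_on_diff Yp_cont) auto
    next
      fix t assume t: "0 < t" "t < b"
      have "(Z has_vector_derivative h (Z t)) (at t)" using Z t by (auto simp: solution_def)
      then have "(r has_vector_derivative h (Z t) - h (Yp t) - A t (\<Phi> t u0)) (at t)"
        unfolding r_def[abs_def] by (intro has_vector_derivative_diff Yp_deriv \<Phi>_deriv)
      then show "(r has_vector_derivative A t (r t) + g t) (at t)"
        by (simp add: g_def r_def blinfun.diff_right blinfun.add_right algebra_simps)
      have "norm u0 * E < d" using Z(2) by (simp add: u0_def E_def field_simps)
      then have "norm (g t) \<le> \<epsilon>' * norm (Z t - Yp t)"
        unfolding g_def A_def using Z(1) t dist[of t] by (intro d) (auto simp: solution_def Yp_norm)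
      also have "\<dots> \<le> \<epsilon>' * (norm u0 * E)" using dist[of t] t \<open>\<epsilon>' > 0\<close> by (intro mult_left_mono) auto
      finally have "norm (g t) \<le> \<epsilon>' * (norm u0 * E)" .
      moreover have "norm (A t (r t)) \<le> C * norm (r t)"
        by (rule order_trans[OF norm_blinfun mult_right_mono[OF C(2)]]) simp
      ultimately show "norm (A t (r t) + g t) \<le> C * norm (r t) + \<epsilon>' * (norm u0 * E)"
        by (intro norm_triangle_le add_mono)
    qed (use assms C \<open>\<epsilon>' > 0\<close> in \<open>auto simp: r_def u0_def \<Phi> E_def\<close>)
    also have "\<epsilon>' * (norm u0 * E) / C * exp (2 * C * (b - 0)) = \<epsilon> * norm u0"
      using C by (simp add: \<epsilon>'_def E_def)
    finally show "norm (Z b - Yp b - \<Phi> b (Z 0 - Yp 0)) \<le> \<epsilon> * norm (Z 0 - Yp 0)"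
      by (simp add: r_def u0_def)
  qed
qed

end

section \<open>Asymptotic phase\<close>

text \<open>With \<open>r n\<close> the tail of the geometric series, the intervals
  \<open>[u n - r n, u n + r n]\<close> are nested; their common point is the limit, and their
  half-length is the rate.\<close>

lemma geometric_steps_convergent:
  fixes u :: "nat \<Rightarrow> real"
  assumes "0 \<le> q" "q < 1" and step: "\<And>n. \<bar>u (Suc n) - u n\<bar> \<le> C * q ^ n"
  shows "\<exists>\<sigma>. \<forall>n. \<bar>u n - \<sigma>\<bar> \<le> C / (1 - q) * q ^ n"
proof -
  define r where "r n = C / (1 - q) * q ^ n" for n
  have C: "C \<ge> 0" using step[of 0] by simp
  have r: "r n \<ge> 0" "r n = C * q ^ n + r (Suc n)" for n
    using assms C unfolding r_def by (simp_all add: field_simps)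
  have inc: "incseq (\<lambda>n. u n - r n)" and dec: "decseq (\<lambda>n. u n + r n)"
  proof -
    have "u n - r n \<le> u (Suc n) - r (Suc n)" "u (Suc n) + r (Suc n) \<le> u n + r n" for n
      using step[of n] r(2)[of n] unfolding abs_le_iff by linarith+
    then show "incseq (\<lambda>n. u n - r n)" "decseq (\<lambda>n. u n + r n)"
      by (auto intro!: incseq_SucI decseq_SucI)
  qed
  have le: "u n - r n \<le> u m + r m" for n m
    using incseqD[OF inc, of n "max n m"] decseqD[OF dec, of m "max n m"] r(1)[of "max n m"] by simp
  define \<sigma> where "\<sigma> = (SUP n. u n - r n)"
  have "u n - r n \<le> \<sigma>" for n
    unfolding \<sigma>_def by (rule cSUP_upper) (auto intro!: bdd_aboveI[of _ "u 0 + r 0"] le)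
  moreover have "\<sigma> \<le> u n + r n" for n
    unfolding \<sigma>_def by (rule cSUP_least) (auto intro: le)
  ultimately have "\<bar>u n - \<sigma>\<bar> \<le> r n" for n unfolding abs_le_iff by (simp add: algebra_simps)
  then show ?thesis unfolding r_def by blast
qed

text \<open>By \<open>a_velocity\<close>, the quantity \<open>a \<bullet> (y - Yp 0)\<close> is to
  first order the time by which \<open>y\<close> is ahead of the section.\<close>

locale contracting_cycle = sphere_cycle +
  fixes a :: 'a and k :: nat
  assumes a_tangent: "a \<bullet> Yp 0 = 0" and a_velocity: "a \<bullet> h (Yp 0) = 1"
    and a_left_eigenvector: "\<And>w. w \<bullet> Yp 0 = 0 \<Longrightarrow> a \<bullet> \<Phi> T w = a \<bullet> w"
    and k_pos: "k > 0"
    and contraction: "\<And>w. w \<bullet> Yp 0 = 0 \<Longrightarrow> a \<bullet> w = 0 \<Longrightarrow>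
      norm ((blinfun_apply (\<Phi> T) ^^ k) w) \<le> 1 / 2 * norm w"
begin

text \<open>A return comprises \<open>k\<close> turns, because a single turn need not shorten
  vectors in the Euclidean norm.\<close>

definition T' where "T' = real k * T"

lemma T'_pos: "T' > 0"
  using k_pos T_pos by (simp add: T'_def)

lemma Yp_T': "Yp (s + real n * T') = Yp s"
  using periodic_shift_nat[of Yp T s "n * k", OF Yp_per] by (simp add: T'_def mult.assoc)

lemma \<Phi>_T'_contraction: "w \<bullet> Yp 0 = 0 \<Longrightarrow> a \<bullet> w = 0 \<Longrightarrow> norm (\<Phi> T' w) \<le> 1 / 2 * norm w"
  using contraction[of w] by (simp add: T'_def \<Phi>_funpow)

lemma \<Phi>_T'_left: "w \<bullet> Yp 0 = 0 \<Longrightarrow> a \<bullet> \<Phi> T' w = a \<bullet> w"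
proof -
  assume w: "w \<bullet> Yp 0 = 0"
  have "(blinfun_apply (\<Phi> T) ^^ n) w \<bullet> Yp 0 = 0 \<and> a \<bullet> (blinfun_apply (\<Phi> T) ^^ n) w = a \<bullet> w" for n
  proof (induction n)
    case (Suc n)
    then show ?case using \<Phi>_tangent[of _ T] by (simp add: a_left_eigenvector Yp_T)
  qed (simp add: w)
  then show ?thesis unfolding T'_def by (metis \<Phi>_funpow)
qed

definition trajectory where "trajectory Y \<longleftrightarrow> (\<forall>b. solution b Y)"

lemma trajectory_norm: "trajectory Y \<Longrightarrow> s \<ge> 0 \<Longrightarrow> norm (Y s) = 1"
  unfolding trajectory_def solution_def by (meson atLeastAtMost_iff order_refl)

lemma trajectory_deriv: "trajectory Y \<Longrightarrow> s > 0 \<Longrightarrow> (Y has_vector_derivative h (Y s)) (at s)"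
  unfolding trajectory_def solution_def by (metis gt_ex greaterThanLessThan_iff)

lemma trajectory_cont: "trajectory Y \<Longrightarrow> 0 \<le> c \<Longrightarrow> continuous_on {c..b} Y"
  unfolding trajectory_def solution_def by (meson atLeastatMost_subset_iff continuous_on_subset order_refl)

lemma trajectory_shift: "trajectory Y \<Longrightarrow> c \<ge> 0 \<Longrightarrow> trajectory (\<lambda>s. Y (s + c))"
  unfolding trajectory_def[of "\<lambda>s. Y (s + c)"] solution_def
proof (intro allI conjI ballI)
  fix b assume Y: "trajectory Y" "c \<ge> 0"
  show "continuous_on {0..b} (\<lambda>s. Y (s + c))"
    by (rule continuous_on_compose2[OF trajectory_cont[OF Y(1) order_refl, of "b + c"]])
       (use Y in \<open>auto intro!: continuous_intros\<close>)
  fix t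
  show "norm (Y (t + c)) = 1" if "t \<in> {0..b}"
    using Y that by (intro trajectory_norm) auto
  assume "t \<in> {0<..<b}"
  then have d: "(Y has_vector_derivative h (Y (t + c))) (at (t + c))"
    using Y by (intro trajectory_deriv) auto
  have "((\<lambda>s. s + c) has_vector_derivative 1) (at t)"
    by (auto intro!: derivative_eq_intros)
  from vector_diff_chain_at[OF this d]
  show "((\<lambda>s. Y (s + c)) has_vector_derivative h (Y (t + c))) (at t)" by (simp add: o_def)
qed

lemma trajectory_speed:
  assumes Y: "trajectory Y" and "0 \<le> s" "s \<le> t"
  shows "norm (Y t - Y s) \<le> Kh * (t - s)"
proof (cases "s < t")
  case True
  have "norm (Y t - Y s) \<le> Kh * t - Kh * s"
  proof (rule differentiable_bound_general[where f' = "\<lambda>t. h (Y t)" and \<phi>' = "\<lambda>_. Kh"])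
    fix x assume x: "s < x" "x < t"
    show "(Y has_vector_derivative h (Y x)) (at x)" using x assms by (intro trajectory_deriv) auto
    show "norm (h (Y x)) \<le> Kh" using x assms by (intro Kh trajectory_norm) auto
    show "((\<lambda>x. Kh * x) has_vector_derivative Kh) (at x)"
      by (auto intro!: derivative_eq_intros simp flip: has_real_derivative_iff_has_vector_derivative)
  qed (use assms True in \<open>auto intro!: trajectory_cont continuous_intros\<close>)
  then show ?thesis by (simp add: algebra_simps)
qed (use assms in simp)

lemma trajectory_Yp: "trajectory (\<lambda>s. Yp (s + c))"
  unfolding trajectory_def using solution_Yp by blast

lemma trajectory_stays_near:
  assumes Y: "trajectory Y" and Z: "trajectory Z" and "b \<ge> 0"
  shows "norm (Y b - Z b) \<le> norm (Y 0 - Z 0) * exp (Lh * b)"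
  using solution_dist[of b Y Z] assms unfolding trajectory_def by blast

section \<open>Hitting the section and returning to it\<close>

text \<open>Near \<open>Yp 0\<close> the function \<open>a \<bullet> (Y s - Yp 0)\<close> has slope
  at least 1/2, so it vanishes within twice its present absolute value of the time \<open>S\<close>,
  before or after.\<close>

lemma section_crossing:
  "\<exists>\<delta>>0. \<forall>Y S. trajectory Y \<longrightarrow> S \<ge> 1 \<longrightarrow> norm (Y S - Yp 0) < \<delta> \<longrightarrow>
    (\<exists>S'. \<bar>S' - S\<bar> \<le> 2 * \<bar>a \<bullet> (Y S - Yp 0)\<bar> \<and> a \<bullet> (Y S' - Yp 0) = 0 \<and>
      norm (Y S' - Yp 0) \<le> norm (Y S - Yp 0) + Kh * \<bar>S' - S\<bar>)"
proof -
  \<comment> \<open>Within \<open>\<eta>\<close> of \<open>Yp 0\<close> the Lipschitz bound lets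
    \<open>a \<bullet> h y\<close> drop by at most 1/2 from its value 1; the summand 1 guards the
    division.\<close>
  define \<eta> where "\<eta> = 1 / (2 * (norm a * Lh + 1))"
  have pos: "norm a * Lh + 1 > 0" "1 + 2 * norm a * Kh > 0" "2 * norm a + 1 > 0"
  proof -
    have "norm a * Lh \<ge> 0" "norm a * Kh \<ge> 0" "norm a \<ge> 0" using Lh(1) Kh(1) by auto
    then show "norm a * Lh + 1 > 0" "1 + 2 * norm a * Kh > 0" "2 * norm a + 1 > 0" by linarith+
  qed
  have \<eta>: "\<eta> > 0" "norm a * Lh * \<eta> \<le> 1 / 2" unfolding \<eta>_def using pos by (auto simp: field_simps)
  have slope: "a \<bullet> h y \<ge> 1 / 2" if "norm y = 1" "norm (y - Yp 0) < \<eta>" for y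
  proof -
    have ah: "a \<bullet> h y = 1 - a \<bullet> (h (Yp 0) - h y)" by (simp add: a_velocity inner_diff_right)
    have cs: "a \<bullet> (h (Yp 0) - h y) \<le> norm a * norm (h (Yp 0) - h y)" by (rule norm_cauchy_schwarz)
    have "norm (h (Yp 0) - h y) \<le> Lh * norm (Yp 0 - y)" by (rule Lh(2)) (simp_all add: Yp_norm that)
    moreover have "Lh * norm (Yp 0 - y) \<le> Lh * \<eta>"
      using that(2) Lh(1) by (intro mult_left_mono) (auto simp: norm_minus_commute)
    ultimately have "norm (h (Yp 0) - h y) \<le> Lh * \<eta>" by linarith
    then have "norm a * norm (h (Yp 0) - h y) \<le> norm a * (Lh * \<eta>)" by (rule mult_left_mono) simp
    then show ?thesis using ah cs \<eta>(2) by (simp add: mult.assoc)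
  qed
  \<comment> \<open>The first bound keeps the whole window of radius \<open>m\<close> around
    \<open>S\<close> in the \<open>\<eta>\<close>-ball; the second gives
    \<open>m \<le> 1 \<le> S\<close>, so the window stays in nonnegative time.\<close>
  define \<delta> where "\<delta> = min (\<eta> / (1 + 2 * norm a * Kh)) (1 / (2 * norm a + 1))"
  show ?thesis
  proof (rule exI[of _ \<delta>], intro conjI allI impI)
    show "\<delta> > 0" using \<eta> pos by (auto simp: \<delta>_def)
  next
    fix Y S assume Y: "trajectory Y" and S: "S \<ge> 1" and near: "norm (Y S - Yp 0) < \<delta>"
    define g where "g s = a \<bullet> (Y s - Yp 0)" for s
    define r where "r = norm (Y S - Yp 0)"
    define m where "m = 2 * \<bar>g S\<bar>"
    have gS: "\<bar>g S\<bar> \<le> norm a * r" unfolding g_def r_def by (rule Cauchy_Schwarz_ineq2)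
    have r: "r \<ge> 0" "r * (1 + 2 * norm a * Kh) < \<eta>" "r * (2 * norm a + 1) < 1"
      using near pos unfolding \<delta>_def r_def by (auto simp: field_simps)
    have m: "0 \<le> m" "m \<le> 1" "r + Kh * m < \<eta>"
    proof -
      show "0 \<le> m" by (simp add: m_def)
      show "m \<le> 1" using gS r by (simp add: m_def algebra_simps)
      have "Kh * m \<le> Kh * (2 * (norm a * r))" unfolding m_def using gS Kh(1) by (intro mult_left_mono) auto
      then show "r + Kh * m < \<eta>" using r(2) by (simp add: algebra_simps)
    qed
    have close: "norm (Y s - Yp 0) \<le> r + Kh * \<bar>s - S\<bar>" if "\<bar>s - S\<bar> \<le> m" for s
    proof -
      have "norm (Y s - Y S) \<le> Kh * \<bar>s - S\<bar>"
      proof (cases "s \<le> S")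
        case True
        then show ?thesis using trajectory_speed[OF Y, of s S] that m S by (simp add: norm_minus_commute)
      next
        case False
        then show ?thesis using trajectory_speed[OF Y, of S s] that m S by simp
      qed
      moreover have "norm (Y s - Yp 0) \<le> norm (Y s - Y S) + r"
        unfolding r_def using norm_triangle_ineq[of "Y s - Y S" "Y S - Yp 0"] by simp
      ultimately show ?thesis by linarith
    qed
    have dg: "(g has_real_derivative a \<bullet> h (Y s)) (at s)" and dpos: "a \<bullet> h (Y s) \<ge> 1 / 2"
      if "\<bar>s - S\<bar> \<le> m" "s > 0" for s
    proof -
      show "(g has_real_derivative a \<bullet> h (Y s)) (at s)"
        unfolding g_def has_real_derivative_iff_has_vector_derivative
        using trajectory_deriv[OF Y that(2)]
        by (auto intro!: derivative_eq_intros bounded_linear.has_vector_derivative[OF bounded_linear_inner_right])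
      have "Kh * \<bar>s - S\<bar> \<le> Kh * m" using that Kh(1) by (intro mult_left_mono) auto
      then show "a \<bullet> h (Y s) \<ge> 1 / 2"
        using close[OF that(1)] m(3) that by (intro slope trajectory_norm[OF Y]) auto
    qed
    have cg: "continuous_on {c..d} g" if "c \<ge> 0" for c d
      unfolding g_def by (intro continuous_intros trajectory_cont Y that)
    have grow: "g d - g c \<ge> (d - c) / 2" if "c \<le> d" "\<bar>c - S\<bar> \<le> m" "\<bar>d - S\<bar> \<le> m" for c d
    proof -
      have "g c - c / 2 \<le> g d - d / 2"
      proof (rule DERIV_nonneg_imp_increasing_open[OF that(1)])
        fix x assume x: "c < x" "x < d"
        then have "\<bar>x - S\<bar> \<le> m" "x > 0" using that m S by auto
        from dg[OF this] dpos[OF this]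
        show "\<exists>y. ((\<lambda>s. g s - s / 2) has_real_derivative y) (at x) \<and> 0 \<le> y"
          by (intro exI[of _ "a \<bullet> h (Y x) - 1 / 2"]) (auto intro!: derivative_eq_intros)
      qed (use that m S in \<open>auto intro!: continuous_intros cg\<close>)
      then show ?thesis by (simp add: field_simps)
    qed
    have "\<exists>S'. \<bar>S' - S\<bar> \<le> m \<and> g S' = 0"
    proof (cases "g S \<ge> 0")
      case True
      have "g (S - m) \<le> 0" using grow[of "S - m" S] m True by (simp add: m_def)
      then have "\<exists>x\<ge>S - m. x \<le> S \<and> g x = 0"
        using True m S by (intro IVT' cg) auto
      then obtain x where x: "S - m \<le> x" "x \<le> S" "g x = 0" by blast
      then have "\<bar>x - S\<bar> \<le> m" by linarith
      with x(3) show ?thesis by blast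
    next
      case False
      have "g (S + m) \<ge> 0" using grow[of S "S + m"] m False by (simp add: m_def)
      then have "\<exists>x\<ge>S. x \<le> S + m \<and> g x = 0"
        using False m S by (intro IVT' cg) auto
      then obtain x where x: "S \<le> x" "x \<le> S + m" "g x = 0" by blast
      then have "\<bar>x - S\<bar> \<le> m" by linarith
      with x(3) show ?thesis by blast
    qed
    then obtain S' where S': "\<bar>S' - S\<bar> \<le> m" "g S' = 0" by blast
    from close[OF S'(1)] S' show "\<exists>S'. \<bar>S' - S\<bar> \<le> 2 * \<bar>a \<bullet> (Y S - Yp 0)\<bar> \<and> a \<bullet> (Y S' - Yp 0) = 0 \<and>
      norm (Y S' - Yp 0) \<le> norm (Y S - Yp 0) + Kh * \<bar>S' - S\<bar>"
      unfolding m_def g_def r_def by blast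
  qed
qed

text \<open>The displacement \<open>e\<close> is tangent up to a term of second order. Its tangent
  part \<open>w\<close> is halved by \<open>\<Phi> T'\<close> and stays annihilated by
  \<open>a\<close>, so both the position error and the shift in hitting time come from the curvature
  term and the linearization error alone. Their total effect is kept below a quarter of
  \<open>norm e\<close>, which leaves the factor 3/4.\<close>

lemma section_return:
  "\<exists>\<delta>>0. \<forall>Y S. trajectory Y \<longrightarrow> S \<ge> 1 \<longrightarrow> norm (Y S - Yp 0) < \<delta> \<longrightarrow> a \<bullet> (Y S - Yp 0) = 0 \<longrightarrow>
    (\<exists>S'\<ge>S. \<bar>S' - (S + T')\<bar> \<le> norm a * norm (Y S - Yp 0) \<and> a \<bullet> (Y S' - Yp 0) = 0 \<and>
      norm (Y S' - Yp 0) \<le> 3 / 4 * norm (Y S - Yp 0))"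
proof -
  obtain \<delta>c where \<delta>c: "\<delta>c > 0"
    "\<And>Y S. trajectory Y \<Longrightarrow> S \<ge> 1 \<Longrightarrow> norm (Y S - Yp 0) < \<delta>c \<Longrightarrow>
    (\<exists>S'. \<bar>S' - S\<bar> \<le> 2 * \<bar>a \<bullet> (Y S - Yp 0)\<bar> \<and> a \<bullet> (Y S' - Yp 0) = 0 \<and>
      norm (Y S' - Yp 0) \<le> norm (Y S - Yp 0) + Kh * \<bar>S' - S\<bar>)"
    using section_crossing by meson
  define B where "B = norm (\<Phi> T')"
  \<comment> \<open>\<open>c1\<close> adds the error terms: 1/4 from the norm of \<open>w\<close>, 1
    from the linearization, \<open>B / 2\<close> from the normal part of \<open>e\<close>.
    \<open>c2\<close> is the cost of moving on to the section, and \<open>\<epsilon>\<close> makes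
    \<open>c1 * \<epsilon> * c2 = 1 / 4\<close>.\<close>
  define c1 where "c1 = 5 / 4 + B / 2"
  define c2 where "c2 = 1 + 2 * Kh * norm a"
  define \<epsilon> where "\<epsilon> = 1 / (4 * c1 * c2)"
  have "B \<ge> 0" by (simp add: B_def)
  then have c: "c1 \<ge> 1" "c2 \<ge> 1" using Kh(1) by (auto simp: c1_def c2_def)
  have \<epsilon>: "\<epsilon> > 0" "c1 * \<epsilon> * c2 = 1 / 4" using c by (auto simp: \<epsilon>_def)
  have c1\<epsilon>: "c1 * \<epsilon> \<le> 1 / 4"
  proof -
    have "c1 * \<epsilon> * 1 \<le> c1 * \<epsilon> * c2" using \<epsilon>(1) c by (intro mult_left_mono) auto
    then show ?thesis using \<epsilon>(2) by simp
  qed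
  obtain \<delta>1 where \<delta>1: "\<delta>1 > 0" "\<And>Z. solution T' Z \<Longrightarrow> norm (Z 0 - Yp 0) < \<delta>1 \<Longrightarrow>
    norm (Z T' - Yp T' - \<Phi> T' (Z 0 - Yp 0)) \<le> \<epsilon> * norm (Z 0 - Yp 0)"
    using flow_differentiable[OF T'_pos \<epsilon>(1)] by meson
  \<comment> \<open>The bound by \<open>\<epsilon>\<close> turns quadratic terms into
    \<open>\<epsilon> * norm e\<close>; the bound by \<open>T' / (norm a + 1)\<close> keeps the new
    hit from preceding \<open>S\<close>.\<close>
  define \<delta> where "\<delta> = min (min \<delta>c \<delta>1) (min \<epsilon> (T' / (norm a + 1)))"
  show ?thesis
  proof (rule exI[of _ \<delta>], intro conjI allI impI)
    show "\<delta> > 0" using \<delta>c \<delta>1 \<epsilon> T'_pos by (simp add: \<delta>_def add_nonneg_pos)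
  next
    fix Y S assume Y: "trajectory Y" and S: "S \<ge> 1" and near: "norm (Y S - Yp 0) < \<delta>"
      and sec: "a \<bullet> (Y S - Yp 0) = 0"
    define e where "e = Y S - Yp 0"
    define e1 where "e1 = Y (S + T') - Yp 0"
    define w where "w = e - (e \<bullet> Yp 0) *\<^sub>R Yp 0"
    define \<rho> where "\<rho> = e1 - \<Phi> T' e"
    have ne: "norm e < \<delta>c" "norm e < \<delta>1" "norm e < \<epsilon>" "norm e < T' / (norm a + 1)"
      using near by (auto simp: e_def \<delta>_def)
    have "norm (Y (T' + S) - Yp T' - \<Phi> T' (Y (0 + S) - Yp 0)) \<le> \<epsilon> * norm (Y (0 + S) - Yp 0)"
      using trajectory_shift[OF Y, of S] S ne by (intro \<delta>1) (auto simp: trajectory_def e_def)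
    then have \<rho>: "norm \<rho> \<le> \<epsilon> * norm e"
      using Yp_T'[of 0 1] by (simp add: \<rho>_def e1_def e_def add.commute)
    have "(norm (Yp 0 + e))\<^sup>2 = 1" using trajectory_norm[OF Y, of S] S by (simp add: e_def)
    \<comment> \<open>Both \<open>Yp 0\<close> and \<open>Yp 0 + e\<close> are unit vectors, so the
      normal component of \<open>e\<close> is quadratic.\<close>
    then have ey: "e \<bullet> Yp 0 = - (norm e * norm e) / 2"
      unfolding power2_norm_eq_inner using Yp_norm[of 0]
      by (simp add: inner_add inner_commute norm_eq_1 power2_norm_eq_inner flip: power2_eq_square)
    have yy: "Yp 0 \<bullet> Yp 0 = 1" using Yp_norm[of 0] by (simp add: norm_eq_1)
    have w: "w \<bullet> Yp 0 = 0" "a \<bullet> w = 0"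
      using sec by (simp_all add: w_def inner_diff yy e_def[symmetric] a_tangent)
    have ew: "norm (e - w) = norm e * norm e / 2" by (simp add: w_def ey Yp_norm)
    have ne2: "norm e * norm e \<le> \<epsilon> * norm e" using ne(3) by (intro mult_right_mono) auto
    have nw: "norm w \<le> norm e + norm e * norm e / 2"
      using norm_triangle_ineq4[of e "e - w"] ew by simp
    have \<Phi>w: "norm (\<Phi> T' w) \<le> 1 / 2 * norm e + norm e * norm e / 4"
      using \<Phi>_T'_contraction[OF w] nw by simp
    have \<Phi>ew: "norm (\<Phi> T' (e - w)) \<le> B * (norm e * norm e / 2)"
      using norm_blinfun[of "\<Phi> T'" "e - w"] ew by (simp add: B_def)
    have e1: "e1 = \<Phi> T' w + (\<Phi> T' (e - w) + \<rho>)" by (simp add: \<rho>_def blinfun.diff_right)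
    have B0: "B \<ge> 0" by (simp add: B_def)
    have B1: "B * (norm e * norm e / 2) \<le> B * (\<epsilon> * norm e / 2)" using ne2 B0 by (intro mult_left_mono) auto
    have small: "norm (\<Phi> T' (e - w) + \<rho>) \<le> (B / 2 + 1) * (\<epsilon> * norm e)"
      using norm_triangle_ineq[of "\<Phi> T' (e - w)" \<rho>] \<Phi>ew \<rho> B1 by (simp add: algebra_simps)
    have ne1: "norm e1 \<le> (1 / 2 + c1 * \<epsilon>) * norm e"
    proof -
      have "norm e1 \<le> (1 / 2 * norm e + norm e * norm e / 4) + (B / 2 + 1) * (\<epsilon> * norm e)"
        unfolding e1 using \<Phi>w small by (rule norm_triangle_mono)
      also have "\<dots> \<le> (1 / 2 * norm e + \<epsilon> * norm e / 4) + (B / 2 + 1) * (\<epsilon> * norm e)" using ne2 by simp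
      also have "\<dots> = (1 / 2 + c1 * \<epsilon>) * norm e" by (simp add: c1_def field_simps)
      finally show ?thesis .
    qed
    have "norm e1 \<le> norm e"
      using ne1 c1\<epsilon> mult_right_mono[of "1 / 2 + c1 * \<epsilon>" 1 "norm e"] by simp
    then obtain S' where S': "\<bar>S' - (S + T')\<bar> \<le> 2 * \<bar>a \<bullet> e1\<bar>" "a \<bullet> (Y S' - Yp 0) = 0"
      "norm (Y S' - Yp 0) \<le> norm e1 + Kh * \<bar>S' - (S + T')\<bar>"
      using \<delta>c(2)[OF Y, of "S + T'"] S T'_pos ne(1) unfolding e1_def by auto
    \<comment> \<open>Here the left eigenvector pays off: the main term of \<open>e1\<close> does
      not move off the section, and the time correction sees the small remainder only.\<close>
    have "a \<bullet> \<Phi> T' w = 0" using \<Phi>_T'_left[OF w(1)] w by simp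
    then have "\<bar>a \<bullet> e1\<bar> \<le> norm a * norm (\<Phi> T' (e - w) + \<rho>)"
      unfolding e1 inner_add_right[of a "\<Phi> T' w"] using Cauchy_Schwarz_ineq2[of a "\<Phi> T' (e - w) + \<rho>"] by simp
    also have "\<dots> \<le> norm a * (c1 * \<epsilon> * norm e)"
    proof -
      have "(B / 2 + 1) * (\<epsilon> * norm e) \<le> c1 * (\<epsilon> * norm e)"
        using \<epsilon>(1) by (intro mult_right_mono) (auto simp: c1_def)
      with small show ?thesis by (intro mult_left_mono) (auto simp: mult.assoc)
    qed
    finally have ae1: "\<bar>a \<bullet> e1\<bar> \<le> norm a * (c1 * \<epsilon> * norm e)" .
    have "norm a * (c1 * \<epsilon> * norm e) \<le> norm a * (1 / 4 * norm e)"
      using c1\<epsilon> by (intro mult_left_mono mult_right_mono) auto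
    then have dS: "\<bar>S' - (S + T')\<bar> \<le> norm a * norm e" using S'(1) ae1 by simp
    have "Kh * \<bar>S' - (S + T')\<bar> \<le> Kh * (2 * (norm a * (c1 * \<epsilon> * norm e)))"
      using S'(1) ae1 Kh(1) by (intro mult_left_mono) auto
    then have "norm (Y S' - Yp 0) \<le> (1 / 2 + c1 * \<epsilon> * c2) * norm e"
      using S'(3) ne1 by (simp add: c2_def algebra_simps)
    then have decay: "norm (Y S' - Yp 0) \<le> 3 / 4 * norm e" by (simp add: \<epsilon>(2))
    have "norm e * (norm a + 1) < T'" using ne(4) by (subst (asm) pos_less_divide_eq) (auto simp: add_nonneg_pos)
    moreover have "norm e * (norm a + 1) = norm a * norm e + norm e" by (simp add: algebra_simps)
    ultimately have "norm a * norm e \<le> T'" using norm_ge_zero[of e] by linarith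
    then have "S' \<ge> S" using dS by linarith
    with dS S'(2) decay
    show "\<exists>S'\<ge>S. \<bar>S' - (S + T')\<bar> \<le> norm a * norm (Y S - Yp 0) \<and> a \<bullet> (Y S' - Yp 0) = 0 \<and>
      norm (Y S' - Yp 0) \<le> 3 / 4 * norm (Y S - Yp 0)" unfolding e_def by blast
  qed
qed

text \<open>Smallness of \<open>infdist\<close> gives closeness to some point
  \<open>Yp \<theta>\<close> of unknown phase. Flowing on for the rest of the period brings the
  trajectory to \<open>Yp T = Yp 0\<close> at the price of a factor \<open>exp (Lh * T)\<close>, and
  \<open>section_crossing\<close> does the rest.\<close>

lemma reaches_section:
  assumes Y: "trajectory Y" and lim: "((\<lambda>S. infdist (Y S) (orbit Yp T)) \<longlongrightarrow> 0) at_top" and "\<delta> > 0"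
  shows "\<exists>S\<ge>1. norm (Y S - Yp 0) < \<delta> \<and> a \<bullet> (Y S - Yp 0) = 0"
proof -
  obtain \<delta>c where \<delta>c: "\<delta>c > 0"
    "\<And>Y S. trajectory Y \<Longrightarrow> S \<ge> 1 \<Longrightarrow> norm (Y S - Yp 0) < \<delta>c \<Longrightarrow>
    (\<exists>S'. \<bar>S' - S\<bar> \<le> 2 * \<bar>a \<bullet> (Y S - Yp 0)\<bar> \<and> a \<bullet> (Y S' - Yp 0) = 0 \<and>
      norm (Y S' - Yp 0) \<le> norm (Y S - Yp 0) + Kh * \<bar>S' - S\<bar>)"
    using section_crossing by meson
  define c where "c = 1 + 2 * norm a * Kh"
  have c: "c \<ge> 1" using Kh(1) by (simp add: c_def)
  define r where "r = min (min \<delta>c (\<delta> / c)) (1 / (2 * norm a + 1))"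
  have r: "r > 0" using \<delta>c c \<open>\<delta> > 0\<close> by (simp add: r_def add_nonneg_pos)
  have "\<forall>\<^sub>F S in at_top. infdist (Y S) (orbit Yp T) < r / exp (Lh * T)"
    using r by (intro order_tendstoD(2)[OF lim]) simp
  then have "\<forall>\<^sub>F S in at_top. infdist (Y S) (orbit Yp T) < r / exp (Lh * T) \<and> S \<ge> 2"
    using eventually_ge_at_top[of 2] by eventually_elim auto
  then obtain S where S: "infdist (Y S) (orbit Yp T) < r / exp (Lh * T)" "S \<ge> 2"
    using eventually_happens'[OF trivial_limit_at_top_linorder] by blast
  have ne: "orbit Yp T \<noteq> {}" using T_pos by (auto simp: orbit_def)
  have "\<exists>y\<in>orbit Yp T. dist (Y S) y < r / exp (Lh * T)"
  proof (rule ccontr)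
    assume "\<not> ?thesis"
    then have "r / exp (Lh * T) \<le> infdist (Y S) (orbit Yp T)"
      unfolding infdist_notempty[OF ne] using ne by (intro cINF_greatest) (auto simp: not_less)
    with S show False by simp
  qed
  then obtain \<theta> where \<theta>: "0 \<le> \<theta>" "\<theta> < T" "norm (Y S - Yp \<theta>) < r / exp (Lh * T)"
    by (auto simp: orbit_def dist_norm)
  define S1 where "S1 = T - \<theta> + S"
  have "norm (Y (T - \<theta> + S) - Yp (T - \<theta> + \<theta>)) \<le> norm (Y (0 + S) - Yp (0 + \<theta>)) * exp (Lh * (T - \<theta>))"
    using trajectory_stays_near[OF trajectory_shift[OF Y, of S] trajectory_Yp[of \<theta>], of "T - \<theta>"] S \<theta> by simp
  also have "\<dots> \<le> norm (Y S - Yp \<theta>) * exp (Lh * T)"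
    using \<theta> Lh(1) by (auto intro!: mult_left_mono)
  also have "\<dots> < r" using \<theta>(3) by (simp add: field_simps)
  finally have near: "norm (Y S1 - Yp 0) < r" by (simp add: Yp_T S1_def)
  moreover have S1: "S1 \<ge> 2" using S \<theta> by (simp add: S1_def)
  ultimately obtain S' where S': "\<bar>S' - S1\<bar> \<le> 2 * \<bar>a \<bullet> (Y S1 - Yp 0)\<bar>" "a \<bullet> (Y S' - Yp 0) = 0"
      "norm (Y S' - Yp 0) \<le> norm (Y S1 - Yp 0) + Kh * \<bar>S' - S1\<bar>"
    using \<delta>c(2)[OF Y, of S1] by (auto simp: r_def)
  have "\<bar>a \<bullet> (Y S1 - Yp 0)\<bar> \<le> norm a * norm (Y S1 - Yp 0)" by (rule Cauchy_Schwarz_ineq2)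
  with S'(1) have dS: "\<bar>S' - S1\<bar> \<le> 2 * (norm a * norm (Y S1 - Yp 0))" by simp
  then have "Kh * \<bar>S' - S1\<bar> \<le> Kh * (2 * (norm a * norm (Y S1 - Yp 0)))" using Kh(1) by (intro mult_left_mono) auto
  then have "norm (Y S' - Yp 0) \<le> c * norm (Y S1 - Yp 0)" using S'(3) by (simp add: c_def algebra_simps)
  also have "\<dots> < c * (\<delta> / c)" using near c by (intro mult_strict_left_mono) (auto simp: r_def)
  finally have "norm (Y S' - Yp 0) < \<delta>" using c by simp
  moreover have "norm (Y S1 - Yp 0) * (2 * norm a + 1) < 1"
  proof -
    have "norm (Y S1 - Yp 0) < 1 / (2 * norm a + 1)" using near by (simp add: r_def)
    then show ?thesis by (subst (asm) pos_less_divide_eq) (auto simp: add_nonneg_pos)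
  qed
  then have "norm (Y S1 - Yp 0) + 2 * (norm a * norm (Y S1 - Yp 0)) < 1" by (simp add: algebra_simps)
  then have "\<bar>S' - S1\<bar> \<le> 1" using dS norm_ge_zero[of "Y S1 - Yp 0"] by linarith
  ultimately show ?thesis using S'(2) S1 by (intro exI[of _ S']) auto
qed

text \<open>The hit times minus multiples of \<open>T'\<close> have geometrically small increments;
  their limit \<open>\<sigma>\<close> determines the phase \<open>- \<sigma>\<close>. Between hits
  the trajectory is compared with the cycle restarted at \<open>Yp 0\<close>, which costs a bounded
  factor.\<close>

theorem asymptotic_phase:
  assumes Y: "trajectory Y" and lim: "((\<lambda>S. infdist (Y S) (orbit Yp T)) \<longlongrightarrow> 0) at_top"
  shows "\<exists>\<theta> C \<kappa> S0. \<kappa> > 0 \<and> (\<forall>S\<ge>S0. norm (Y S - Yp (S + \<theta>)) \<le> C * exp (- \<kappa> * S))"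
proof -
  from section_return obtain \<delta> where \<delta>: "\<delta> > 0" and
    return: "\<forall>Y S. trajectory Y \<longrightarrow> S \<ge> 1 \<longrightarrow> norm (Y S - Yp 0) < \<delta> \<longrightarrow> a \<bullet> (Y S - Yp 0) = 0 \<longrightarrow>
    (\<exists>S'\<ge>S. \<bar>S' - (S + T')\<bar> \<le> norm a * norm (Y S - Yp 0) \<and> a \<bullet> (Y S' - Yp 0) = 0 \<and>
      norm (Y S' - Yp 0) \<le> 3 / 4 * norm (Y S - Yp 0))"
    by (elim exE conjE)
  define ok where "ok S \<longleftrightarrow> S \<ge> 1 \<and> norm (Y S - Yp 0) < \<delta> \<and> a \<bullet> (Y S - Yp 0) = 0" for S
  define next_hit where "next_hit S S' \<longleftrightarrow> \<bar>S' - (S + T')\<bar> \<le> norm a * norm (Y S - Yp 0) \<and>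
      norm (Y S' - Yp 0) \<le> 3 / 4 * norm (Y S - Yp 0)" for S S'
  have "\<exists>f. \<forall>n. ok (f n) \<and> next_hit (f n) (f (Suc n))"
  proof (rule dependent_nat_choice)
    show "\<exists>S. ok S" using reaches_section[OF Y lim \<delta>(1)] unfolding ok_def by blast
    fix S assume "ok S"
    then obtain S' where "S' \<ge> S" "next_hit S S'" "a \<bullet> (Y S' - Yp 0) = 0"
      using return[rule_format, OF Y, of S] unfolding ok_def next_hit_def by blast
    moreover have "norm (Y S' - Yp 0) < \<delta>"
      using \<open>ok S\<close> \<open>next_hit S S'\<close> norm_ge_zero[of "Y S - Yp 0"] unfolding ok_def next_hit_def by linarith
    ultimately show "\<exists>S'. ok S' \<and> next_hit S S'"
      using \<open>ok S\<close> by (intro exI[of _ S']) (auto simp: ok_def)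
  qed
  then obtain f where f: "\<And>n. ok (f n)" "\<And>n. next_hit (f n) (f (Suc n))" by blast
  have e: "norm (Y (f n) - Yp 0) \<le> \<delta> * (3 / 4) ^ n" for n
  proof (induction n)
    case 0 then show ?case using f(1)[of 0] by (simp add: ok_def)
  next
    case (Suc n) then show ?case using f(2)[of n] by (simp add: next_hit_def)
  qed
  define u where "u n = f n - real n * T'" for n
  have "\<bar>u (Suc n) - u n\<bar> \<le> norm a * \<delta> * (3 / 4) ^ n" for n
  proof -
    have "u (Suc n) - u n = f (Suc n) - (f n + T')" by (simp add: u_def algebra_simps)
    then have "\<bar>u (Suc n) - u n\<bar> \<le> norm a * norm (Y (f n) - Yp 0)" using f(2)[of n] by (simp add: next_hit_def)
    also have "\<dots> \<le> norm a * (\<delta> * (3 / 4) ^ n)" by (intro mult_left_mono e) auto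
    finally show ?thesis by (simp add: mult.assoc)
  qed
  from geometric_steps_convergent[OF _ _ this] obtain \<sigma> where
    \<sigma>0: "\<forall>n. \<bar>u n - \<sigma>\<bar> \<le> norm a * \<delta> / (1 - 3 / 4) * (3 / 4) ^ n" by fastforce
  define Q where "Q = norm a * \<delta> / (1 - 3 / 4)"
  have Q: "Q \<ge> 0" using \<delta>(1) by (simp add: Q_def)
  have \<sigma>: "\<bar>u n - \<sigma>\<bar> \<le> Q * (3 / 4) ^ n" for n
    unfolding Q_def by (rule \<sigma>0[rule_format])
  have \<sigma>Q: "\<bar>u n - \<sigma>\<bar> \<le> Q" for n
    using \<sigma>[of n] mult_left_mono[of "(3 / 4 :: real) ^ n" 1 Q] Q by (simp add: power_le_one)
  define C2 where "C2 = exp (Lh * (2 * Q + T')) * \<delta> + Kh * Q"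
  have C2: "C2 \<ge> 0" using \<delta>(1) Kh(1) Q by (simp add: C2_def)
  \<comment> \<open>The rate for which \<open>exp (- \<kappa> * T') = 3 / 4\<close>: one contraction
    per return.\<close>
  define \<kappa> where "\<kappa> = - ln (3 / 4) / T'"
  have \<kappa>: "\<kappa> > 0" using T'_pos unfolding \<kappa>_def by (intro divide_pos_pos) auto
  have "norm (Y S - Yp (S + - \<sigma>)) \<le> (C2 * exp (\<kappa> * (\<sigma> + Q + T'))) * exp (- \<kappa> * S)"
    if S: "S \<ge> \<bar>\<sigma>\<bar> + Q" for S
  proof -
    \<comment> \<open>Subtracting the maximal deviation \<open>Q\<close> guarantees that the
      \<open>n\<close>-th hit is not later than \<open>S\<close>, while \<open>S - f n\<close> stays
      at most \<open>2 * Q + T'\<close>.\<close>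
    define n where "n = nat \<lfloor>(S - \<sigma> - Q) / T'\<rfloor>"
    have "(S - \<sigma> - Q) / T' \<ge> 0" using S T'_pos by (intro divide_nonneg_pos) auto
    then have "real n \<le> (S - \<sigma> - Q) / T'" "(S - \<sigma> - Q) / T' < real n + 1"
      unfolding n_def by linarith+
    then have n: "real n * T' \<le> S - \<sigma> - Q" "S - \<sigma> - Q < real n * T' + T'" "(S - \<sigma> - Q) / T' - 1 \<le> real n"
      using T'_pos by (simp_all add: field_simps)
    define s where "s = S - f n"
    have seq: "s = (S - \<sigma> - real n * T') - (u n - \<sigma>)" by (simp add: s_def u_def)
    have s: "0 \<le> s" "s \<le> 2 * Q + T'" using \<sigma>Q[of n] n(1,2) seq unfolding abs_le_iff by linarith+
    have "norm (Y (s + f n) - Yp (s + 0)) \<le> norm (Y (0 + f n) - Yp (0 + 0)) * exp (Lh * s)"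
      using f(1)[of n] s
      by (intro trajectory_stays_near[OF trajectory_shift[OF Y] trajectory_Yp]) (auto simp: ok_def)
    also have "\<dots> \<le> (\<delta> * (3 / 4) ^ n) * exp (Lh * (2 * Q + T'))"
      using e[of n] s Lh(1) \<delta>(1) by (intro mult_mono) auto
    finally have 1: "norm (Y S - Yp s) \<le> \<delta> * (3 / 4) ^ n * exp (Lh * (2 * Q + T'))" by (simp add: s_def)
    \<comment> \<open>\<open>s\<close> counts time from the actual hit, \<open>s'\<close> from its
      asymptotic position; they differ by \<open>u n - \<sigma>\<close>, again geometrically
      small.\<close>
    define s' where "s' = S - \<sigma> - real n * T'"
    have "norm (Yp s - Yp s') \<le> Kh * \<bar>u n - \<sigma>\<bar>"
    proof (cases "s \<le> s'")
      case True
      then show ?thesis using trajectory_speed[OF trajectory_Yp[of 0], of s s'] s seq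
        by (simp add: s'_def norm_minus_commute)
    next
      case False
      have "s' \<ge> 0" using n Q by (simp add: s'_def)
      then show ?thesis using trajectory_speed[OF trajectory_Yp[of 0], of s' s] False seq
        by (simp add: s'_def)
    qed
    also have "\<dots> \<le> Kh * (Q * (3 / 4) ^ n)" using \<sigma>[of n] Kh(1) by (intro mult_left_mono) auto
    finally have 2: "norm (Yp s - Yp s') \<le> Kh * (Q * (3 / 4) ^ n)" .
    have 3: "Yp s' = Yp (S + - \<sigma>)" using Yp_T'[of s' n] by (simp add: s'_def)
    have "norm (Y S - Yp (S + - \<sigma>)) \<le> norm (Y S - Yp s) + norm (Yp s - Yp s')"
      unfolding 3[symmetric] using norm_triangle_ineq[of "Y S - Yp s" "Yp s - Yp s'"] by simp
    also have "\<dots> \<le> C2 * (3 / 4) ^ n" using 1 2 by (simp add: C2_def algebra_simps)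
    also have "(3 / 4 :: real) ^ n = exp (- (\<kappa> * T') * real n)"
      using T'_pos by (simp add: \<kappa>_def exp_of_nat2_mult)
    also have "C2 * exp (- (\<kappa> * T') * real n) \<le> C2 * exp (\<kappa> * (\<sigma> + Q + T') - \<kappa> * S)"
    proof (intro mult_left_mono C2)
      have "\<kappa> * T' * ((S - \<sigma> - Q) / T' - 1) \<le> \<kappa> * T' * real n"
        using n(3) \<kappa> T'_pos by (intro mult_left_mono) auto
      moreover have "\<kappa> * T' * ((S - \<sigma> - Q) / T' - 1) = \<kappa> * S - \<kappa> * (\<sigma> + Q + T')"
        using T'_pos by (simp add: field_simps)
      ultimately show "exp (- (\<kappa> * T') * real n) \<le> exp (\<kappa> * (\<sigma> + Q + T') - \<kappa> * S)"
        by simp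
    qed
    also have "\<dots> = (C2 * exp (\<kappa> * (\<sigma> + Q + T'))) * exp (- \<kappa> * S)" by (simp add: exp_diff exp_minus field_simps)
    finally show ?thesis .
  qed
  with \<kappa> show ?thesis by blast
qed

end

theorem basin_asymptotic_phase:
  fixes F G :: "'a::euclidean_space \<Rightarrow> 'a"
  assumes reg: "is_regularization \<alpha> F G" and per: "periodic_solution F Yp T"
    and stable: "exponentially_stable F Yp T" and basin: "y \<in> basin F (orbit Yp T)"
  shows "\<exists>Y \<theta> C \<kappa> S0. ivp_solution (F_sph F) 0 y Y \<and> (\<forall>S\<ge>0. norm (Y S) = 1) \<and> \<kappa> > 0 \<and>
    (\<forall>S\<ge>S0. norm (Y S - Yp (S + \<theta>)) \<le> C * exp (- \<kappa> * S))"
proof -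
  define h where "h x = F_sph F (x /\<^sub>R norm x)" for x
  have h1: "h y = F_sph F y" if "norm y = 1" for y using that by (simp add: h_def)
  obtain D :: "'a \<Rightarrow> 'a \<Rightarrow>\<^sub>L 'a" where D: "\<And>x. norm x > 1 / 2 \<Longrightarrow> (h has_derivative blinfun_apply (D x)) (at x)"
    "continuous_on {x. norm x > 1 / 2} D"
    using F_sph_extension_C1[OF reg] unfolding h_def by blast
  interpret sphere_cycle h D Yp T
  proof
    show "h x \<bullet> x = 0" if "norm x > 1 / 2" for x
      unfolding h_def using that by (intro F_sph_extension_tangential) auto
    show "(Yp has_vector_derivative h (Yp s)) (at s)" for s
      using per by (simp add: periodic_solution_def h1)
  qed (use per D in \<open>auto simp: periodic_solution_def\<close>)
  let ?V = "tangent_space (Yp 0)"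
  have frechet: "frechet_derivative (\<lambda>x. F_sph F (x /\<^sub>R norm x)) (at (Yp s)) = blinfun_apply (A s)" for s
    using frechet_derivative_at[OF D(1)[of "Yp s"]] by (simp add: h_def[abs_def] A_def Yp_norm)
  \<comment> \<open>Uniqueness for the linearized equation gives the description in
    \<open>monodromy\<close> its value; tangency of \<open>w\<close> at time 0 makes
    \<open>\<Phi> s w\<close> tangent at all times.\<close>
  have mono: "monodromy F Yp T w = \<Phi> T w" if "w \<in> ?V" for w
  proof -
    have "(THE \<eta>. linearized_solution F Yp \<eta> \<and> \<eta> 0 = w) = (\<lambda>s. \<Phi> s w)"
    proof (rule the_equality)
      show "linearized_solution F Yp (\<lambda>s. \<Phi> s w) \<and> \<Phi> 0 w = w"
        using that unfolding linearized_solution_def frechet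
        by (auto simp: \<Phi> \<Phi>_deriv \<Phi>_tangent tangent_space_def)
    next
      fix \<eta> assume "linearized_solution F Yp \<eta> \<and> \<eta> 0 = w"
      then show "\<eta> = (\<lambda>s. \<Phi> s w)"
        unfolding linearized_solution_def frechet by (auto intro!: linear_ode_unique)
    qed
    then show ?thesis by (simp add: monodromy_def)
  qed
  have V: "subspace ?V" unfolding tangent_space_def
    using subspace_hyperplane[of "Yp 0"] by (simp add: inner_commute)
  have \<Phi>V: "blinfun_apply (\<Phi> T) ` ?V \<subseteq> ?V"
    using \<Phi>_tangent[of _ T] by (auto simp: tangent_space_def Yp_T)
  have vV: "h (Yp 0) \<in> ?V" using h_tang[of "Yp 0"] by (simp add: tangent_space_def Yp_norm)
  \<comment> \<open>The tangent space contains the nonzero velocity, so its dimension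
    \<open>DIM('a) - 1\<close> is at least 1.\<close>
  have d: "DIM('a) \<ge> 2"
  proof -
    have "dim {h (Yp 0)} \<le> dim ?V" using vV by (intro dim_subset) auto
    moreover have "Yp 0 \<noteq> 0" using Yp_norm[of 0] by force
    then have "dim ?V = DIM('a) - 1"
      unfolding tangent_space_def using dim_hyperplane[of "Yp 0"] by (simp add: inner_commute)
    ultimately show ?thesis using velocity_nonzero by (simp add: dim_insert)
  qed
  have eig: "\<And>\<mu> u v. u \<in> ?V \<Longrightarrow> v \<in> ?V \<Longrightarrow> u \<noteq> 0 \<or> v \<noteq> 0 \<Longrightarrow> \<mu> \<noteq> 0 \<Longrightarrow>
      \<Phi> T u = Re \<mu> *\<^sub>R u - Im \<mu> *\<^sub>R v \<Longrightarrow> \<Phi> T v = Im \<mu> *\<^sub>R u + Re \<mu> *\<^sub>R v \<Longrightarrow> \<mu> = 1 \<or> cmod \<mu> < 1"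
  proof -
    fix \<mu> u v assume uv: "u \<in> ?V" "v \<in> ?V" "u \<noteq> 0 \<or> v \<noteq> 0" "\<mu> \<noteq> 0"
      "\<Phi> T u = Re \<mu> *\<^sub>R u - Im \<mu> *\<^sub>R v" "\<Phi> T v = Im \<mu> *\<^sub>R u + Re \<mu> *\<^sub>R v"
    \<comment> \<open>Every nonzero multiplier has a logarithm, so it belongs to some Floquet
      exponent and the stability hypothesis applies to it.\<close>
    define m where "m = Ln \<mu> / of_real T"
    have em: "exp (m * of_real T) = \<mu>" using uv(4) T_pos by (simp add: m_def)
    have "floquet_exponent F Yp T m"
      unfolding floquet_exponent_def em Let_def using uv mono by metis
    then have "\<mu> = 1 \<or> Re m < 0" using stable em unfolding exponentially_stable_def by metis
    moreover have "cmod \<mu> = exp (Re m * T)" using norm_exp_eq_Re[of "m * of_real T"] em by simp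
    ultimately show "\<mu> = 1 \<or> cmod \<mu> < 1" using T_pos by (auto simp: mult_neg_pos)
  qed
  have mult: "dim {w \<in> ?V. ((\<lambda>z. \<Phi> T z - z) ^^ DIM('a)) w = 0} = 1"
  proof -
    \<comment> \<open>The two maps agree on tangent vectors, so the induction has to carry tangency
      of the iterates along.\<close>
    have "((\<lambda>z. monodromy F Yp T z - z) ^^ n) w = ((\<lambda>z. \<Phi> T z - z) ^^ n) w \<and> ((\<lambda>z. \<Phi> T z - z) ^^ n) w \<in> ?V"
      if "w \<in> ?V" for n w
      using that \<Phi>V V by (induction n) (auto simp: mono intro!: subspace_diff)
    then have "{w \<in> ?V. ((\<lambda>z. \<Phi> T z - z) ^^ DIM('a)) w = 0} =
        {w \<in> ?V. ((\<lambda>z. monodromy F Yp T z - z) ^^ DIM('a)) w = 0}" by auto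
    then show ?thesis using stable by (simp add: exponentially_stable_def zero_exponent_multiplicity_def)
  qed
  have lin: "linear (blinfun_apply (\<Phi> T))"
    by (intro bounded_linear.linear blinfun.bounded_linear_right)
  obtain a k where ak: "a \<in> ?V" "a \<bullet> h (Yp 0) = 1" "\<And>w. w \<in> ?V \<Longrightarrow> a \<bullet> \<Phi> T w = a \<bullet> w"
    "k > 0" "\<And>w. w \<in> ?V \<Longrightarrow> a \<bullet> w = 0 \<Longrightarrow> norm ((blinfun_apply (\<Phi> T) ^^ k) w) \<le> 1 / 2 * norm w"
    by (rule spectral_splitting[OF lin V \<Phi>V vV velocity_nonzero \<Phi>_velocity d eig mult]) blast+
  interpret contracting_cycle h D Yp T a k
    by unfold_locales (use ak in \<open>auto simp: tangent_space_def\<close>)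
  obtain Y where Y: "ivp_solution (F_sph F) 0 y Y" "\<forall>S\<ge>0. Y S \<in> sphere 0 1"
    "((\<lambda>S. infdist (Y S) (orbit Yp T)) \<longlongrightarrow> 0) at_top"
    using basin unfolding basin_def by auto
  have "trajectory Y"
    unfolding trajectory_def solution_def
  proof (intro allI conjI ballI)
    fix b t :: real
    show "continuous_on {0..b} Y"
    proof -
      have "continuous_on {0..} Y"
        using Y(1) unfolding ivp_solution_def continuous_on_eq_continuous_within
        by (auto intro: has_vector_derivative_continuous)
      then show ?thesis by (rule continuous_on_subset) auto
    qed
    show "norm (Y t) = 1" if "t \<in> {0..b}" using Y(2) that by auto
    show "(Y has_vector_derivative h (Y t)) (at t)" if "t \<in> {0<..<b}"
    proof -
      have "(Y has_vector_derivative F_sph F (Y t)) (at t within {0..})" using Y(1) that by (auto simp: ivp_solution_def)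
      moreover have "at t within {0..} = at t" using that by (intro at_within_interior) auto
      ultimately show ?thesis using Y(2) that by (simp add: h1)
    qed
  qed
  from asymptotic_phase[OF this Y(3)] obtain \<theta> C \<kappa> S0 where
    "\<kappa> > 0" "\<forall>S\<ge>S0. norm (Y S - Yp (S + \<theta>)) \<le> C * exp (- \<kappa> * S)" by blast
  moreover have "\<forall>S\<ge>0. norm (Y S) = 1" using Y(2) by simp
  ultimately show ?thesis using Y(1) by blast
qed

section \<open>The log-periodic profile\<close>

locale log_periodic_profile =
  fixes \<alpha> :: real and F :: "'a::euclidean_space \<Rightarrow> 'a" and Yp :: "real \<Rightarrow> 'a" and T :: real
  assumes \<alpha>: "\<alpha> < 1" and T_pos: "T > 0"
    and Yp_cont: "continuous_on UNIV Yp" and F_rad_cont: "continuous_on UNIV (\<lambda>s. F_rad F (Yp s))"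
    and Yp_per: "\<And>s. Yp (s + T) = Yp s" and avg_pos: "avg_F_rad F Yp T > 0"
begin

definition J where "J = oriented_integral (\<lambda>s. F_rad F (Yp s)) 0"

text \<open>The gain of the logarithmic radius over one turn of the cycle.\<close>

definition P where "P = T * avg_F_rad F Yp T"

definition w where "w s = exp ((1 - \<alpha>) * J s)"

definition q where "q = exp ((1 - \<alpha>) * P)"

text \<open>The integral of \<open>w\<close> over \<open>{..s}\<close> in closed form: since
  \<open>w (s + T) = q * w s\<close>, the part over \<open>{..0}\<close> is a geometric series of
  integrals over periods, with sum \<open>integral {0..T} w / (q - 1)\<close>.\<close>

definition W where "W s = oriented_integral w 0 s + integral {0..T} w / (q - 1)"

lemma P_pos: "P > 0"
  using T_pos avg_pos by (simp add: P_def)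

lemma q_gt_1: "q > 1"
  using P_pos \<alpha> by (simp add: q_def)

lemma J_deriv: "(J has_real_derivative F_rad F (Yp s)) (at s)"
  using oriented_integral_has_vector_derivative[OF F_rad_cont, of 0 s]
  by (simp add: J_def has_real_derivative_iff_has_vector_derivative)

lemma J_0 [simp]: "J 0 = 0"
  by (simp add: J_def)

lemma constant_if_derivative_0:
  fixes g :: "real \<Rightarrow> real"
  assumes "\<And>s. (g has_real_derivative 0) (at s)"
  shows "g s = g 0"
  using DERIV_isconst_all[of g s 0] assms by blast

lemma J_shift: "J (s + T) = J s + P"
proof -
  have d: "((\<lambda>s. J (s + T) - J s) has_real_derivative 0) (at s)" for s
    using DERIV_diff[OF DERIV_shift[THEN iffD1, OF J_deriv[of "s + T"]] J_deriv[of s]] by (simp add: Yp_per)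
  have "J (s + T) - J s = J (0 + T) - J 0" by (rule constant_if_derivative_0[OF d])
  also have "\<dots> = P" using T_pos by (simp add: J_def P_def avg_F_rad_def oriented_integral_def)
  finally show ?thesis by simp
qed

lemma I_int_eq: "I_int F Yp s1 s2 = J s2 - J s1"
proof -
  define c where "c = min 0 (min s1 s2)"
  have "oriented_integral (\<lambda>s. F_rad F (Yp s)) s1 s2 = J s2 - J s1"
    unfolding J_def by (subst (1 2 3) oriented_integral_from_left[OF F_rad_cont, of c]) (auto simp: c_def)
  then show ?thesis by (simp add: I_int_def oriented_integral_def)
qed

lemma w_pos: "w s > 0"
  by (simp add: w_def)

lemma J_cont: "continuous_on S J"
  using J_deriv by (intro continuous_at_imp_continuous_on) (auto intro: DERIV_isCont)

lemma w_cont: "continuous_on S w"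
  unfolding w_def by (intro continuous_intros J_cont)

lemma w_shift: "w (s + T) = q * w s"
  by (simp add: w_def q_def J_shift distrib_left exp_add)

lemma W_deriv: "(W has_real_derivative w s) (at s)"
  unfolding W_def using oriented_integral_has_vector_derivative[OF w_cont, of 0 s]
  by (auto intro!: derivative_eq_intros simp flip: has_real_derivative_iff_has_vector_derivative)

lemma W_cont: "continuous_on S W"
  using W_deriv by (intro continuous_at_imp_continuous_on) (auto intro: DERIV_isCont)

lemma W_strict_mono: "s < t \<Longrightarrow> W s < W t"
  using DERIV_pos_imp_increasing[of s t W] W_deriv w_pos by blast

text \<open>Both sides have the same derivative; the additive constant in \<open>W\<close> is the
  one for which they also agree at 0.\<close>

lemma W_shift: "W (s + T) = q * W s"
proof -
  have d: "((\<lambda>s. W (s + T) - q * W s) has_real_derivative 0) (at s)" for s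
    using DERIV_diff[OF DERIV_shift[THEN iffD1, OF W_deriv[of "s + T"]] DERIV_cmult[OF W_deriv[of s], of q]]
    by (simp add: w_shift)
  have "W (s + T) - q * W s = W (0 + T) - q * W 0" by (rule constant_if_derivative_0[OF d])
  also have "\<dots> = 0" using T_pos q_gt_1 by (simp add: W_def oriented_integral_def field_simps)
  finally show ?thesis by simp
qed

lemma W_shift_nat: "W (s + real n * T) = q ^ n * W s"
proof (induction n)
  case (Suc n)
  have "W (s + real (Suc n) * T) = W ((s + real n * T) + T)" by (simp add: algebra_simps)
  then show ?case using Suc by (simp add: W_shift)
qed simp

lemma W_pos: "W s > 0"
proof -
  have "(0::real) < integral {0..T} w"
  proof -
    have "W 0 < W T" using W_strict_mono T_pos by blast
    then show ?thesis using T_pos by (simp add: W_def oriented_integral_def)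
  qed
  then have W0: "W 0 > 0" using q_gt_1 by (simp add: W_def)
  obtain n where n: "real n * T > - s" using ex_less_of_nat_mult[OF T_pos] by blast
  then have "W 0 < W (s + real n * T)" by (intro W_strict_mono) simp
  then have "0 < q ^ n * W s" using W0 by (simp add: W_shift_nat)
  then show ?thesis using q_gt_1 by (simp add: zero_less_mult_iff)
qed

lemma W_at_bot: "(\<lambda>n. W (s - real n)) \<longlonglongrightarrow> 0"
proof -
  have lim: "(\<lambda>m. W s / q ^ m) \<longlonglongrightarrow> 0"
    using tendsto_mult_right_zero[OF LIMSEQ_inverse_realpow_zero[OF q_gt_1], of "W s"] by (simp add: divide_inverse)
  show ?thesis
  proof (rule LIMSEQ_I)
    fix r :: real assume "r > 0"
    from order_tendstoD(2)[OF lim this] obtain m where m: "W s / q ^ m < r"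
      using eventually_happens'[OF sequentially_bot] by blast
    have "W (s - real n) < r" if "n \<ge> nat \<lceil>real m * T\<rceil> + 1" for n
    proof -
      have "real n > real m * T" using that by linarith
      then have "W (s - real n) < W (s - real m * T)" by (intro W_strict_mono) simp
      also have "\<dots> = W s / q ^ m" using W_shift_nat[of "s - real m * T" m] q_gt_1 by simp
      finally show ?thesis using m by simp
    qed
    then show "\<exists>no. \<forall>n\<ge>no. norm (W (s - real n) - 0) < r" using W_pos by (auto simp: abs_of_pos)
  qed
qed

lemma W_at_top: "filterlim W at_top at_top"
  unfolding filterlim_at_top_gt[where c = 0]
proof (intro allI impI)
  fix Z :: real assume "Z > 0"
  obtain n where "Z / W 0 < q ^ n" using real_arch_pow[OF q_gt_1] by blast
  then have "Z < q ^ n * W 0" using W_pos[of 0] by (simp add: field_simps)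
  then have n: "Z < W (real n * T)" using W_shift_nat[of 0 n] by simp
  show "\<forall>\<^sub>F x in at_top. Z \<le> W x"
    using eventually_gt_at_top[of "real n * T"]
    by eventually_elim (use n W_strict_mono in force)
qed

text \<open>Identifies \<open>W\<close> with the improper integral inside \<open>phi_fun\<close>, by
  monotone convergence over \<open>{- real n..0}\<close>.\<close>

lemma w_has_integral: "((\<lambda>s'. w (s + s')) has_integral W s) {..0}"
proof -
  let ?f = "\<lambda>n s'. if s' \<in> {- real n..0} then w (s + s') else 0"
  have "(?f n has_integral (W s - W (s - real n))) {..0}" for n
  proof -
    have "((\<lambda>s'. w (s + s')) has_integral (W (s + 0) - W (s + - real n))) {- real n..0}"
    proof (rule fundamental_theorem_of_calculus)
      fix x
      have "((\<lambda>x. W (s + x)) has_real_derivative w (s + x)) (at x)"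
        using DERIV_shift[of W "w (x + s)" x s] W_deriv by (simp add: add.commute)
      then show "((\<lambda>x. W (s + x)) has_vector_derivative w (s + x)) (at x within {- real n..0})"
        by (simp add: has_real_derivative_iff_has_vector_derivative[symmetric] has_field_derivative_at_within)
    qed simp
    then show ?thesis by (subst has_integral_restrict) auto
  qed
  then show ?thesis
  proof (rule has_integral_monotone_convergence_increasing)
    show "?f n x \<le> ?f (Suc n) x" for n x using w_pos[of "s + x"] by auto
    show "(\<lambda>n. ?f n x) \<longlonglongrightarrow> w (s + x)" if "x \<in> {..0}" for x
    proof (rule tendsto_eventually)
      obtain n0 :: nat where "- x \<le> real n0" using real_arch_simple by blast
      then show "\<forall>\<^sub>F n in sequentially. ?f n x = w (s + x)"
        using that unfolding eventually_sequentially by (intro exI[of _ n0]) auto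
    qed
    show "(\<lambda>n. W s - W (s - real n)) \<longlonglongrightarrow> W s"
      using tendsto_diff[OF tendsto_const W_at_bot, of "W s" s] by simp
  qed
qed

text \<open>As \<open>I(s1 + s', s2) = J s2 - J (s1 + s')\<close>, the factor depending on
  \<open>s2\<close> leaves the integral and its logarithm becomes the summand
  \<open>- J s2\<close>.\<close>

lemma phi_fun_eq: "phi_fun \<alpha> F Yp s1 s2 = ln (W s1) / (1 - \<alpha>) - J s2"
proof -
  have "(\<lambda>s'. exp (- (1 - \<alpha>) * I_int F Yp (s1 + s') s2)) = (\<lambda>s'. w (s1 + s') * inverse (w s2))"
    by (simp add: I_int_eq w_def fun_eq_iff algebra_simps flip: exp_minus exp_add)
  then have "integral {..0} (\<lambda>s'. exp (- (1 - \<alpha>) * I_int F Yp (s1 + s') s2)) = W s1 * inverse (w s2)"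
    using integral_unique[OF has_integral_mult_left[OF w_has_integral[of s1], of "inverse (w s2)"]] by (simp only:)
  moreover have "ln (W s1 * inverse (w s2)) = ln (W s1) - (1 - \<alpha>) * J s2"
    using W_pos[of s1] by (subst ln_mult) (auto simp: w_def exp_minus[symmetric])
  ultimately show ?thesis using \<alpha> by (simp add: phi_fun_def field_simps)
qed

lemma psi_fun_eq: "psi_fun \<alpha> F Yp s = ln (W s) / (1 - \<alpha>)"
  by (simp add: psi_fun_def phi_fun_eq)

definition amp where "amp s = exp (J s - ln (W s) / (1 - \<alpha>))"

lemma x_p_eq: "x_p \<alpha> F Yp s = amp s *\<^sub>R Yp s"
  by (simp add: x_p_def phi_fun_eq amp_def)

lemma psi_fun_shift: "psi_fun \<alpha> F Yp (s + T) = psi_fun \<alpha> F Yp s + P"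
  using W_pos[of s] q_gt_1 \<alpha> by (simp add: psi_fun_eq W_shift ln_mult add_divide_distrib) (simp add: q_def)

lemma amp_shift: "amp (s + T) = amp s"
  using psi_fun_shift[of s] by (simp add: amp_def J_shift psi_fun_eq)

lemma ln_W_cont: "continuous_on S (\<lambda>s. ln (W s))"
  using W_pos by (intro continuous_intros W_cont) (auto simp: less_imp_neq[THEN not_sym])

lemma amp_cont: "continuous_on S amp"
  unfolding amp_def by (intro continuous_intros ln_W_cont J_cont) (use \<alpha> in auto)

lemma psi_fun_cont: "continuous_on S (psi_fun \<alpha> F Yp)"
  unfolding psi_fun_eq[abs_def] by (intro continuous_intros ln_W_cont) (use \<alpha> in auto)

lemma psi_fun_strict_mono: "strict_mono (psi_fun \<alpha> F Yp)"
  using \<alpha> W_pos W_strict_mono by (auto intro!: strict_monoI divide_strict_right_mono simp: psi_fun_eq)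

lemma psi_fun_shift_int: "psi_fun \<alpha> F Yp (s + of_int n * T) = psi_fun \<alpha> F Yp s + of_int n * P"
proof -
  \<comment> \<open>Subtracting the mean slope \<open>P / T\<close> leaves a periodic function, to
    which the shift by integers applies.\<close>
  have "psi_fun \<alpha> F Yp (x + T) - (x + T) * (P / T) = psi_fun \<alpha> F Yp x - x * (P / T)" for x
    using T_pos by (simp add: psi_fun_shift distrib_right add_divide_distrib)
  from periodic_shift_int[of "\<lambda>x. psi_fun \<alpha> F Yp x - x * (P / T)" T, OF this, of s n]
  show ?thesis using T_pos by (simp add: distrib_right add_divide_distrib)
qed

lemma psi_fun_bij: "bij (psi_fun \<alpha> F Yp)"
proof (rule bijI)
  show "inj (psi_fun \<alpha> F Yp)" using psi_fun_strict_mono by (rule strict_mono_imp_inj_on)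
  show "surj (psi_fun \<alpha> F Yp)"
    unfolding surj_def
  proof
    fix z
    let ?p = "psi_fun \<alpha> F Yp"
    \<comment> \<open>The target is first moved by whole multiples of \<open>P\<close>, so that the
      intermediate value theorem is needed on one period only.\<close>
    obtain n where n: "0 \<le> (z - ?p 0) + of_int n * P" "(z - ?p 0) + of_int n * P < P"
      using real_reduce_period[OF P_pos] .
    have "?p (of_int (- n) * T) \<le> z" "z \<le> ?p (of_int (- n) * T + T)"
      using psi_fun_shift_int[of 0 "- n"] psi_fun_shift[of "of_int (- n) * T"] n by simp_all
    then have "\<exists>x\<ge>of_int (- n) * T. x \<le> of_int (- n) * T + T \<and> ?p x = z"
      using T_pos by (intro IVT' psi_fun_cont) auto
    then show "\<exists>x. z = ?p x" by auto
  qed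
qed

lemma X_p_psi: "X_p \<alpha> F Yp (psi_fun \<alpha> F Yp s) = amp s *\<^sub>R Yp s"
  using psi_fun_bij by (simp add: X_p_def x_p_eq bij_is_inj)

lemma X_p_periodic: "X_p \<alpha> F Yp (z + P) = X_p \<alpha> F Yp z"
proof -
  obtain s where "z = psi_fun \<alpha> F Yp s" using psi_fun_bij by (metis bij_pointE)
  then show ?thesis by (simp add: X_p_psi amp_shift Yp_per flip: psi_fun_shift)
qed

lemma X_p_cont: "continuous_on UNIV (X_p \<alpha> F Yp)"
proof -
  let ?p = "psi_fun \<alpha> F Yp"
  have "continuous_on UNIV (inv ?p)"
  proof (rule continuous_at_imp_continuous_on, safe)
    fix z
    obtain s where s: "z = ?p s" using psi_fun_bij by (metis bij_pointE)
    show "isCont (inv ?p) z"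
      unfolding s
    proof (rule isCont_inverse_function[where f = ?p and d = 1])
      show "isCont ?p x" for x
        using psi_fun_cont[of UNIV] by (simp add: continuous_on_eq_continuous_at)
    qed (use psi_fun_bij in \<open>auto simp: bij_is_inj\<close>)
  qed
  then have "continuous_on UNIV (\<lambda>z. amp (inv ?p z) *\<^sub>R Yp (inv ?p z))"
    by (intro continuous_on_scaleR continuous_on_compose2[OF amp_cont[of UNIV]] continuous_on_compose2[OF Yp_cont]) auto
  then show ?thesis by (simp add: X_p_def x_p_eq[abs_def] o_def)
qed

text \<open>The argument of \<open>X_p\<close> runs to infinity in the limit; uniformity is what
  allows a vanishing phase error to be neglected there.\<close>

lemma X_p_uniformly_continuous: "uniformly_continuous_on UNIV (X_p \<alpha> F Yp)"
  by (rule periodic_continuous_uniformly_continuous[OF X_p_cont P_pos X_p_periodic])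

lemma amp_bounded: "\<exists>C>0. \<forall>s. \<bar>amp s\<bar> \<le> C"
  using periodic_continuous_bounded[OF amp_cont T_pos amp_shift] by (metis real_norm_def)

end

section \<open>Asymptotics after escape\<close>

text \<open>With \<open>E\<close> the integral of the bound over \<open>{s..}\<close>,
  \<open>D + E\<close> decreases and \<open>D - E\<close> increases, so both are bounded and squeeze
  \<open>D\<close>.\<close>

lemma tendsto_if_derivative_exp_decay:
  fixes D :: "real \<Rightarrow> real"
  assumes der: "\<And>s. s \<ge> a \<Longrightarrow> (D has_real_derivative D' s) (at s)"
    and bnd: "\<And>s. s \<ge> a \<Longrightarrow> \<bar>D' s\<bar> \<le> C * exp (- \<kappa> * s)" and "\<kappa> > 0"
  shows "\<exists>b. (D \<longlongrightarrow> b) at_top"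
proof -
  define E where "E s = C / \<kappa> * exp (- \<kappa> * s)" for s
  have dE: "(E has_real_derivative - (C * exp (- \<kappa> * s))) (at s)" for s
    unfolding E_def using \<open>\<kappa> > 0\<close> by (auto intro!: derivative_eq_intros)
  have dec: "D t + E t \<le> D s + E s" if "a \<le> s" "s \<le> t" for s t
  proof (rule DERIV_nonpos_imp_nonincreasing[where f = "\<lambda>s. D s + E s", OF that(2)])
    fix x assume "s \<le> x" "x \<le> t"
    then show "\<exists>y. ((\<lambda>s. D s + E s) has_real_derivative y) (at x) \<and> y \<le> 0"
      using DERIV_add[OF der[of x] dE[of x]] bnd[of x] that by (intro exI[of _ "D' x + - (C * exp (- \<kappa> * x))"]) auto
  qed
  have inc: "D s - E s \<le> D t - E t" if "a \<le> s" "s \<le> t" for s t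
  proof (rule DERIV_nonneg_imp_nondecreasing[where f = "\<lambda>s. D s - E s", OF that(2)])
    fix x assume "s \<le> x" "x \<le> t"
    then show "\<exists>y. ((\<lambda>s. D s - E s) has_real_derivative y) (at x) \<and> 0 \<le> y"
      using DERIV_diff[OF der[of x] dE[of x]] bnd[of x] that by (intro exI[of _ "D' x - - (C * exp (- \<kappa> * x))"]) auto
  qed
  have "C * exp (- \<kappa> * a) \<ge> 0" using bnd[of a] by linarith
  then have E: "E s \<ge> 0" for s using \<open>\<kappa> > 0\<close> by (simp add: E_def zero_le_mult_iff zero_le_divide_iff)
  define b where "b = (INF s\<in>{a..}. D s + E s)"
  have lower: "D a - E a \<le> D s + E s" if "s \<ge> a" for s
    using inc[of a s] E[of s] that by simp
  have b_le: "b \<le> D s + E s" if "s \<ge> a" for s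
    unfolding b_def using that by (intro cINF_lower) (auto intro!: bdd_belowI[of _ "D a - E a"] lower)
  have "((\<lambda>s. D s + E s) \<longlongrightarrow> b) at_top"
  proof (rule tendstoI)
    fix e :: real assume "e > 0"
    have "\<exists>s\<ge>a. D s + E s < b + e"
    proof (rule ccontr)
      assume "\<not> ?thesis"
      then have "b + e \<le> (INF s\<in>{a..}. D s + E s)" by (intro cINF_greatest) (auto simp: not_less)
      then have "b + e \<le> b" by (simp only: b_def)
      with \<open>e > 0\<close> show False by simp
    qed
    then obtain s where s: "s \<ge> a" "D s + E s < b + e" by blast
    show "\<forall>\<^sub>F t in at_top. dist (D t + E t) b < e"
      using eventually_ge_at_top[of s]
    proof eventually_elim
      case (elim t)
      then show ?case using b_le[of t] dec[of s t] s by (simp add: dist_real_def)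
    qed
  qed
  moreover have "(E \<longlongrightarrow> 0) at_top"
  proof -
    have "filterlim (\<lambda>s. - \<kappa> * s) at_bot at_top"
      using \<open>\<kappa> > 0\<close> by (intro filterlim_tendsto_neg_mult_at_bot[OF tendsto_const] filterlim_ident) auto
    then have "((\<lambda>s. exp (- \<kappa> * s)) \<longlongrightarrow> 0) at_top"
      by (rule filterlim_compose[OF exp_at_bot])
    then show ?thesis unfolding E_def by (rule tendsto_mult_right_zero)
  qed
  ultimately have "((\<lambda>s. (D s + E s) - E s) \<longlongrightarrow> b - 0) at_top" by (rule tendsto_diff)
  then show ?thesis by auto
qed

lemma uniformly_continuous_tendsto_diff:
  fixes f :: "real \<Rightarrow> 'b::real_normed_vector"
  assumes "uniformly_continuous_on UNIV f" "((\<lambda>s. x s - y s) \<longlongrightarrow> 0) Fl"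
  shows "((\<lambda>s. f (x s) - f (y s)) \<longlongrightarrow> 0) Fl"
proof (rule tendstoI)
  fix e :: real assume "e > 0"
  then obtain d where d: "d > 0" "\<And>x y. dist y x < d \<Longrightarrow> dist (f y) (f x) < e"
    using assms(1) unfolding uniformly_continuous_on_def by (metis UNIV_I)
  from tendstoD[OF assms(2) d(1)] show "\<forall>\<^sub>F s in Fl. dist (f (x s) - f (y s)) 0 < e"
    by eventually_elim (use d(2) in \<open>auto simp: dist_norm\<close>)
qed

lemma ivp_solution_deriv:
  "ivp_solution f t0 x0 x \<Longrightarrow> t > t0 \<Longrightarrow> (x has_vector_derivative f (x t)) (at t)"
proof -
  assume x: "ivp_solution f t0 x0 x" "t > t0"
  then have "(x has_vector_derivative f (x t)) (at t within {t0..})" by (auto simp: ivp_solution_def)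
  moreover have "at t within {t0..} = at t" using x by (intro at_within_interior) auto
  ultimately show ?thesis by simp
qed

lemma ivp_solution_cont: "ivp_solution f t0 x0 x \<Longrightarrow> continuous_on {t0..} x"
  unfolding ivp_solution_def continuous_on_eq_continuous_within
  by (auto intro: has_vector_derivative_continuous)

lemma log_periodic_profile_periodic_solution:
  assumes "\<alpha> < 1" and reg: "is_regularization \<alpha> F G" and per: "periodic_solution F Yp T"
    and avg: "avg_F_rad F Yp T > 0"
  shows "log_periodic_profile \<alpha> F Yp T"
proof
  obtain L where L: "L-lipschitz_on (sphere 0 1) (F_rad F)" using F_rad_lipschitz_on_sphere[OF reg] .
  show "continuous_on UNIV Yp"
    using per unfolding periodic_solution_def
    by (auto intro!: continuous_at_imp_continuous_on has_vector_derivative_continuous)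
  then show "continuous_on UNIV (\<lambda>s. F_rad F (Yp s))"
    by (rule continuous_on_compose2[OF lipschitz_on_continuous_on[OF L]])
       (use per in \<open>auto simp: periodic_solution_def\<close>)
qed (use assms in \<open>auto simp: periodic_solution_def\<close>)

theorem escape_asymptotics:
  fixes F G :: "'a::euclidean_space \<Rightarrow> 'a"
  assumes \<alpha>: "\<alpha> < 1" and reg: "is_regularization \<alpha> F G"
    and X: "rescaled_solution \<alpha> F G ystar X" and esc: "escape_time \<alpha> F ystar X \<tau>esc"
    and per: "periodic_solution F Yp T" and stable: "exponentially_stable F Yp T"
    and basin: "X \<tau>esc \<in> basin F (orbit Yp T)" and avg: "avg_F_rad F Yp T > 0"
  shows "\<exists>c. ((\<lambda>\<tau>. X \<tau> /\<^sub>R (\<tau> powr (1 / (1 - \<alpha>))) - X_p \<alpha> F Yp (ln \<tau> / (1 - \<alpha>) + c)) \<longlongrightarrow> 0) at_top"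
proof -
  define \<beta> where "\<beta> = 1 - \<alpha>"
  have \<beta>: "\<beta> > 0" using \<alpha> by (simp add: \<beta>_def)
  obtain Y \<theta> C \<kappa> S0 where Y: "ivp_solution (F_sph F) 0 (X \<tau>esc) Y" "\<And>S. S \<ge> 0 \<Longrightarrow> norm (Y S) = 1"
    and \<kappa>: "\<kappa> > 0" and decay: "\<And>S. S \<ge> S0 \<Longrightarrow> norm (Y S - Yp (S + \<theta>)) \<le> C * exp (- \<kappa> * S)"
    using basin_asymptotic_phase[OF reg per stable basin] by blast
  obtain L where L: "L-lipschitz_on (sphere 0 1) (F_rad F)" using F_rad_lipschitz_on_sphere[OF reg] .
  have L0: "L \<ge> 0" using L by (rule lipschitz_on_nonneg)
  have cF: "continuous_on (sphere 0 1) (F_rad F)" using L by (rule lipschitz_on_continuous_on)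
  have Yp1: "norm (Yp s) = 1" for s using per by (simp add: periodic_solution_def)
  interpret log_periodic_profile \<alpha> F Yp T
    by (rule log_periodic_profile_periodic_solution[OF \<alpha> reg per avg])
  \<comment> \<open>Freezing \<open>Y\<close> at its initial value for negative times makes the
    integrand continuous on the line, so that \<open>LY\<close> has a two-sided derivative at
    0.\<close>
  define fY where "fY s = F_rad F (Y (max 0 s))" for s
  have cY: "continuous_on {0..} Y" by (rule ivp_solution_cont[OF Y(1)])
  have "continuous_on UNIV (\<lambda>s. Y (max 0 s))"
    by (rule continuous_on_compose2[OF cY]) (auto intro!: continuous_intros)
  then have cfY: "continuous_on UNIV fY"
    unfolding fY_def by (rule continuous_on_compose2[OF cF]) (auto simp: Y(2))
  define LY where "LY = oriented_integral fY 0"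
  have dLY: "(LY has_real_derivative fY s) (at s)" for s
    using oriented_integral_has_vector_derivative[OF cfY, of 0 s]
    by (simp add: LY_def has_real_derivative_iff_has_vector_derivative)
  have cLY: "continuous_on S LY" for S
    using dLY by (intro continuous_at_imp_continuous_on) (auto intro: DERIV_isCont)
  define g where "g s = exp (\<beta> * LY s)" for s
  have cg: "continuous_on S g" for S unfolding g_def by (intro continuous_intros cLY)
  define \<tau> where "\<tau> s = \<tau>esc + oriented_integral g 0 s" for s
  have d\<tau>: "(\<tau> has_real_derivative g s) (at s)" for s
    unfolding \<tau>_def using oriented_integral_has_vector_derivative[OF cg, of 0 s]
    by (auto intro!: derivative_eq_intros simp flip: has_real_derivative_iff_has_vector_derivative)
  have c\<tau>: "continuous_on S \<tau>" for S
    using d\<tau> by (intro continuous_at_imp_continuous_on) (auto intro: DERIV_isCont)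
  have \<tau>_mono: "\<tau> s < \<tau> t" if "s < t" for s t
    by (rule DERIV_pos_imp_increasing[OF that, of \<tau>]) (use d\<tau> in \<open>auto simp: g_def intro!: exI\<close>)
  have \<tau>0: "\<tau> 0 = \<tau>esc" by (simp add: \<tau>_def)


  have XY: "X (\<tau> S) = exp (LY S) *\<^sub>R Y S" if S: "S \<ge> 0" for S
  proof -
    have Xs: "ivp_solution (reg_field \<alpha> F G 1) (tau_ent \<alpha> F ystar) ystar X"
      using X by (simp add: rescaled_solution_def)
    have te: "tau_ent \<alpha> F ystar < \<tau>esc" "norm (X \<tau>esc) = 1" "\<And>t. t > \<tau>esc \<Longrightarrow> norm (X t) > 1"
      using esc by (auto simp: escape_time_def)
    obtain m where m: "m \<in> {0..S}" "\<And>s. s \<in> {0..S} \<Longrightarrow> LY m \<le> LY s"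
      using continuous_attains_inf[OF compact_Icc _ cLY, of 0 S] S by auto
    \<comment> \<open>It is not known beforehand that \<open>exp (LY s) *\<^sub>R Y s\<close> stays
      outside the unit ball. Comparing in the field with \<open>\<nu>\<close> below its least radius
      on \<open>{0..S}\<close> avoids the question: there both curves see the homogeneous field,
      \<open>X\<close> because it has radius above 1 after escape.\<close>
    define \<nu> where "\<nu> = min 1 (exp (LY m)) / 2"
    have \<nu>: "\<nu> > 0" "\<nu> < 1" "\<nu> < exp (LY m)"
      using exp_gt_zero[of "LY m"] unfolding \<nu>_def by linarith+
    have ge: "\<tau> s \<ge> \<tau>esc" if "s \<ge> 0" for s using \<tau>_mono[of 0 s] \<tau>0 that by (cases "s = 0") auto
    have "C1_on UNIV (reg_field \<alpha> F G \<nu>)" using reg \<nu> by (simp add: is_regularization_def)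
    then have lip: "lipschitz_on_compacts UNIV (reg_field \<alpha> F G \<nu>)" by (rule C1_UNIV_lipschitz_on_compacts)
    show ?thesis
    proof (rule ode_uniqueness[where f = "reg_field \<alpha> F G \<nu>" and g = g and x = "\<lambda>s. X (\<tau> s)"
        and z = "\<lambda>S. exp (LY S) *\<^sub>R Y S", OF lip S])
      show "continuous_on {0..S} (\<lambda>s. X (\<tau> s))"
        by (rule continuous_on_compose2[OF ivp_solution_cont[OF Xs] c\<tau>]) (use ge te in force)
      show "continuous_on {0..S} (\<lambda>S. exp (LY S) *\<^sub>R Y S)"
        by (intro continuous_intros cLY continuous_on_subset[OF cY]) auto
      show "X (\<tau> 0) = exp (LY 0) *\<^sub>R Y 0"
        using Y(1) by (simp add: \<tau>0 LY_def ivp_solution_def)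
    next
      fix s assume s: "0 < s" "s < S"
      have "\<tau> s > \<tau>esc" using \<tau>_mono[OF s(1)] \<tau>0 by simp
      then have "norm (X (\<tau> s)) > 1" "\<tau> s > tau_ent \<alpha> F ystar" using te by auto
      moreover have "(\<tau> has_vector_derivative g s) (at s)"
        using d\<tau> by (simp add: has_real_derivative_iff_has_vector_derivative)
      ultimately show "((\<lambda>s. X (\<tau> s)) has_vector_derivative g s *\<^sub>R reg_field \<alpha> F G \<nu> (X (\<tau> s))) (at s)"
        using vector_diff_chain_at[OF _ ivp_solution_deriv[OF Xs], of \<tau> "g s" s] \<nu>
        by (simp add: o_def reg_field_outside)
      have Y1: "norm (Y s) = 1" using s by (intro Y(2)) auto
      have "exp (LY m) \<le> exp (LY s)" using m(2)[of s] s by simp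
      moreover have norm_z: "norm (exp (LY s) *\<^sub>R Y s) = exp (LY s)" using Y1 by simp
      ultimately have out: "norm (exp (LY s) *\<^sub>R Y s) > \<nu>" using \<nu> by linarith
      have "reg_field \<alpha> F G \<nu> (exp (LY s) *\<^sub>R Y s) = exp (LY s) powr \<alpha> *\<^sub>R F (Y s)"
        unfolding reg_field_outside[OF out] norm_z by simp
      moreover have "g s * exp (LY s) powr \<alpha> = exp (LY s)"
        by (simp add: g_def \<beta>_def powr_def algebra_simps flip: exp_add)
      ultimately have rf: "g s *\<^sub>R reg_field \<alpha> F G \<nu> (exp (LY s) *\<^sub>R Y s) = exp (LY s) *\<^sub>R F (Y s)"
        by simp
      have dY: "(Y has_vector_derivative F_sph F (Y s)) (at s)" by (rule ivp_solution_deriv[OF Y(1) s(1)])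
      have dexp: "((\<lambda>s. exp (LY s)) has_real_derivative exp (LY s) * fY s) (at s)"
        using dLY[of s] by (auto intro!: derivative_eq_intros)
      have "((\<lambda>s. exp (LY s) *\<^sub>R Y s) has_vector_derivative exp (LY s) *\<^sub>R F_sph F (Y s) + (exp (LY s) * fY s) *\<^sub>R Y s) (at s)"
        by (rule has_vector_derivative_scaleR[OF dexp dY])
      also have "exp (LY s) *\<^sub>R F_sph F (Y s) + (exp (LY s) * fY s) *\<^sub>R Y s = exp (LY s) *\<^sub>R F (Y s)"
        using s by (simp add: F_sph_def fY_def scaleR_diff_right)
      finally show "((\<lambda>s. exp (LY s) *\<^sub>R Y s) has_vector_derivative g s *\<^sub>R reg_field \<alpha> F G \<nu> (exp (LY s) *\<^sub>R Y s)) (at s)"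
        by (simp add: rf)
    qed (auto intro: cg)
  qed

  \<comment> \<open>The logarithmic radius relative to the cycle; its limit \<open>b\<close> is the
    only information on the past of the trajectory that survives in \<open>c\<close>.\<close>
  define D where "D s = LY s - J (s + \<theta>)" for s
  have "\<exists>b. (D \<longlongrightarrow> b) at_top"
  proof (rule tendsto_if_derivative_exp_decay)
    fix s assume s: "s \<ge> max S0 0"
    show "(D has_real_derivative fY s - F_rad F (Yp (s + \<theta>))) (at s)"
      unfolding D_def by (rule DERIV_diff[OF dLY DERIV_shift[THEN iffD1, OF J_deriv]])
    have "\<bar>fY s - F_rad F (Yp (s + \<theta>))\<bar> \<le> L * norm (Y s - Yp (s + \<theta>))"
      using lipschitz_onD[OF L, of "Y s" "Yp (s + \<theta>)"] s by (simp add: fY_def dist_norm Y(2) Yp1)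
    also have "\<dots> \<le> L * (C * exp (- \<kappa> * s))" using s L0 by (intro mult_left_mono decay) auto
    finally show "\<bar>fY s - F_rad F (Yp (s + \<theta>))\<bar> \<le> (L * C) * exp (- \<kappa> * s)" by (simp add: mult.assoc)
  qed (rule \<kappa>)
  then obtain b where b: "(D \<longlongrightarrow> b) at_top" by blast
  have shift: "filterlim (\<lambda>s. s + \<theta>) at_top at_top"
    by (rule filterlim_tendsto_add_at_top[OF tendsto_const[of \<theta>] filterlim_ident, simplified add.commute])
  have Wtop: "filterlim (\<lambda>s. W (s + \<theta>)) at_top at_top" by (rule filterlim_compose[OF W_at_top shift])
  \<comment> \<open>This form of l'Hopital's rule requires divergence of the denominator only; that
    of \<open>\<tau>\<close> is then a consequence, in \<open>\<tau>top\<close>.\<close>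
  have ratio: "((\<lambda>s. \<tau> s / W (s + \<theta>)) \<longlongrightarrow> exp (\<beta> * b)) at_top"
  proof (rule lhospital_at_top_at_top[where f' = g and g' = "\<lambda>s. w (s + \<theta>)"])
    show "((\<lambda>s. g s / w (s + \<theta>)) \<longlongrightarrow> exp (\<beta> * b)) at_top"
    proof -
      have "g s / w (s + \<theta>) = exp (\<beta> * D s)" for s
        by (simp add: g_def w_def D_def \<beta>_def[symmetric] right_diff_distrib exp_diff)
      then show ?thesis by (auto intro!: tendsto_intros b)
    qed
    show "\<forall>\<^sub>F s in at_top. ((\<lambda>s. W (s + \<theta>)) has_real_derivative w (s + \<theta>)) (at s)"
      by (intro always_eventually allI DERIV_shift[THEN iffD1, OF W_deriv])
  qed (use d\<tau> Wtop w_pos in \<open>auto simp: less_imp_neq[THEN not_sym]\<close>)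
  have \<tau>top: "filterlim \<tau> at_top at_top"
  proof -
    have "filterlim (\<lambda>s. \<tau> s / W (s + \<theta>) * W (s + \<theta>)) at_top at_top"
      by (rule filterlim_tendsto_pos_mult_at_top[OF ratio _ Wtop]) simp
    then show ?thesis using W_pos by (simp add: less_imp_neq[THEN not_sym])
  qed
  have \<tau>pos: "\<forall>\<^sub>F s in at_top. \<tau> s > 0"
    using \<tau>top by (simp add: filterlim_at_top_dense)
  \<comment> \<open>The vanishing error in replacing \<open>ln (\<tau> s) / \<beta>\<close> by
    \<open>psi_fun \<alpha> F Yp (s + \<theta>) + b\<close>; the limit of the ratio turns into the
    summand \<open>b\<close>.\<close>
  define \<delta> where "\<delta> s = ln (\<tau> s / W (s + \<theta>)) / \<beta> - b" for s
  have \<delta>: "(\<delta> \<longlongrightarrow> 0) at_top"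
  proof -
    have "((\<lambda>s. ln (\<tau> s / W (s + \<theta>)) / \<beta> - b) \<longlongrightarrow> ln (exp (\<beta> * b)) / \<beta> - b) at_top"
      using \<beta> by (intro tendsto_intros ratio) auto
    then show ?thesis using \<beta> by (simp add: \<delta>_def[abs_def])
  qed
  have ln\<tau>: "\<forall>\<^sub>F s in at_top. ln (\<tau> s) / \<beta> = psi_fun \<alpha> F Yp (s + \<theta>) + b + \<delta> s"
    using \<tau>pos
  proof eventually_elim
    case (elim s)
    then show ?case using W_pos[of "s + \<theta>"] by (simp add: \<delta>_def psi_fun_eq \<beta>_def[symmetric] ln_div diff_divide_distrib)
  qed
  \<comment> \<open>The constant \<open>c\<close> is \<open>- b\<close>: it cancels the offset of
    \<open>ln \<tau> / \<beta>\<close> against \<open>psi_fun\<close>.\<close>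
  define Q where "Q \<tau> = X \<tau> /\<^sub>R (\<tau> powr (1 / \<beta>)) - X_p \<alpha> F Yp (ln \<tau> / \<beta> + - b)" for \<tau>
  have Q\<tau>: "((\<lambda>s. Q (\<tau> s)) \<longlongrightarrow> 0) at_top"
  proof -
    \<comment> \<open>The three errors are those of radius, direction on the sphere, and argument of
      \<open>X_p\<close>.\<close>
    define e1 where "e1 s = (amp (s + \<theta>) * (exp (D s - b - \<delta> s) - 1)) *\<^sub>R Y s" for s
    define e2 where "e2 s = amp (s + \<theta>) *\<^sub>R (Y s - Yp (s + \<theta>))" for s
    define e3 where "e3 s = X_p \<alpha> F Yp (psi_fun \<alpha> F Yp (s + \<theta>) + \<delta> s) - X_p \<alpha> F Yp (psi_fun \<alpha> F Yp (s + \<theta>))" for s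
    obtain CA where CA: "CA > 0" "\<And>s. \<bar>amp s\<bar> \<le> CA" using amp_bounded by blast
    have "(e1 \<longlongrightarrow> 0) at_top"
    proof (rule Lim_null_comparison)
      show "\<forall>\<^sub>F s in at_top. norm (e1 s) \<le> CA * \<bar>exp (D s - b - \<delta> s) - 1\<bar>"
        using eventually_ge_at_top[of 0]
        by eventually_elim (auto simp: e1_def abs_mult Y(2) intro!: mult_right_mono CA)
      have "((\<lambda>s. CA * \<bar>exp (D s - b - \<delta> s) - 1\<bar>) \<longlongrightarrow> CA * \<bar>exp (b - b - 0) - 1\<bar>) at_top"
        by (intro tendsto_intros b \<delta>)
      then show "((\<lambda>s. CA * \<bar>exp (D s - b - \<delta> s) - 1\<bar>) \<longlongrightarrow> 0) at_top" by simp
    qed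
    moreover have "(e2 \<longlongrightarrow> 0) at_top"
    proof (rule Lim_null_comparison)
      show "\<forall>\<^sub>F s in at_top. norm (e2 s) \<le> CA * (C * exp (- \<kappa> * s))"
        using eventually_ge_at_top[of S0]
        by eventually_elim (use CA(1) in \<open>auto simp: e2_def intro!: mult_mono CA(2) decay[simplified]\<close>)
      have "filterlim (\<lambda>s. - \<kappa> * s) at_bot at_top"
        using \<open>\<kappa> > 0\<close> by (intro filterlim_tendsto_neg_mult_at_bot[OF tendsto_const] filterlim_ident) auto
      then have "((\<lambda>s. exp (- \<kappa> * s)) \<longlongrightarrow> 0) at_top"
        by (rule filterlim_compose[OF exp_at_bot])
      then show "((\<lambda>s. CA * (C * exp (- \<kappa> * s))) \<longlongrightarrow> 0) at_top"
        by (intro tendsto_mult_right_zero)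
    qed
    moreover have "(e3 \<longlongrightarrow> 0) at_top"
      unfolding e3_def by (rule uniformly_continuous_tendsto_diff[OF X_p_uniformly_continuous]) (simp add: \<delta>)
    ultimately have lim: "((\<lambda>s. e1 s + e2 s - e3 s) \<longlongrightarrow> 0 + 0 - 0) at_top" by (intro tendsto_intros)
    have "\<forall>\<^sub>F s in at_top. e1 s + e2 s - e3 s = Q (\<tau> s)"
      using \<tau>pos ln\<tau> eventually_ge_at_top[of 0]
    proof eventually_elim
      case (elim s)
      have "\<tau> s powr (1 / \<beta>) = exp (ln (\<tau> s) / \<beta>)" using elim(1) by (simp add: powr_def)
      then have "exp (LY s) / \<tau> s powr (1 / \<beta>) = exp (LY s - (psi_fun \<alpha> F Yp (s + \<theta>) + b + \<delta> s))"
        using elim(2) by (simp add: exp_diff)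
      also have "\<dots> = amp (s + \<theta>) * exp (D s - b - \<delta> s)"
        by (simp add: amp_def D_def psi_fun_eq flip: exp_add)
      finally have "X (\<tau> s) /\<^sub>R (\<tau> s powr (1 / \<beta>)) = (amp (s + \<theta>) * exp (D s - b - \<delta> s)) *\<^sub>R Y s"
        using XY[OF elim(3)] by (simp add: divide_inverse mult.commute)
      moreover have "X_p \<alpha> F Yp (ln (\<tau> s) / \<beta> + - b) = amp (s + \<theta>) *\<^sub>R Yp (s + \<theta>) + e3 s"
        using elim(2) by (simp add: e3_def X_p_psi add.assoc)
      ultimately show ?case
        by (simp add: Q_def e1_def e2_def algebra_simps)
    qed
    from Lim_transform_eventually[OF lim this] show ?thesis by simp
  qed
  have "(Q \<longlongrightarrow> 0) at_top"
  proof (rule tendstoI)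
    fix e :: real assume "e > 0"
    from tendstoD[OF Q\<tau> this] obtain S1 where S1: "\<And>s. s \<ge> S1 \<Longrightarrow> dist (Q (\<tau> s)) 0 < e"
      unfolding eventually_at_top_linorder by blast
    \<comment> \<open>The limit is known along \<open>\<tau> s\<close>; by continuity and divergence
      of \<open>\<tau>\<close>, every \<open>t\<close> beyond \<open>\<tau> S1\<close> is such a
      value with \<open>s \<ge> S1\<close>.\<close>
    have "dist (Q t) 0 < e" if t: "t \<ge> \<tau> S1" for t
    proof -
      have "\<forall>\<^sub>F s in at_top. t \<le> \<tau> s \<and> S1 \<le> s"
        using \<tau>top eventually_ge_at_top[of S1] by (auto simp: filterlim_at_top intro: eventually_conj)
      then obtain S2 where "t \<le> \<tau> S2" "S1 \<le> S2" using eventually_happens'[OF trivial_limit_at_top_linorder] by blast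
      then have "\<exists>s\<ge>S1. s \<le> S2 \<and> \<tau> s = t" using t by (intro IVT' c\<tau>) auto
      then show ?thesis using S1 by auto
    qed
    then show "\<forall>\<^sub>F t in at_top. dist (Q t) 0 < e" unfolding eventually_at_top_linorder by blast
  qed
  then show ?thesis unfolding Q_def \<beta>_def by blast
qed

section \<open>The regularized solutions\<close>

lemma reg_field_scale:
  assumes "\<nu> > 0"
  shows "reg_field \<alpha> F G \<nu> (\<nu> *\<^sub>R x) = \<nu> powr \<alpha> *\<^sub>R reg_field \<alpha> F G 1 x"
proof -
  have "(\<nu> *\<^sub>R x) /\<^sub>R norm (\<nu> *\<^sub>R x) = x /\<^sub>R norm x" using assms by simp
  moreover have "norm (\<nu> *\<^sub>R x) = \<nu> * norm x" using assms by simp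
  ultimately show ?thesis
    using assms by (simp add: reg_field_def powr_mult del: scaleR_scaleR) auto
qed

locale regularized_blowup =
  fixes \<alpha> t0 r0 tb :: real and F G :: "'a::euclidean_space \<Rightarrow> 'a" and ystar :: 'a
    and x\<nu> :: "real \<Rightarrow> real \<Rightarrow> 'a" and X :: "real \<Rightarrow> 'a"
  assumes \<alpha>: "\<alpha> < 1" and reg: "is_regularization \<alpha> F G" and r0: "r0 > 0"
    and ystar: "norm ystar = 1" "F_sph F ystar = 0" "F_rad F ystar < 0"
    and x\<nu>: "\<And>\<nu>. \<nu> > 0 \<Longrightarrow> ivp_solution (reg_field \<alpha> F G \<nu>) t0 (r0 *\<^sub>R ystar) (x\<nu> \<nu>)"
    and tb: "tb = t0 + r0 powr (1 - \<alpha>) / ((\<alpha> - 1) * F_rad F ystar)"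
    and X: "rescaled_solution \<alpha> F G ystar X"
begin

definition k where "k = (1 - \<alpha>) * (- F_rad F ystar)"

lemma k_pos: "k > 0"
  using \<alpha> ystar by (simp add: k_def mult_pos_neg)

definition radius where "radius t = (k * (tb - t)) powr (1 / (1 - \<alpha>))"

text \<open>The time at which \<open>radius\<close> equals \<open>\<nu>\<close>.\<close>

definition t_ent where "t_ent \<nu> = tb - \<nu> powr (1 - \<alpha>) / k"

lemma tb_eq: "tb = t0 + r0 powr (1 - \<alpha>) / k"
  using tb by (simp add: k_def algebra_simps)

lemma t_ent_less_tb: "\<nu> > 0 \<Longrightarrow> t_ent \<nu> < tb"
  using k_pos by (simp add: t_ent_def)

lemma lipschitz: "\<nu> > 0 \<Longrightarrow> lipschitz_on_compacts UNIV (reg_field \<alpha> F G \<nu>)"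
  using reg by (intro C1_UNIV_lipschitz_on_compacts) (auto simp: is_regularization_def)

lemma radius_gt:
  assumes "\<nu> > 0" "t < t_ent \<nu>"
  shows "radius t > \<nu>"
proof -
  have "\<nu> powr (1 - \<alpha>) < k * (tb - t)" using assms k_pos by (simp add: t_ent_def field_simps)
  then have "(\<nu> powr (1 - \<alpha>)) powr (1 / (1 - \<alpha>)) < radius t"
    unfolding radius_def using \<alpha> by (intro powr_less_mono2) auto
  then show ?thesis using assms \<alpha> by (simp add: powr_powr)
qed

lemma before_entry:
  assumes \<nu>: "\<nu> > 0" and t: "t0 \<le> t" "t \<le> t_ent \<nu>"
  shows "x\<nu> \<nu> t = radius t *\<^sub>R ystar"
proof (rule ode_uniqueness[where f = "reg_field \<alpha> F G \<nu>" and g = "\<lambda>_. 1", OF lipschitz[OF \<nu>] t(1)])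
  have lt: "t < tb" using t t_ent_less_tb[OF \<nu>] by simp
  show "continuous_on {t0..t} (x\<nu> \<nu>)"
    by (rule continuous_on_subset[OF ivp_solution_cont[OF x\<nu>[OF \<nu>]]]) auto
  show "continuous_on {t0..t} (\<lambda>t. radius t *\<^sub>R ystar)"
    unfolding radius_def using lt k_pos by (intro continuous_intros) auto
  have "k * (tb - t0) = r0 powr (1 - \<alpha>)" using k_pos tb_eq by simp
  then have "radius t0 = r0" using r0 \<alpha> by (simp add: radius_def powr_powr)
  then show "x\<nu> \<nu> t0 = radius t0 *\<^sub>R ystar"
    using x\<nu>[OF \<nu>] by (simp add: ivp_solution_def)
  fix s assume s: "t0 < s" "s < t"
  show "(x\<nu> \<nu> has_vector_derivative 1 *\<^sub>R reg_field \<alpha> F G \<nu> (x\<nu> \<nu> s)) (at s)"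
    using ivp_solution_deriv[OF x\<nu>[OF \<nu>] s(1)] by simp
  have u: "k * (tb - s) > 0" using s lt k_pos by simp
  have rad: "radius s > \<nu>" using s t \<nu> by (intro radius_gt) auto
  have "((\<lambda>t. (k * (tb - t)) powr (1 / (1 - \<alpha>))) has_real_derivative
      (1 / (1 - \<alpha>)) * (k * (tb - s)) powr (1 / (1 - \<alpha>) - 1) * (- k)) (at s)"
    using u by (auto intro!: derivative_eq_intros)
  also have "1 / (1 - \<alpha>) - 1 = (1 / (1 - \<alpha>)) * \<alpha>" using \<alpha> by (simp add: field_simps)
  also have "(k * (tb - s)) powr ((1 / (1 - \<alpha>)) * \<alpha>) = radius s powr \<alpha>"
    by (simp add: radius_def powr_powr)
  also have "1 / (1 - \<alpha>) * radius s powr \<alpha> * (- k) = radius s powr \<alpha> * F_rad F ystar"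
    using \<alpha> by (simp add: k_def)
  finally have "(radius has_real_derivative radius s powr \<alpha> * F_rad F ystar) (at s)"
    unfolding radius_def[abs_def] .
  from has_vector_derivative_scaleR[OF this has_vector_derivative_const[of ystar]]
  have d: "((\<lambda>t. radius t *\<^sub>R ystar) has_vector_derivative (radius s powr \<alpha> * F_rad F ystar) *\<^sub>R ystar) (at s)"
    by simp
  have "F ystar = F_rad F ystar *\<^sub>R ystar" using ystar(2) by (simp add: F_sph_def)
  then have "reg_field \<alpha> F G \<nu> (radius s *\<^sub>R ystar) = (radius s powr \<alpha> * F_rad F ystar) *\<^sub>R ystar"
    using rad \<nu> ystar(1) by (simp add: reg_field_outside)
  with d show "((\<lambda>t. radius t *\<^sub>R ystar) has_vector_derivative 1 *\<^sub>R reg_field \<alpha> F G \<nu> (radius s *\<^sub>R ystar)) (at s)"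
    by simp
qed auto

text \<open>The time scale \<open>\<nu> powr (1 - \<alpha>)\<close> matches the homogeneity of the
  field and takes \<open>t_ent \<nu>\<close> to \<open>tau_ent\<close>, where both sides equal
  \<open>\<nu> *\<^sub>R ystar\<close>. The condition \<open>\<nu> \<le> r0\<close> puts the entry
  no earlier than \<open>t0\<close>.\<close>

lemma after_entry:
  assumes \<nu>: "\<nu> > 0" "\<nu> \<le> r0" and t: "t_ent \<nu> \<le> t"
  shows "x\<nu> \<nu> t = \<nu> *\<^sub>R X ((t - tb) / \<nu> powr (1 - \<alpha>))"
proof (rule ode_uniqueness[where f = "reg_field \<alpha> F G \<nu>" and g = "\<lambda>_. 1", OF lipschitz[OF \<nu>(1)] t])
  have Xs: "ivp_solution (reg_field \<alpha> F G 1) (tau_ent \<alpha> F ystar) ystar X"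
    using X by (simp add: rescaled_solution_def)
  define p where "p = \<nu> powr (1 - \<alpha>)"
  have p: "p > 0" using \<nu> by (simp add: p_def)
  have tau: "tau_ent \<alpha> F ystar = - 1 / k"   proof -
    have "F_rad F ystar * (\<alpha> - 1) = k" by (simp add: k_def algebra_simps)
    then show ?thesis by (simp add: tau_ent_def)
  qed
  have ent: "(t_ent \<nu> - tb) / p = - 1 / k" using p by (simp add: t_ent_def p_def)
  have "p \<le> r0 powr (1 - \<alpha>)" unfolding p_def using \<nu> \<alpha> by (intro powr_mono2) auto
  then have "p / k \<le> r0 powr (1 - \<alpha>) / k" using k_pos by (simp add: divide_right_mono)
  then have t0: "t0 \<le> t_ent \<nu>" using tb_eq unfolding t_ent_def p_def by linarith
  have ge: "(s - tb) / p \<ge> tau_ent \<alpha> F ystar" if "s \<ge> t_ent \<nu>" for s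
    unfolding tau ent[symmetric] using that p by (simp add: divide_right_mono)
  show "continuous_on {t_ent \<nu>..t} (x\<nu> \<nu>)"
    by (rule continuous_on_subset[OF ivp_solution_cont[OF x\<nu>[OF \<nu>(1)]]]) (use t0 in auto)
  have "continuous_on {t_ent \<nu>..t} (\<lambda>s. X ((s - tb) / p))"
    by (rule continuous_on_compose2[OF ivp_solution_cont[OF Xs]]) (use p ge in \<open>auto intro!: continuous_intros\<close>)
  then show "continuous_on {t_ent \<nu>..t} (\<lambda>s. \<nu> *\<^sub>R X ((s - tb) / \<nu> powr (1 - \<alpha>)))"
    unfolding p_def by (intro continuous_intros)
  have "radius (t_ent \<nu>) = \<nu>"
    using k_pos \<nu> \<alpha> by (simp add: radius_def t_ent_def powr_powr)
  then show "x\<nu> \<nu> (t_ent \<nu>) = \<nu> *\<^sub>R X ((t_ent \<nu> - tb) / \<nu> powr (1 - \<alpha>))"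
    using before_entry[OF \<nu>(1) t0 order_refl] Xs ent tau by (simp add: ivp_solution_def p_def)
  fix s assume s: "t_ent \<nu> < s" "s < t"
  show "(x\<nu> \<nu> has_vector_derivative 1 *\<^sub>R reg_field \<alpha> F G \<nu> (x\<nu> \<nu> s)) (at s)"
    using ivp_solution_deriv[OF x\<nu>[OF \<nu>(1)], of s] s t0 by simp
  have "(s - tb) / p > tau_ent \<alpha> F ystar"
    unfolding tau ent[symmetric] using s p by (simp add: divide_strict_right_mono)
  then have dX: "(X has_vector_derivative reg_field \<alpha> F G 1 (X ((s - tb) / p))) (at ((s - tb) / p))"
    by (rule ivp_solution_deriv[OF Xs])
  have "((\<lambda>s. (s - tb) / p) has_vector_derivative 1 / p) (at s)"
    using p by (auto intro!: derivative_eq_intros simp flip: has_real_derivative_iff_has_vector_derivative)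
  from bounded_linear.has_vector_derivative[OF bounded_linear_scaleR_right vector_diff_chain_at[OF this dX], of \<nu>]
  have "((\<lambda>s. \<nu> *\<^sub>R X ((s - tb) / p)) has_vector_derivative \<nu> *\<^sub>R ((1 / p) *\<^sub>R reg_field \<alpha> F G 1 (X ((s - tb) / p)))) (at s)"
    unfolding o_def .
  moreover have "\<nu> * (1 / p) = \<nu> powr \<alpha>"
    using \<nu> by (simp add: p_def powr_diff)
  ultimately show "((\<lambda>s. \<nu> *\<^sub>R X ((s - tb) / \<nu> powr (1 - \<alpha>))) has_vector_derivative
      1 *\<^sub>R reg_field \<alpha> F G \<nu> (\<nu> *\<^sub>R X ((s - tb) / \<nu> powr (1 - \<alpha>)))) (at s)"
    using \<nu> by (simp add: reg_field_scale p_def)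
qed auto

end

theorem theorem5:
  fixes \<alpha> t0 r0 tb T \<tau>esc :: real
    and F G :: "'a::euclidean_space \<Rightarrow> 'a"
    and ystar :: 'a
    and x\<nu> :: "real \<Rightarrow> real \<Rightarrow> 'a"
    and X Yp :: "real \<Rightarrow> 'a"
  assumes "\<alpha> < 1"
    and "C1_on (sphere 0 1) F"
    and "is_regularization \<alpha> F G"
    and "r0 > 0" and "ystar \<in> sphere 0 1"
    and "F_sph F ystar = 0" and "F_rad F ystar < 0"
    and "\<And>\<nu>. \<nu> > 0 \<Longrightarrow> ivp_solution (reg_field \<alpha> F G \<nu>) t0 (r0 *\<^sub>R ystar) (x\<nu> \<nu>)"
    and "tb = t0 + r0 powr (1 - \<alpha>) / ((\<alpha> - 1) * F_rad F ystar)"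
    and "rescaled_solution \<alpha> F G ystar X"
    and "escape_time \<alpha> F ystar X \<tau>esc"
    and "periodic_solution F Yp T"
    and "exponentially_stable F Yp T"
    and "X \<tau>esc \<in> basin F (orbit Yp T)"
    and "avg_F_rad F Yp T > 0"
  shows "(\<forall>z. X_p \<alpha> F Yp (z + T * avg_F_rad F Yp T) = X_p \<alpha> F Yp z) \<and>
    (\<exists>c. \<forall>chi. \<exists>x :: real \<Rightarrow> 'a.
      (\<forall>t\<ge>t0. (\<lambda>n. x\<nu> (exp (- T * avg_F_rad F Yp T * real n + chi)) t) \<longlonglongrightarrow> x t) \<and>
      (\<forall>t>tb. x t = (t - tb) powr (1 / (1 - \<alpha>)) *\<^sub>R
          X_p \<alpha> F Yp (ln ((t - tb) powr (1 / (1 - \<alpha>))) + (c - chi))))"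
proof -
  interpret regularized_blowup \<alpha> t0 r0 tb F G ystar x\<nu> X
    by unfold_locales (use assms in auto)
  interpret log_periodic_profile \<alpha> F Yp T
    using assms by (intro log_periodic_profile_periodic_solution) auto
  define \<beta> where "\<beta> = 1 - \<alpha>"
  have \<beta>: "\<beta> > 0" using \<alpha> by (simp add: \<beta>_def)
  obtain c where c: "((\<lambda>\<tau>. X \<tau> /\<^sub>R (\<tau> powr (1 / \<beta>)) - X_p \<alpha> F Yp (ln \<tau> / \<beta> + c)) \<longlongrightarrow> 0) at_top"
    using escape_asymptotics[of \<alpha> F G ystar X \<tau>esc Yp T] assms unfolding \<beta>_def by blast
  have X_p_shift: "X_p \<alpha> F Yp (z + real n * P) = X_p \<alpha> F Yp z" for z n
    by (rule periodic_shift_nat) (rule X_p_periodic)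
  have "\<exists>x. (\<forall>t\<ge>t0. (\<lambda>n. x\<nu> (exp (- T * avg_F_rad F Yp T * real n + chi)) t) \<longlonglongrightarrow> x t) \<and>
      (\<forall>t>tb. x t = (t - tb) powr (1 / (1 - \<alpha>)) *\<^sub>R
          X_p \<alpha> F Yp (ln ((t - tb) powr (1 / (1 - \<alpha>))) + (c - chi)))" for chi
  proof -
    define \<nu> where "\<nu> n = exp (- T * avg_F_rad F Yp T * real n + chi)" for n
    have \<nu>pos: "\<nu> n > 0" for n by (simp add: \<nu>_def)
    have ln\<nu>: "ln (\<nu> n) = chi - real n * P" for n by (simp add: \<nu>_def P_def)
    have \<nu>lim: "\<nu> \<longlonglongrightarrow> 0"
    proof -
      have "filterlim (\<lambda>n. - P * real n) at_bot sequentially"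
        using P_pos by (intro filterlim_tendsto_neg_mult_at_bot[OF tendsto_const _ filterlim_real_sequentially]) auto
      then have "(\<lambda>n. exp (- P * real n)) \<longlonglongrightarrow> 0" by (rule filterlim_compose[OF exp_at_bot])
      then have "(\<lambda>n. exp (- P * real n) * exp chi) \<longlonglongrightarrow> 0" by (rule tendsto_mult_left_zero)
      then show ?thesis by (simp add: \<nu>_def[abs_def] P_def mult.assoc flip: exp_add)
    qed
    have \<nu>\<beta>lim: "(\<lambda>n. \<nu> n powr \<beta>) \<longlonglongrightarrow> 0"
      using tendsto_powr2[OF \<nu>lim tendsto_const[of \<beta>]] \<nu>pos \<beta> by (simp add: less_imp_le)
    have small: "\<forall>\<^sub>F n in sequentially. \<nu> n \<le> r0"
      using order_tendstoD(2)[OF \<nu>lim r0] by eventually_elim simp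
    \<comment> \<open>At \<open>tb\<close> the rescaled time is 0 whatever \<open>\<nu>\<close> is,
      so the solution there equals \<open>\<nu> *\<^sub>R X 0\<close> for small \<open>\<nu>\<close>
      and tends to 0.\<close>
    define x where "x t = (if t < tb then radius t *\<^sub>R ystar else if t = tb then 0 else
      (t - tb) powr (1 / \<beta>) *\<^sub>R X_p \<alpha> F Yp (ln ((t - tb) powr (1 / \<beta>)) + (c - chi)))" for t
    have "(\<lambda>n. x\<nu> (\<nu> n) t) \<longlonglongrightarrow> x t" if t: "t \<ge> t0" for t
    proof -
      consider "t < tb" | "t = tb" | "t > tb" by linarith
      then show ?thesis
      proof cases
        case 1
        have "\<forall>\<^sub>F n in sequentially. \<nu> n powr \<beta> < k * (tb - t)"
          using 1 k_pos by (intro order_tendstoD(2)[OF \<nu>\<beta>lim]) simp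
        then have "\<forall>\<^sub>F n in sequentially. x\<nu> (\<nu> n) t = radius t *\<^sub>R ystar"
        proof eventually_elim
          case (elim n)
          then have "t \<le> t_ent (\<nu> n)" using k_pos by (simp add: t_ent_def \<beta>_def[symmetric] field_simps)
          then show ?case by (rule before_entry[OF \<nu>pos t])
        qed
        then show ?thesis using 1 by (simp add: x_def tendsto_eventually)
      next
        case 2
        have "(\<lambda>n. \<nu> n *\<^sub>R X 0) \<longlonglongrightarrow> 0 *\<^sub>R X 0" by (intro tendsto_intros \<nu>lim)
        moreover have "\<forall>\<^sub>F n in sequentially. \<nu> n *\<^sub>R X 0 = x\<nu> (\<nu> n) t"
          using small
        proof eventually_elim
          case (elim n)
          then show ?case using after_entry[OF \<nu>pos elim, of t] t_ent_less_tb[OF \<nu>pos, of n] 2 by simp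
        qed
        ultimately show ?thesis using 2 by (auto simp: x_def intro: Lim_transform_eventually)
      next
        case 3
        define \<tau> where "\<tau> n = (t - tb) / \<nu> n powr \<beta>" for n
        have \<tau>top: "filterlim \<tau> at_top sequentially"
        proof -
          have "filterlim (\<lambda>n. inverse (\<nu> n powr \<beta>)) at_top sequentially"
            using \<nu>pos by (intro filterlim_inverse_at_top \<nu>\<beta>lim always_eventually) (auto simp: less_imp_neq[THEN not_sym])
          then show ?thesis
            unfolding \<tau>_def divide_inverse using 3
            by (intro filterlim_tendsto_pos_mult_at_top[OF tendsto_const]) auto
        qed
        define A where "A = (t - tb) powr (1 / \<beta>)"
        have A: "A > 0" using 3 by (simp add: A_def)
        have \<tau>pow: "\<tau> n powr (1 / \<beta>) = A / \<nu> n" for n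
          using 3 \<nu>pos[of n] \<beta> by (simp add: \<tau>_def A_def powr_divide powr_powr)
        \<comment> \<open>The time scale contributes
          \<open>- ln (\<nu> n) = real n * P - chi\<close>: the first term is a whole number of
          periods of \<open>X_p\<close>, the second remains as the phase.\<close>
        have ln\<tau>: "ln (\<tau> n) / \<beta> + c = ln A + (c - chi) + real n * P" for n
        proof -
          have "ln (\<tau> n) = ln (t - tb) - \<beta> * ln (\<nu> n)"
            unfolding \<tau>_def using 3 \<nu>pos[of n] by (subst ln_div) (auto simp: ln_powr)
          then show ?thesis using 3 \<beta> by (simp add: A_def ln_powr ln\<nu> diff_divide_distrib)
        qed
        have "(\<lambda>n. X (\<tau> n) /\<^sub>R (\<tau> n powr (1 / \<beta>)) - X_p \<alpha> F Yp (ln (\<tau> n) / \<beta> + c)) \<longlonglongrightarrow> 0"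
          by (rule filterlim_compose[OF c \<tau>top])
        then have "(\<lambda>n. X (\<tau> n) /\<^sub>R (A / \<nu> n) - X_p \<alpha> F Yp (ln A + (c - chi))) \<longlonglongrightarrow> 0"
          by (simp only: \<tau>pow ln\<tau> X_p_shift)
        then have "(\<lambda>n. X (\<tau> n) /\<^sub>R (A / \<nu> n)) \<longlonglongrightarrow> X_p \<alpha> F Yp (ln A + (c - chi))"
          by (simp add: LIM_zero_iff)
        then have "(\<lambda>n. A *\<^sub>R (X (\<tau> n) /\<^sub>R (A / \<nu> n))) \<longlonglongrightarrow> A *\<^sub>R X_p \<alpha> F Yp (ln A + (c - chi))"
          by (intro tendsto_intros)
        then have lim: "(\<lambda>n. \<nu> n *\<^sub>R X (\<tau> n)) \<longlonglongrightarrow> x t"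
          using A 3 by (simp add: x_def A_def)
        have "\<forall>\<^sub>F n in sequentially. \<nu> n *\<^sub>R X (\<tau> n) = x\<nu> (\<nu> n) t"
          using small
        proof eventually_elim
          case (elim n)
          then show ?case using after_entry[OF \<nu>pos elim, of t] t_ent_less_tb[OF \<nu>pos, of n] 3
            by (simp add: \<tau>_def \<beta>_def)
        qed
        then show ?thesis by (rule Lim_transform_eventually[OF lim])
      qed
    qed
    then show ?thesis
      by (intro exI[of _ x]) (auto simp: \<nu>_def x_def \<beta>_def)
  qed
  then show ?thesis using X_p_periodic unfolding P_def by blast
qed

end
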